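(* Let $\mathcal M$ be a model of $T_{FPL}$. For all $x,y\in\mathcal M$, $$d(x,x+y)\le 2\,d_{Haus}(\Gamma(x),\Gamma(y)).$$ Consequently, for all $x,y\in\mathcal M$, $$d(x,y)\le 4\,d_{Haus}(\Gamma(x),\Gamma(y))\le 4\,d(x,y).$$
   Context: We use continuous first-order logic of metric structures. The language $\mathfrak L$ has one sort (a complete metric space of diameter $1$), constants $0,1$, and a binary function symbol $+$ that is contractive for the $\ell^1$-metric on pairs. For $n\ge2$, $P_n$ is the lattice of partitions of $\{1,\dots,n\}$ ordered by refinement ($x\le y$ iff every block of $x$ is contained in a block of $y$), with join $+$, minimal element $0$, maximal element $1$, and metric $d(x,y)=\frac{\#x+\#y-2\#(x+y)}{n-1}$, where $\#x$ is the number of blocks. $T_{FPL}$ is the set of all $\mathfrak L$-sentences $\sigma$ with $\sigma^{P_n}=0$ for all $n\ge2$; $\mathcal M\models T_{FPL}$ means $\sigma^{\mathcal M}=0$ for all $\sigma\in T_{FPL}$. Every model $\mathcal M$ of $T_{FPL}$ is a complete lattice under the order $x\le y\iff x+y=y$, with join $+$; its meet (greatest lower bound) is written $xy$. Put $|x|=d(x,0)$. An element $y\in\mathcal M$ is metrically modular if $|x+y|+|xy|=|x|+|y|$ for all $x\in\mathcal M$. A selector for $x\in\mathcal M$ is a metrically modular $y\in\mathcal M$ with $x+y=1$ and $xy=0$. $\Gamma(x)$ denotes the set of all selectors of $x$ in $\mathcal M$ (it is nonempty for every $x$). For subsets $A,B$ of a metric space, $d_{Haus}(A,B)=\max\{\sup_{a\in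 A}d(a,B),\sup_{b\in B}d(b,A)\}$. *)

theory Defs
  imports "HOL-Analysis.Analysis" "HOL-Algebra.Lattice" "HOL-Library.Disjoint_Sets"
begin

section \<open>Metric structures for the language with symbols 0, 1, +\<close>

record 'a fpl_str = "'a partial_object" +
  ldist :: "'a \<Rightarrow> 'a \<Rightarrow> real"
  lzero :: 'a
  lone :: 'a
  lplus :: "'a \<Rightarrow> 'a \<Rightarrow> 'a"

text \<open>As usual in continuous logic, the diameter is required to be bounded by 1. In the models
  below it is equal to 1, because the value of \<open>1 - d(0, 1)\<close> is 0 in every partition
  lattice.\<close>

locale fpl_structure = Metric_space "carrier M" "ldist M" for M :: "'a fpl_str" +
  assumes complete: "mcomplete"
    and diameter: "\<lbrakk>x \<in> carrier M; y \<in> carrier M\<rbrakk> \<Longrightarrow> ldist M x y \<le> 1"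
    and lzero_closed: "lzero M \<in> carrier M"
    and lone_closed: "lone M \<in> carrier M"
    and lplus_closed: "\<lbrakk>x \<in> carrier M; y \<in> carrier M\<rbrakk> \<Longrightarrow> lplus M x y \<in> carrier M"
    and lplus_contractive:
      "\<lbrakk>x \<in> carrier M; y \<in> carrier M; x' \<in> carrier M; y' \<in> carrier M\<rbrakk>
        \<Longrightarrow> ldist M (lplus M x y) (lplus M x' y') \<le> ldist M x x' + ldist M y y'"

section \<open>Continuous first-order logic\<close>

datatype trm = Var nat | Zero | One | Plus trm trm

text \<open>A \<open>k\<close>-ary connective is a continuous function \<open>[0,1]^k \<rightarrow> [0,1]\<close>. The cube
  is encoded as the extensional function space \<open>{..<k} \<rightarrow> [0,1]\<close> with the product topology;
  the constraint is imposed in \<open>wff\<close>, where \<open>k\<close> is the number of arguments.\<close>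

datatype fml =
    Dist trm trm
  | Conn "(nat \<Rightarrow> real) \<Rightarrow> real" "fml list"
  | FSup nat fml
  | FInf nat fml

definition unit_cube :: "nat \<Rightarrow> (nat \<Rightarrow> real) set"
  where "unit_cube k = ({..<k} \<rightarrow>\<^sub>E {0..1})"

definition connective :: "nat \<Rightarrow> ((nat \<Rightarrow> real) \<Rightarrow> real) \<Rightarrow> bool"
  where "connective k u \<longleftrightarrow> continuous_on (unit_cube k) u \<and> u ` unit_cube k \<subseteq> {0..1}"

fun wff :: "fml \<Rightarrow> bool" where
  "wff (Dist s t) \<longleftrightarrow> True"
| "wff (Conn u fs) \<longleftrightarrow> connective (length fs) u \<and> (\<forall>f \<in> set fs. wff f)"
| "wff (FSup v f) \<longleftrightarrow> wff f"
| "wff (FInf v f) \<longleftrightarrow> wff f"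

fun trm_vars :: "trm \<Rightarrow> nat set" where
  "trm_vars (Var v) = {v}"
| "trm_vars Zero = {}"
| "trm_vars One = {}"
| "trm_vars (Plus s t) = trm_vars s \<union> trm_vars t"

fun free_vars :: "fml \<Rightarrow> nat set" where
  "free_vars (Dist s t) = trm_vars s \<union> trm_vars t"
| "free_vars (Conn u fs) = (\<Union>f \<in> set fs. free_vars f)"
| "free_vars (FSup v f) = free_vars f - {v}"
| "free_vars (FInf v f) = free_vars f - {v}"

definition sentence :: "fml \<Rightarrow> bool"
  where "sentence f \<longleftrightarrow> wff f \<and> free_vars f = {}"

fun trm_val :: "'a fpl_str \<Rightarrow> trm \<Rightarrow> (nat \<Rightarrow> 'a) \<Rightarrow> 'a" where
  "trm_val M (Var v) e = e v"
| "trm_val M Zero e = lzero M"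
| "trm_val M One e = lone M"
| "trm_val M (Plus s t) e = lplus M (trm_val M s e) (trm_val M t e)"

fun fml_val :: "'a fpl_str \<Rightarrow> fml \<Rightarrow> (nat \<Rightarrow> 'a) \<Rightarrow> real" where
  "fml_val M (Dist s t) e = ldist M (trm_val M s e) (trm_val M t e)"
| "fml_val M (Conn u fs) e = u (\<lambda>i \<in> {..<length fs}. map (\<lambda>f. fml_val M f e) fs ! i)"
| "fml_val M (FSup v f) e = (SUP a \<in> carrier M. fml_val M f (e(v := a)))"
| "fml_val M (FInf v f) e = (INF a \<in> carrier M. fml_val M f (e(v := a)))"

text \<open>The value of a sentence does not depend on the assignment; the one chosen is constantly 0.\<close>

definition sentence_val :: "'a fpl_str \<Rightarrow> fml \<Rightarrow> real"
  where "sentence_val M f = fml_val M f (\<lambda>_. lzero M)"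

section \<open>Partition lattices and their common theory\<close>

definition partition_order :: "nat \<Rightarrow> nat set set gorder"
  where "partition_order n =
    \<lparr>carrier = {x. partition_on {1..n} x}, eq = (=), le = refines {1..n}\<rparr>"

text \<open>The distance is set to 0 outside the carrier only because \<open>Metric_space\<close> asks for
  symmetry and nonnegativity on the whole type.\<close>

definition partition_lattice :: "nat \<Rightarrow> nat set set fpl_str"
  where "partition_lattice n =
    \<lparr>carrier = {x. partition_on {1..n} x},
     ldist = (\<lambda>x y. if partition_on {1..n} x \<and> partition_on {1..n} y
       then (real (card x) + real (card y) - 2 * real (card (x \<squnion>\<^bsub>partition_order n\<^esub> y)))
              / (real n - 1)
       else 0),
     lzero = (\<lambda>i. {i}) ` {1..n},
     lone = {{1..n}},
     lplus = (\<lambda>x y. x \<squnion>\<^bsub>partition_order n\<^esub> y)\<rparr>"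

definition T_FPL :: "fml set"
  where "T_FPL = {f. sentence f \<and> (\<forall>n\<ge>2. sentence_val (partition_lattice n) f = 0)}"

definition models_T_FPL :: "'a fpl_str \<Rightarrow> bool"
  where "models_T_FPL M \<longleftrightarrow> fpl_structure M \<and> (\<forall>f \<in> T_FPL. sentence_val M f = 0)"

section \<open>Selectors\<close>

definition lorder :: "'a fpl_str \<Rightarrow> 'a gorder"
  where "lorder M = \<lparr>carrier = carrier M, eq = (=), le = (\<lambda>x y. lplus M x y = y)\<rparr>"

definition lmeet :: "'a fpl_str \<Rightarrow> 'a \<Rightarrow> 'a \<Rightarrow> 'a"
  where "lmeet M x y = x \<sqinter>\<^bsub>lorder M\<^esub> y"

definition lnorm :: "'a fpl_str \<Rightarrow> 'a \<Rightarrow> real"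
  where "lnorm M x = ldist M x (lzero M)"

definition metrically_modular :: "'a fpl_str \<Rightarrow> 'a \<Rightarrow> bool"
  where "metrically_modular M y \<longleftrightarrow> y \<in> carrier M \<and>
    (\<forall>x \<in> carrier M. lnorm M (lplus M x y) + lnorm M (lmeet M x y) = lnorm M x + lnorm M y)"

definition selectors :: "'a fpl_str \<Rightarrow> 'a \<Rightarrow> 'a set"
  where "selectors M x =
    {y. metrically_modular M y \<and> lplus M x y = lone M \<and> lmeet M x y = lzero M}"

section \<open>Hausdorff distance\<close>

text \<open>Infima and suprema are taken in the reals, so these are meaningful for nonempty sets on which
  \<open>d\<close> is bounded.\<close>

definition point_set_dist :: "('a \<Rightarrow> 'a \<Rightarrow> real) \<Rightarrow> 'a \<Rightarrow> 'a set \<Rightarrow> real"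
  where "point_set_dist d a B = (INF b \<in> B. d a b)"

definition hausdorff_dist :: "('a \<Rightarrow> 'a \<Rightarrow> real) \<Rightarrow> 'a set \<Rightarrow> 'a set \<Rightarrow> real"
  where "hausdorff_dist d A B =
    max (SUP a \<in> A. point_set_dist d a B) (SUP b \<in> B. point_set_dist d b A)"

end

theory Submission
  imports Defs
begin

text \<open>
  In a partition lattice the metrically modular elements are the partitions with at most one
  nontrivial block, and the selectors of \<open>x\<close> are those whose block is a transversal of \<open>x\<close>.  There both
  estimates are combinatorial.  For the upper bound, a transversal of \<open>x\<close> is thinned out to one of the
  join \<open>x + y\<close> and then extended to one of \<open>y\<close>, which takes as many steps as \<open>d(x, y)\<close> counts
  (\<open>transversal_move\<close>).  For the lower bound, consider the bipartite graph of blocks of \<open>x\<close> and of \<open>y\<close>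
  in which blocks are adjacent when they meet.  A transversal of \<open>x\<close> that lies in few blocks of \<open>y\<close> has
  few points in common with any transversal of \<open>y\<close>.  A bound on the sizes of dominating sets
  (\<open>bipartite_domination\<close>) gives a transversal of \<open>x\<close> and one of \<open>y\<close> whose distances from the
  transversals of the other partition add up to at least \<open>d(x, x + y)\<close> (\<open>far_transversals\<close>).  One of
  these distances is therefore at least half of it.

  To carry this over to a model, both statements have to be turned into sentences, although the meet,
  which occurs in the definition of a selector, is not continuous.  Metric modularity of \<open>a\<close> is therefore
  expressed by approximate lower bounds of \<open>x\<close> and \<open>a\<close> of the appropriate norm, for all \<open>x\<close>.  In a model
  this is equivalent to metric modularity, because semimodularity and completeness turn approximate
  lower bounds of nearly maximal norm into an actual one (\<open>lower_bound_limit\<close>).  In the partition lattices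
  the resulting \<open>selector_defect\<close> bounds the distance from the set of selectors up to a factor that does not
  depend on \<open>n\<close> (\<open>transversal_near_selector_defect\<close>, which rests on \<open>near_one_block\<close>).

  With this estimate the sentences may speak about approximate selectors, and quantification over the
  set of selectors is replaced by quantification over all elements with a penalty proportional to
  the defect.  In a model, approximate selectors are corrected by a convergent sequence of moves
  (\<open>FPL_model.selector_move\<close>), which also shows that every element has a selector.  The second estimate
  for \<open>d(x, y)\<close> follows from the first by the triangle inequality through \<open>x + y\<close>.
\<close>

section \<open>Joins of partitions\<close>

text \<open>All joins below are obtained by adding sets to a partition one at a time and merging the
  blocks that each set touches.\<close>

definition touched :: "'a set set \<Rightarrow> 'a set \<Rightarrow> 'a set set"
  where "touched x S = {B \<in> x. B \<inter> S \<noteq> {}}"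

text \<open>Requiring that a block that meets \<open>S\<close> contains it, rather than that some block contains
  \<open>S\<close>, makes the empty set harmless.\<close>

definition unsplit :: "'a set set \<Rightarrow> 'a set \<Rightarrow> bool"
  where "unsplit w S \<longleftrightarrow> (\<forall>B \<in> w. B \<inter> S \<noteq> {} \<longrightarrow> S \<subseteq> B)"

definition merge :: "'a set set \<Rightarrow> 'a set \<Rightarrow> 'a set set"
  where "merge x S = (x - touched x S) \<union> {\<Union>(touched x S)}"

lemma partition_block_eq:
  "\<lbrakk>partition_on V x; B \<in> x; C \<in> x; i \<in> B; i \<in> C\<rbrakk> \<Longrightarrow> B = C"
  unfolding partition_on_def disjoint_def by blast

lemma partition_block_of:
  "\<lbrakk>partition_on V x; i \<in> V\<rbrakk> \<Longrightarrow> \<exists>B \<in> x. i \<in> B"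
  unfolding partition_on_def by blast

lemma refines_iff_unsplit:
  assumes "partition_on V x" "partition_on V w"
  shows "refines V x w \<longleftrightarrow> (\<forall>B \<in> x. unsplit w B)"
proof
  assume r: "refines V x w"
  show "\<forall>B \<in> x. unsplit w B"
  proof
    fix B assume "B \<in> x"
    then obtain W where W: "W \<in> w" "B \<subseteq> W" using r unfolding refines_def by blast
    show "unsplit w B"
      unfolding unsplit_def using W partition_block_eq[OF assms(2)] by blast
  qed
next
  assume u: "\<forall>B \<in> x. unsplit w B"
  show "refines V x w"
    unfolding refines_def
  proof (intro conjI assms ballI)
    fix B assume B: "B \<in> x"
    then have "B \<noteq> {}" "B \<subseteq> V" using assms(1) unfolding partition_on_def by auto
    then obtain i W where "i \<in> B" "W \<in> w" "i \<in> W"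
      using partition_block_of[OF assms(2)] by blast
    then show "\<exists>W \<in> w. B \<subseteq> W" using u B unfolding unsplit_def by blast
  qed
qed

lemma unsplit_refines:
  assumes "refines V x w" "S \<subseteq> V" "unsplit x S"
  shows "unsplit w S"
proof -
  have px: "partition_on V x" and pw: "partition_on V w" using assms(1) unfolding refines_def by auto
  show ?thesis
    unfolding unsplit_def
  proof (intro ballI impI)
    fix W assume W: "W \<in> w" "W \<inter> S \<noteq> {}"
    then obtain i where i: "i \<in> W" "i \<in> S" by blast
    then obtain B where B: "B \<in> x" "i \<in> B" using partition_block_of[OF px] assms(2) by blast
    then have SB: "S \<subseteq> B" using assms(3) i unfolding unsplit_def by blast
    have "unsplit w B" using B assms(1) refines_iff_unsplit[OF px pw] by blast
    then have "B \<subseteq> W" using W i B unfolding unsplit_def by blast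
    then show "S \<subseteq> W" using SB by blast
  qed
qed

lemma partition_on_merge:
  assumes x: "partition_on V x" and S: "S \<subseteq> V" "S \<noteq> {}"
  shows "partition_on V (merge x S)"
proof (rule partition_onI)
  obtain i where "i \<in> S" "i \<in> V" using S by blast
  then have "touched x S \<noteq> {}"
    using partition_block_of[OF x, of i] unfolding touched_def by blast
  moreover have "{} \<notin> x" using x unfolding partition_on_def by auto
  ultimately show "{} \<notin> merge x S"
    unfolding merge_def touched_def by auto
  have "\<Union> (merge x S) = \<Union> x"
    unfolding merge_def touched_def by auto
  then show "\<Union> (merge x S) = V"
    using x unfolding partition_on_def by simp
  fix p q assume pq: "p \<in> merge x S" "q \<in> merge x S" "p \<noteq> q"
  have *: "disjnt B (\<Union>(touched x S))" if "B \<in> x - touched x S" for B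
    using that partition_block_eq[OF x] unfolding touched_def disjnt_def by blast
  have **: "disjnt B C" if "B \<in> x" "C \<in> x" "B \<noteq> C" for B C
    using that partition_block_eq[OF x] unfolding disjnt_def by blast
  show "disjnt p q"
    using pq * ** unfolding merge_def
    by (metis DiffD1 UnE disjnt_sym singletonD)
qed

lemma refines_merge:
  assumes x: "partition_on V x" and S: "S \<subseteq> V" "S \<noteq> {}"
  shows "refines V x (merge x S)"
  unfolding refines_def using x partition_on_merge[OF assms]
  by (auto simp: merge_def)

lemma unsplit_merge:
  assumes x: "partition_on V x" and S: "S \<subseteq> V"
  shows "unsplit (merge x S) S"
  using assms unfolding unsplit_def merge_def touched_def partition_on_def by blast

lemma merge_least:
  assumes x: "partition_on V x" and S: "S \<subseteq> V" "S \<noteq> {}"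
    and w: "refines V x w" "unsplit w S"
  shows "refines V (merge x S) w"
proof -
  have pw: "partition_on V w" using w unfolding refines_def by auto
  have uB: "unsplit w B" if "B \<in> x" for B using that w(1) refines_iff_unsplit[OF x pw] by blast
  have "unsplit w (\<Union>(touched x S))"
    unfolding unsplit_def
  proof (intro ballI impI)
    fix W assume W: "W \<in> w" "W \<inter> \<Union> (touched x S) \<noteq> {}"
    then obtain B where B: "B \<in> x" "B \<inter> S \<noteq> {}" "W \<inter> B \<noteq> {}" unfolding touched_def by blast
    then have "B \<subseteq> W" using uB W unfolding unsplit_def by blast
    then have "S \<subseteq> W" using B w(2) W unfolding unsplit_def by blast
    then show "\<Union> (touched x S) \<subseteq> W"
      using uB W unfolding unsplit_def touched_def by blast
  qed
  then show ?thesis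
    using uB refines_iff_unsplit[OF partition_on_merge[OF x S] pw] unfolding merge_def by blast
qed

lemma finite_partition: "\<lbrakk>finite V; partition_on V x\<rbrakk> \<Longrightarrow> finite x"
  by (rule finite_elements)

lemma card_merge:
  assumes "finite V" and x: "partition_on V x" and S: "S \<subseteq> V" "S \<noteq> {}"
  shows "card (merge x S) + card (touched x S) = card x + 1"
proof -
  have fx: "finite x" using assms finite_partition by blast
  have t: "touched x S \<subseteq> x" unfolding touched_def by auto
  have "\<Union>(touched x S) \<notin> x - touched x S"
  proof
    assume a: "\<Union>(touched x S) \<in> x - touched x S"
    obtain i B where "i \<in> S" "B \<in> x" "i \<in> B" using S partition_block_of[OF x] by blast
    then have "B \<in> touched x S" "i \<in> \<Union>(touched x S)" unfolding touched_def by blast+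
    then show False using a \<open>i \<in> S\<close> unfolding touched_def by blast
  qed
  then have "card (merge x S) = card (x - touched x S) + 1"
    unfolding merge_def using fx by simp
  moreover have "card (x - touched x S) + card (touched x S) = card x"
    using t fx by (metis card_Diff_subset card_mono finite_subset le_add_diff_inverse2)
  ultimately show ?thesis by simp
qed

text \<open>Each coarse block that meets \<open>S\<close> contains a fine block that meets \<open>S\<close>.\<close>

lemma card_touched_refines:
  assumes "finite V" and r: "refines V x w" and S: "S \<subseteq> V"
  shows "card (touched w S) \<le> card (touched x S)"
proof -
  have px: "partition_on V x" and pw: "partition_on V w" using r unfolding refines_def by auto
  have "touched w S \<subseteq> (\<lambda>B. THE W. W \<in> w \<and> B \<subseteq> W) ` touched x S"
  proof
    fix W assume W: "W \<in> touched w S"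
    then obtain i where i: "i \<in> W" "i \<in> S" "W \<in> w" unfolding touched_def by blast
    then obtain B where B: "B \<in> x" "i \<in> B" using partition_block_of[OF px] S by blast
    have BW: "B \<subseteq> W" using refines_iff_unsplit[OF px pw] r B i unfolding unsplit_def by blast
    have "(THE W. W \<in> w \<and> B \<subseteq> W) = W"
    proof (rule the_equality)
      fix W' assume "W' \<in> w \<and> B \<subseteq> W'"
      then show "W' = W" using BW i B partition_block_eq[OF pw, of W' W] by blast
    qed (use BW i in blast)
    moreover have "B \<in> touched x S" using B i unfolding touched_def by blast
    ultimately show "W \<in> (\<lambda>B. THE W. W \<in> w \<and> B \<subseteq> W) ` touched x S" by force
  qed
  moreover have "finite (touched x S)"
    using finite_partition[OF assms(1) px] unfolding touched_def by auto
  ultimately show ?thesis by (rule surj_card_le[rotated])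
qed

text \<open>The finest partition that splits no member of \<open>F\<close>.  Taking \<open>F\<close> to be a union of partitions
  gives their join, and a single set gives the partition with at most one nontrivial block.\<close>

definition is_gen :: "'a set \<Rightarrow> 'a set set \<Rightarrow> 'a set set \<Rightarrow> bool"
  where "is_gen V F w \<longleftrightarrow> partition_on V w \<and> (\<forall>S \<in> F. unsplit w S) \<and>
    (\<forall>w'. partition_on V w' \<and> (\<forall>S \<in> F. unsplit w' S) \<longrightarrow> refines V w w')"

definition gen :: "'a set \<Rightarrow> 'a set set \<Rightarrow> 'a set set"
  where "gen V F = (THE w. is_gen V F w)"

lemma is_gen_unique: "\<lbrakk>is_gen V F w; is_gen V F w'\<rbrakk> \<Longrightarrow> w = w'"
  unfolding is_gen_def by (meson refines_asym)

lemma gen_eqI: "is_gen V F w \<Longrightarrow> gen V F = w"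
  unfolding gen_def by (rule the_equality) (auto dest: is_gen_unique)

lemma is_gen_empty: "is_gen V {} ((\<lambda>i. {i}) ` V)"
proof -
  have p: "partition_on V ((\<lambda>i. {i}) ` V)" by (rule partition_on_singletons)
  have "refines V ((\<lambda>i. {i}) ` V) w" if "partition_on V w" for w
    unfolding refines_iff_unsplit[OF p that] unsplit_def by auto
  then show ?thesis using p unfolding is_gen_def by simp
qed

lemma is_gen_insert:
  assumes "is_gen V F w" "F \<subseteq> Pow V" "S \<subseteq> V" "S \<noteq> {}"
  shows "is_gen V (insert S F) (merge w S)"
proof -
  have w: "partition_on V w" using assms(1) unfolding is_gen_def by auto
  note p = partition_on_merge[OF w assms(3,4)]
  show ?thesis
    unfolding is_gen_def
  proof (intro conjI p ballI allI impI)
    fix T assume "T \<in> insert S F"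
    then consider "T = S" | "T \<in> F" by auto
    then show "unsplit (merge w S) T"
    proof cases
      case 1 then show ?thesis using unsplit_merge[OF w assms(3)] by simp
    next
      case 2
      then show ?thesis
        using unsplit_refines[OF refines_merge[OF w assms(3,4)]] assms(1,2)
        unfolding is_gen_def by blast
    qed
  next
    fix w' assume "partition_on V w' \<and> (\<forall>T \<in> insert S F. unsplit w' T)"
    then show "refines V (merge w S) w'"
      using merge_least[OF w assms(3,4)] assms(1) unfolding is_gen_def by blast
  qed
qed

lemma is_gen_gen:
  assumes "finite V" "F \<subseteq> Pow V"
  shows "is_gen V F (gen V F)"
proof -
  have "finite F" using assms finite_subset by blast
  then have "F \<subseteq> Pow V \<Longrightarrow> \<exists>w. is_gen V F w"
  proof (induction F)
    case empty then show ?case using is_gen_empty by blast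
  next
    case (insert S F)
    then obtain w where w: "is_gen V F w" by auto
    show ?case
    proof (cases "S = {}")
      case True
      then show ?thesis using w unfolding is_gen_def unsplit_def by auto
    next
      case False
      then have "is_gen V (insert S F) (merge w S)"
        using is_gen_insert[OF w, of S] insert.prems by simp
      then show ?thesis by blast
    qed
  qed
  then show ?thesis using assms gen_eqI by metis
qed

locale finite_ground_set =
  fixes V :: "'a set"
  assumes finV: "finite V"
begin

lemma partition_gen: "F \<subseteq> Pow V \<Longrightarrow> partition_on V (gen V F)"
  using is_gen_gen[OF finV] unfolding is_gen_def by blast

lemma unsplit_gen: "\<lbrakk>F \<subseteq> Pow V; S \<in> F\<rbrakk> \<Longrightarrow> unsplit (gen V F) S"
  using is_gen_gen[OF finV] unfolding is_gen_def by blast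

lemma gen_least:
  assumes "F \<subseteq> Pow V" "partition_on V w" "\<And>S. S \<in> F \<Longrightarrow> unsplit w S"
  shows "refines V (gen V F) w"
  using is_gen_gen[OF finV assms(1)] assms(2,3) unfolding is_gen_def by simp

lemma gen_insert:
  "\<lbrakk>F \<subseteq> Pow V; S \<subseteq> V; S \<noteq> {}\<rbrakk> \<Longrightarrow> gen V (insert S F) = merge (gen V F) S"
  by (rule gen_eqI[OF is_gen_insert[OF is_gen_gen[OF finV]]])

lemma gen_insert_empty: "F \<subseteq> Pow V \<Longrightarrow> gen V (insert {} F) = gen V F"
  using is_gen_gen[OF finV, of F] by (intro gen_eqI) (auto simp: is_gen_def unsplit_def)

lemma gen_mono: "\<lbrakk>F \<subseteq> G; G \<subseteq> Pow V\<rbrakk> \<Longrightarrow> refines V (gen V F) (gen V G)"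
  by (intro gen_least partition_gen) (auto intro: unsplit_gen)

lemma partition_Pow: "partition_on V x \<Longrightarrow> x \<subseteq> Pow V"
  unfolding partition_on_def by auto

lemma gen_partition: "partition_on V x \<Longrightarrow> gen V x = x"
proof (rule gen_eqI)
  assume x: "partition_on V x"
  show "is_gen V x x"
    unfolding is_gen_def using x refines_iff_unsplit[OF x] refines_refl[OF x] by blast
qed

text \<open>Joins are associative because closing up part of a family first does not change the
  partition that the family generates.\<close>

lemma gen_gen_Un:
  assumes "F \<subseteq> Pow V" "G \<subseteq> Pow V"
  shows "gen V (gen V F \<union> G) = gen V (F \<union> G)"
proof (rule gen_eqI)
  have P: "F \<union> G \<subseteq> Pow V" using assms by auto
  note p = partition_gen[OF P]
  have r: "refines V (gen V F) (gen V (F \<union> G))" by (rule gen_mono[OF _ P]) auto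
  show "is_gen V (gen V F \<union> G) (gen V (F \<union> G))"
    unfolding is_gen_def
  proof (intro conjI p ballI allI impI)
    fix S assume "S \<in> gen V F \<union> G"
    then show "unsplit (gen V (F \<union> G)) S"
      using r refines_iff_unsplit[OF partition_gen[OF assms(1)] p] unsplit_gen[OF P] by blast
  next
    fix w assume w: "partition_on V w \<and> (\<forall>S \<in> gen V F \<union> G. unsplit w S)"
    then have "refines V (gen V F) w"
      using refines_iff_unsplit[OF partition_gen[OF assms(1)]] by blast
    then have "unsplit w S" if "S \<in> F" for S
      using that unsplit_refines unsplit_gen[OF assms(1)] assms(1) by blast
    then show "refines V (gen V (F \<union> G)) w" using w by (intro gen_least[OF P]) auto
  qed
qed

lemma card_refines:
  assumes "refines V x w"
  shows "card w \<le> card x"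
proof -
  have px: "partition_on V x" and pw: "partition_on V w" using assms unfolding refines_def by auto
  have "touched u V = u" if "partition_on V u" for u
  proof -
    have "B \<inter> V = B \<and> B \<noteq> {}" if "B \<in> u" for B
      using that \<open>partition_on V u\<close> unfolding partition_on_def by blast
    then show ?thesis unfolding touched_def by auto
  qed
  from this[OF px] this[OF pw] show ?thesis using card_touched_refines[OF finV assms, of V] by simp
qed

text \<open>Merging the blocks that meet \<open>S\<close> loses one block less than it touches, and a coarser partition
  has fewer blocks to touch.  So the number of blocks lost when a fixed family is added decreases
  as the partition gets coarser, which is the semimodular law.\<close>

lemma card_gen_insert_semimodular:
  assumes "F \<subseteq> G" "G \<subseteq> Pow V" "S \<subseteq> V"
  shows "card (gen V G) + card (gen V (insert S F)) \<le> card (gen V F) + card (gen V (insert S G))"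
proof (cases "S = {}")
  case True
  then show ?thesis using assms by (simp add: gen_insert_empty)
next
  case False
  have F: "F \<subseteq> Pow V" using assms by auto
  have "card (touched (gen V G) S) \<le> card (touched (gen V F) S)"
    using card_touched_refines[OF finV gen_mono] assms by blast
  then show ?thesis
    using card_merge[OF finV partition_gen[OF F] assms(3) False]
      card_merge[OF finV partition_gen[OF assms(2)] assms(3) False]
      gen_insert[OF F assms(3) False] gen_insert[OF assms(2,3) False] by simp
qed

text \<open>With \<open>F\<close> a partition this says that the rank \<open>n - #x\<close> is submodular along joins, in a form that
  needs no meets.\<close>

lemma card_gen_semimodular:
  assumes "F \<subseteq> G" "G \<subseteq> Pow V" "H \<subseteq> Pow V"
  shows "card (gen V G) + card (gen V (F \<union> H)) \<le> card (gen V F) + card (gen V (G \<union> H))"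
proof -
  have "finite H" using assms(3) finV finite_subset[of H "Pow V"] by simp
  then show ?thesis using assms(3)
  proof (induction H)
    case empty then show ?case by simp
  next
    case (insert S H)
    have "card (gen V (G \<union> H)) + card (gen V (insert S (F \<union> H)))
        \<le> card (gen V (F \<union> H)) + card (gen V (insert S (G \<union> H)))"
    proof (rule card_gen_insert_semimodular)
      show "F \<union> H \<subseteq> G \<union> H" using assms(1) by (rule Un_mono) simp
      show "G \<union> H \<subseteq> Pow V" "S \<subseteq> V" using assms(2) insert.prems by simp_all
    qed
    moreover have "card (gen V G) + card (gen V (F \<union> H)) \<le> card (gen V F) + card (gen V (G \<union> H))"
      using insert.IH insert.prems by simp
    ultimately show ?case unfolding Un_insert_right by linarith
  qed
qed

end

section \<open>One-block partitions and transversals\<close>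

definition blk :: "'a set \<Rightarrow> 'a set \<Rightarrow> 'a set set"
  where "blk V S = gen V {S}"

text \<open>The metric of the partition lattice before division by \<open>n - 1\<close>.  Integers keep the subtraction
  honest and let the counting arguments be linear arithmetic.\<close>

definition pdist :: "'a set \<Rightarrow> 'a set set \<Rightarrow> 'a set set \<Rightarrow> int"
  where "pdist V x y = int (card x) + int (card y) - 2 * int (card (gen V (x \<union> y)))"

text \<open>The selectors of a partition \<open>x\<close> are the one-block partitions given by transversals of \<open>x\<close>.\<close>

definition transversal :: "'a set set \<Rightarrow> 'a set \<Rightarrow> bool"
  where "transversal x A \<longleftrightarrow> A \<subseteq> \<Union>x \<and> (\<forall>B \<in> x. \<exists>i. A \<inter> B = {i})"

text \<open>This is the combinatorial core of the lower bound.  Choose \<open>S\<close> of least size dominating \<open>Y\<close>; every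
  \<open>s\<close> in \<open>S\<close> then has a private neighbour.  If \<open>S\<close> is small, \<open>T = Y\<close> will do.  If it is large, most
  private neighbours may be left out of \<open>T\<close>: one that belongs to an \<open>s\<close> with another neighbour is
  needed only for vertices outside \<open>S\<close>, which are few.  The remaining ones either form components
  with one edge, which are counted by \<open>I\<close>, or see a vertex outside \<open>S\<close>; minimality of \<open>S\<close>, tested by
  exchanging them for such vertices, bounds how many of the latter there are.\<close>

lemma bipartite_domination:
  fixes R :: "'a \<Rightarrow> 'b \<Rightarrow> bool"
  assumes fX: "finite X" and fY: "finite Y"
    and X: "\<And>x. x \<in> X \<Longrightarrow> \<exists>y \<in> Y. R x y" and Y: "\<And>y. y \<in> Y \<Longrightarrow> \<exists>x \<in> X. R x y"
  defines "I \<equiv> {x \<in> X. \<exists>y \<in> Y. (\<forall>x' \<in> X. R x' y \<longrightarrow> x' = x) \<and> (\<forall>y' \<in> Y. R x y' \<longrightarrow> y' = y)}"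
  shows "\<exists>S \<subseteq> X. \<exists>T \<subseteq> Y. (\<forall>y \<in> Y. \<exists>s \<in> S. R s y) \<and> (\<forall>x \<in> X. \<exists>t \<in> T. R x t) \<and>
    2 * card S + 2 * card T \<le> 2 * card Y + card X + card I"
proof -
  define dom where "dom S \<longleftrightarrow> S \<subseteq> X \<and> (\<forall>y \<in> Y. \<exists>s \<in> S. R s y)" for S
  have "dom X" unfolding dom_def using Y by simp
  then obtain S where S: "dom S" and min: "\<And>S'. dom S' \<Longrightarrow> card S \<le> card S'"
    using ex_has_least_nat[of dom X card] by blast
  have SX: "S \<subseteq> X" and Sdom: "\<And>y. y \<in> Y \<Longrightarrow> \<exists>s \<in> S. R s y" using S unfolding dom_def by auto
  have fS: "finite S" using SX fX by (rule finite_subset)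
  have "\<exists>y \<in> Y. R s y \<and> (\<forall>s' \<in> S. R s' y \<longrightarrow> s' = s)" if "s \<in> S" for s
  proof -
    have "card (S - {s}) < card S" using that fS by (rule card_Diff1_less[rotated])
    then have "\<not> dom (S - {s})" using min[of "S - {s}"] by linarith
    then obtain y where "y \<in> Y" "\<forall>s' \<in> S - {s}. \<not> R s' y" unfolding dom_def using SX by blast
    then show ?thesis using Sdom[of y] by blast
  qed
  then obtain P where PY: "\<And>s. s \<in> S \<Longrightarrow> P s \<in> Y" and PR: "\<And>s. s \<in> S \<Longrightarrow> R s (P s)"
    and Ppriv: "\<And>s s'. \<lbrakk>s \<in> S; s' \<in> S; R s' (P s)\<rbrakk> \<Longrightarrow> s' = s"
    by metis
  have Pinj: "inj_on P S" using PR Ppriv unfolding inj_on_def by metis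
  define Q where "Q = Y - P ` S"
  define Bad where "Bad = {s \<in> S. \<forall>y \<in> Q. \<not> R s y}"
  define U where "U = {x \<in> X - S. \<forall>y \<in> Q \<union> P ` Bad. \<not> R x y}"
  obtain nb where nb: "\<And>x. x \<in> X \<Longrightarrow> nb x \<in> Y \<and> R x (nb x)" using X by metis
  define T where "T = Q \<union> P ` Bad \<union> nb ` U"
  have fQ: "finite Q" "finite Bad" "finite U" unfolding Q_def Bad_def U_def using fX fY fS by auto
  have TY: "T \<subseteq> Y" unfolding T_def Q_def Bad_def U_def using PY nb by auto
  have Tdom: "\<exists>t \<in> T. R x t" if x: "x \<in> X" for x
  proof (cases "x \<in> S")
    case True
    then show ?thesis using PR[OF True] unfolding T_def Bad_def by blast
  next
    case False
    then show ?thesis using x nb[OF x] unfolding T_def U_def by blast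
  qed
  have "card (P ` S) = card S" by (rule card_image[OF Pinj])
  moreover have PS: "P ` S \<subseteq> Y" using PY by auto
  ultimately have cQ: "card Q + card S = card Y"
    unfolding Q_def using fY by (metis card_Diff_subset card_mono finite_subset le_add_diff_inverse2)
  have "card T \<le> card (Q \<union> P ` Bad) + card (nb ` U)" unfolding T_def by (rule card_Un_le)
  also have "\<dots> \<le> card Q + card (P ` Bad) + card (nb ` U)" using card_Un_le[of Q "P ` Bad"] by simp
  also have "\<dots> \<le> card Q + card Bad + card U"
    using card_image_le[OF fQ(2), of P] card_image_le[OF fQ(3), of nb] by linarith
  finally have cT: "card T \<le> card Q + card Bad + card U" .
  \<comment> \<open>A bad vertex whose private neighbour sees nothing outside \<open>S\<close> is a component with one edge.\<close>
  define Bad' where "Bad' = {s \<in> Bad. \<exists>x \<in> X - S. R x (P s)}"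
  have badN: "y = P s" if "s \<in> Bad" "y \<in> Y" "R s y" for s y
  proof -
    have "y \<notin> Q" using that unfolding Bad_def by blast
    then obtain s' where s': "s' \<in> S" "y = P s'" using \<open>y \<in> Y\<close> unfolding Q_def by blast
    have "s = s'" using Ppriv[OF s'(1), of s] that s' unfolding Bad_def by blast
    then show ?thesis using s' by simp
  qed
  have "Bad - Bad' \<subseteq> I"
  proof
    fix s assume s: "s \<in> Bad - Bad'"
    then have sS: "s \<in> S" unfolding Bad_def by blast
    have "\<forall>x' \<in> X. R x' (P s) \<longrightarrow> x' = s"
      using s Ppriv[OF sS] unfolding Bad'_def by blast
    moreover have "\<forall>y' \<in> Y. R s y' \<longrightarrow> y' = P s" using badN s by blast
    ultimately show "s \<in> I" unfolding I_def using sS SX PY[OF sS] by blast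
  qed
  then have cI: "card (Bad - Bad') \<le> card I"
    by (rule card_mono[rotated]) (use fX in \<open>simp add: I_def\<close>)
  have "\<forall>s \<in> Bad'. \<exists>x. x \<in> X - S \<and> R x (P s)" unfolding Bad'_def by blast
  then obtain g where g: "\<And>s. s \<in> Bad' \<Longrightarrow> g s \<in> X - S \<and> R (g s) (P s)" by metis
  have Bad'S: "Bad' \<subseteq> S" unfolding Bad'_def Bad_def by auto
  have "dom ((S - Bad') \<union> g ` Bad')"
    unfolding dom_def
  proof (intro conjI ballI)
    show "S - Bad' \<union> g ` Bad' \<subseteq> X" using SX g by auto
    fix y assume y: "y \<in> Y"
    then obtain s where s: "s \<in> S" "R s y" using Sdom by blast
    show "\<exists>s \<in> (S - Bad') \<union> g ` Bad'. R s y"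
    proof (cases "s \<in> Bad'")
      case True
      then have "y = P s" using badN s y unfolding Bad'_def by blast
      then show ?thesis using g[OF True] True by blast
    next
      case False
      then show ?thesis using s by blast
    qed
  qed
  then have "card S \<le> card ((S - Bad') \<union> g ` Bad')" by (rule min)
  also have "\<dots> \<le> card (S - Bad') + card (g ` Bad')" by (rule card_Un_le)
  also have "card (S - Bad') = card S - card Bad'"
    using Bad'S fS by (meson card_Diff_subset finite_subset)
  finally have "card Bad' \<le> card (g ` Bad')"
    using card_mono[OF fS Bad'S] by linarith
  moreover have "card (g ` Bad') + card U \<le> card (X - S)"
  proof -
    have "g ` Bad' \<inter> U = {}"
      using g unfolding U_def Bad'_def by auto
    moreover have "finite (g ` Bad')" using Bad'S fS by (meson finite_imageI finite_subset)
    ultimately have "card (g ` Bad') + card U = card (g ` Bad' \<union> U)"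
      using fQ(3) by (simp add: card_Un_disjoint)
    also have "\<dots> \<le> card (X - S)"
      by (rule card_mono) (use fX g in \<open>auto simp: U_def\<close>)
    finally show ?thesis .
  qed
  moreover have "card Bad \<le> card Bad' + card (Bad - Bad')"
  proof -
    have "Bad = Bad' \<union> (Bad - Bad')" unfolding Bad'_def by auto
    then show ?thesis using card_Un_le[of Bad' "Bad - Bad'"] by simp
  qed
  moreover have "card (X - S) + card S = card X"
    using SX fX fS by (metis card_Diff_subset card_mono le_add_diff_inverse2)
  ultimately have key: "card S + card T + card S \<le> card Y + card I + card X"
    using cT cQ cI by linarith
  show ?thesis
  proof (cases "2 * card S \<le> card X + card I")
    case True
    then have "2 * card S + 2 * card Y \<le> 2 * card Y + card X + card I" by linarith
    then show ?thesis using SX Sdom X by (intro exI[of _ S] exI[of _ Y] conjI) auto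
  next
    case False
    then have "2 * card S + 2 * card T \<le> 2 * card Y + card X + card I" using key by linarith
    then show ?thesis using SX Sdom TY Tdom by (intro exI[of _ S] exI[of _ T] conjI) auto
  qed
qed

context finite_ground_set
begin

lemma gen_empty: "gen V {} = (\<lambda>i. {i}) ` V"
  by (rule gen_eqI[OF is_gen_empty])

lemma blk_eq:
  assumes "S \<subseteq> V" "S \<noteq> {}"
  shows "blk V S = insert S ((\<lambda>i. {i}) ` (V - S))"
proof -
  have "blk V S = merge ((\<lambda>i. {i}) ` V) S"
    unfolding blk_def using gen_insert[of "{}" S] assms gen_empty by simp
  moreover have "touched ((\<lambda>i. {i}) ` V) S = (\<lambda>i. {i}) ` S"
    using assms unfolding touched_def by auto
  ultimately show ?thesis unfolding merge_def by auto
qed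

lemma partition_blk: "S \<subseteq> V \<Longrightarrow> partition_on V (blk V S)"
  unfolding blk_def by (intro partition_gen) auto

lemma card_blk:
  assumes "S \<subseteq> V" "S \<noteq> {}"
  shows "card (blk V S) + card S = card V + 1"
proof -
  have "S \<notin> (\<lambda>i. {i}) ` (V - S)" by auto
  then have "card (blk V S) = card (V - S) + 1"
    unfolding blk_eq[OF assms] using finV by (simp add: card_image)
  moreover have "card (V - S) + card S = card V"
    using assms finV by (metis card_Diff_subset card_mono finite_subset le_add_diff_inverse2)
  ultimately show ?thesis by simp
qed

lemma gen_Un_blk:
  assumes "partition_on V x" "S \<subseteq> V"
  shows "gen V (x \<union> blk V S) = gen V (insert S x)"
  using gen_gen_Un[of "{S}" x] assms partition_Pow[OF assms(1)]
  unfolding blk_def by (simp add: Un_commute)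

lemma card_gen_insert:
  assumes "partition_on V x" "S \<subseteq> V" "S \<noteq> {}"
  shows "card (gen V (insert S x)) + card (touched x S) = card x + 1"
  using card_merge[OF finV assms] gen_insert[OF partition_Pow[OF assms(1)] assms(2,3)]
    gen_partition[OF assms(1)] by simp

lemma card_touched_blk:
  assumes "A \<subseteq> V" "A \<noteq> {}" "A' \<subseteq> V"
  shows "card (touched (blk V A) A') = card (A' - A) + (if A \<inter> A' = {} then 0 else 1)"
proof -
  have t: "touched (blk V A) A' = (if A \<inter> A' = {} then {} else {A}) \<union> (\<lambda>i. {i}) ` (A' - A)"
    unfolding blk_eq[OF assms(1,2)] touched_def using assms by auto
  have "card ((\<lambda>i. {i}) ` (A' - A)) = card (A' - A)" by (rule card_image) auto
  moreover have "A \<notin> (\<lambda>i. {i}) ` (A' - A)" using assms by auto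
  moreover have "finite ((\<lambda>i. {i}) ` (A' - A))" using assms finV by (meson finite_Diff finite_imageI finite_subset)
  ultimately show ?thesis unfolding t by simp
qed

lemma pdist_blk:
  assumes "A \<subseteq> V" "A \<noteq> {}" "A' \<subseteq> V" "A' \<noteq> {}"
  shows "pdist V (blk V A) (blk V A') =
    int (card A) + int (card A') - 2 * int (card (A \<inter> A')) - (if A \<inter> A' = {} then 2 else 0)"
proof -
  have "finite A'" using assms finV by (meson finite_subset)
  then have "card (A' - A) + card (A \<inter> A') = card A'"
    by (metis Int_commute card_Int_Diff add.commute)
  then show ?thesis
    unfolding pdist_def gen_Un_blk[OF partition_blk[OF assms(1)] assms(3)]
    using card_gen_insert[OF partition_blk[OF assms(1)] assms(3,4)] card_blk[OF assms(1,2)]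
      card_blk[OF assms(3,4)] card_touched_blk[OF assms(1,2,3)]
    by (auto split: if_splits)
qed

lemma pdist_triangle:
  assumes x: "partition_on V x" and y: "partition_on V y" and z: "partition_on V z"
  shows "pdist V x z \<le> pdist V x y + pdist V y z"
proof -
  note P = partition_Pow[OF x] partition_Pow[OF y] partition_Pow[OF z]
  have "card (gen V (x \<union> y)) + card (gen V (y \<union> z)) \<le> card (gen V y) + card (gen V (x \<union> y \<union> z))"
    by (rule card_gen_semimodular) (use P in auto)
  moreover have "card (gen V (x \<union> y \<union> z)) \<le> card (gen V (x \<union> z))"
    by (rule card_refines[OF gen_mono]) (use P in auto)
  ultimately show ?thesis
    unfolding pdist_def gen_partition[OF y] by linarith
qed

text \<open>One-block partitions are metrically modular: the traces of the blocks of \<open>x\<close> on \<open>S\<close>, together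
  with singletons, form a common refinement with the largest rank that semimodularity allows.\<close>

lemma block_meet:
  assumes x: "partition_on V x" and S: "S \<subseteq> V" "S \<noteq> {}"
  shows "\<exists>z. partition_on V z \<and> refines V z x \<and> refines V z (blk V S) \<and>
    card z + card (gen V (x \<union> blk V S)) = card x + card (blk V S)"
proof -
  define t where "t = (\<lambda>B. B \<inter> S) ` touched x S"
  define s where "s = (\<lambda>i. {i}) ` (V - S)"
  have dj: "disjnt p q" if "p \<in> t" "q \<in> t" "p \<noteq> q" for p q
    using that partition_block_eq[OF x] unfolding t_def touched_def disjnt_def by blast
  have "\<exists>B \<in> x. i \<in> B" if "i \<in> S" for i
    using partition_block_of[OF x] S(1) that by blast
  then have Ut: "\<Union>t = S"
    unfolding t_def touched_def by fastforce
  have pz: "partition_on V (t \<union> s)"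
  proof (rule partition_onI)
    show "\<Union> (t \<union> s) = V" using Ut S unfolding s_def by auto
    show "{} \<notin> t \<union> s" unfolding t_def s_def touched_def by auto
    fix p q assume pq: "p \<in> t \<union> s" "q \<in> t \<union> s" "p \<noteq> q"
    have "p \<subseteq> S" if "p \<in> t" for p using that unfolding t_def by auto
    moreover have "p \<inter> S = {}" if "p \<in> s" for p using that unfolding s_def by auto
    moreover have "disjnt p q" if "p \<in> s" "q \<in> s" "p \<noteq> q" for p q
      using that unfolding s_def by auto
    ultimately show "disjnt p q" using pq dj[of p q] unfolding disjnt_def by fast
  qed
  have "inj_on (\<lambda>B. B \<inter> S) (touched x S)"
  proof (rule inj_onI)
    fix B C assume "B \<in> touched x S" "C \<in> touched x S" "B \<inter> S = C \<inter> S"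
    then show "B = C" using partition_block_eq[OF x, of B C] unfolding touched_def by blast
  qed
  then have "card t = card (touched x S)" unfolding t_def by (rule card_image)
  moreover have "card s = card (V - S)" unfolding s_def by (rule card_image) auto
  moreover have "t \<inter> s = {}" unfolding t_def s_def by auto
  moreover have "finite t" "finite s" using finV finite_partition[OF finV pz] by auto
  moreover have "card (V - S) + card S = card V"
    using S finV by (metis card_Diff_subset card_mono finite_subset le_add_diff_inverse2)
  ultimately have c: "card (t \<union> s) + card S = card (touched x S) + card V"
    by (simp add: card_Un_disjoint)
  have zx: "refines V (t \<union> s) x"
    unfolding refines_def
  proof (intro conjI pz x ballI)
    fix p assume "p \<in> t \<union> s"
    then show "\<exists>B \<in> x. p \<subseteq> B"
      using partition_block_of[OF x] unfolding t_def s_def touched_def by auto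
  qed
  have zS: "refines V (t \<union> s) (blk V S)"
    unfolding refines_def
  proof (intro conjI pz partition_blk S ballI)
    fix p assume "p \<in> t \<union> s"
    then show "\<exists>B \<in> blk V S. p \<subseteq> B" unfolding blk_eq[OF S] t_def s_def by auto
  qed
  have "card (t \<union> s) + card (gen V (x \<union> blk V S)) = card x + card (blk V S)"
    using c gen_Un_blk[OF x S(1)] card_gen_insert[OF x S] card_blk[OF S] by simp
  then show ?thesis using pz zx zS by blast
qed

text \<open>Choosing representatives in \<open>S\<close> whenever possible gives a transversal inside \<open>S\<close> if \<open>S\<close> meets
  every block, and one containing \<open>S\<close> if \<open>S\<close> meets every block at most once.\<close>

lemma transversal_near:
  assumes x: "partition_on V x"
  shows "\<exists>A. transversal x A \<and> (\<forall>B \<in> x. B \<inter> S \<noteq> {} \<longrightarrow> A \<inter> B \<subseteq> S)"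
proof -
  have "\<forall>B \<in> x. \<exists>i. i \<in> B \<and> (B \<inter> S \<noteq> {} \<longrightarrow> i \<in> S)"
    using partition_onD3[OF x] by (metis Int_iff ex_in_conv)
  then obtain f where f: "\<And>B. B \<in> x \<Longrightarrow> f B \<in> B" "\<And>B. \<lbrakk>B \<in> x; B \<inter> S \<noteq> {}\<rbrakk> \<Longrightarrow> f B \<in> S"
    by metis
  have i: "f ` x \<inter> B = {f B}" if "B \<in> x" for B
  proof -
    have "f C = f B" if "C \<in> x" "f C \<in> B" for C
      using partition_block_eq[OF x that(1) \<open>B \<in> x\<close> f(1)[OF that(1)] that(2)] by simp
    then show ?thesis using f(1)[OF that] that by blast
  qed
  have "transversal x (f ` x)"
    unfolding transversal_def
  proof (intro conjI ballI)
    show "f ` x \<subseteq> \<Union>x" using f(1) by auto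
    show "\<exists>i. f ` x \<inter> B = {i}" if "B \<in> x" for B using i[OF that] by (rule exI)
  qed
  moreover have "\<forall>B \<in> x. B \<inter> S \<noteq> {} \<longrightarrow> f ` x \<inter> B \<subseteq> S"
  proof (intro ballI impI)
    fix B assume "B \<in> x" "B \<inter> S \<noteq> {}"
    then show "f ` x \<inter> B \<subseteq> S" using i[of B] f(2)[of B] by simp
  qed
  ultimately show ?thesis by blast
qed

lemma transversal_subset: "\<lbrakk>partition_on V x; transversal x A\<rbrakk> \<Longrightarrow> A \<subseteq> V"
  unfolding transversal_def partition_on_def by auto

lemma card_transversal_touched:
  assumes x: "partition_on V x" and A: "transversal x A" and S: "S \<subseteq> A"
  shows "card (touched x S) = card S"
proof -
  have "\<forall>i \<in> S. \<exists>B. B \<in> x \<and> i \<in> B"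
    using S A unfolding transversal_def by blast
  then obtain f where f: "\<And>i. i \<in> S \<Longrightarrow> f i \<in> x" "\<And>i. i \<in> S \<Longrightarrow> i \<in> f i" by metis
  have "inj_on f S"
  proof (rule inj_onI)
    fix i j assume ij: "i \<in> S" "j \<in> S" "f i = f j"
    obtain k where "A \<inter> f i = {k}" using A f(1)[OF ij(1)] unfolding transversal_def by blast
    moreover have "i \<in> A \<inter> f i" "j \<in> A \<inter> f i"
      using ij S f(2)[OF ij(1)] f(2)[OF ij(2)] by auto
    ultimately show "i = j" by (metis singletonD)
  qed
  moreover have "touched x S = f ` S"
  proof (intro equalityI subsetI)
    fix B assume "B \<in> touched x S"
    then obtain i where i: "B \<in> x" "i \<in> B" "i \<in> S" unfolding touched_def by blast
    then have "B = f i" using partition_block_eq[OF x i(1) f(1) i(2) f(2)] by simp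
    then show "B \<in> f ` S" using i by simp
  next
    fix B assume "B \<in> f ` S"
    then obtain i where "i \<in> S" "B = f i" by blast
    then show "B \<in> touched x S" using f[of i] unfolding touched_def by auto
  qed
  ultimately show ?thesis by (simp add: card_image)
qed

lemma touched_transversal: "transversal x A \<Longrightarrow> touched x A = x"
  unfolding transversal_def touched_def by blast

lemma card_transversal: "\<lbrakk>partition_on V x; transversal x A\<rbrakk> \<Longrightarrow> card A = card x"
  using card_transversal_touched[of x A A] touched_transversal[of x A] by simp

lemma transversal_nonempty:
  assumes "V \<noteq> {}" "partition_on V x" "transversal x A"
  shows "A \<noteq> {}"
proof -
  have "x \<noteq> {}" using assms(1,2) unfolding partition_on_def by auto
  then show ?thesis using assms(3) unfolding transversal_def by blast
qed

section \<open>Moving and separating transversals\<close>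

lemma block_above:
  assumes "refines V x w" "W \<in> w"
  shows "\<exists>B \<in> x. B \<subseteq> W"
proof -
  have px: "partition_on V x" and pw: "partition_on V w" using assms(1) unfolding refines_def by auto
  have "W \<noteq> {}" "W \<subseteq> V" using assms(2) pw unfolding partition_on_def by auto
  then obtain i where i: "i \<in> W" "i \<in> V" by blast
  obtain B where B: "B \<in> x" "i \<in> B" using partition_block_of[OF px i(2)] by blast
  obtain W' where W': "W' \<in> w" "B \<subseteq> W'" using assms(1) B(1) unfolding refines_def by blast
  have "W' = W" using partition_block_eq[OF pw W'(1) assms(2), of i] W' B i by blast
  then show ?thesis using B W' by blast
qed

lemma transversal_restrict:
  assumes r: "refines V x w" and A: "transversal x A"
  shows "\<exists>A' \<subseteq> A. transversal w A'"
proof -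
  have pw: "partition_on V w" using r unfolding refines_def by auto
  obtain A' where A': "transversal w A'" "\<forall>W \<in> w. W \<inter> A \<noteq> {} \<longrightarrow> A' \<inter> W \<subseteq> A"
    using transversal_near[OF pw] by blast
  have "A' \<inter> W \<subseteq> A" if W: "W \<in> w" for W
  proof -
    obtain B where "B \<in> x" "B \<subseteq> W" using block_above[OF r W] by blast
    then have "W \<inter> A \<noteq> {}" using A unfolding transversal_def by blast
    then show ?thesis using A'(2) W by blast
  qed
  then have "A' \<subseteq> A" using A'(1) unfolding transversal_def by blast
  then show ?thesis using A'(1) by blast
qed

lemma transversal_extend:
  assumes r: "refines V y w" and A: "transversal w A"
  shows "\<exists>B. A \<subseteq> B \<and> transversal y B"
proof -
  have py: "partition_on V y" and pw: "partition_on V w" using r unfolding refines_def by auto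
  obtain B where B: "transversal y B" "\<forall>C \<in> y. C \<inter> A \<noteq> {} \<longrightarrow> B \<inter> C \<subseteq> A"
    using transversal_near[OF py] by blast
  have "i \<in> B" if i: "i \<in> A" for i
  proof -
    have "i \<in> V" using i transversal_subset[OF pw A] by blast
    then obtain C where C: "C \<in> y" "i \<in> C" using partition_block_of[OF py] by blast
    obtain j where j: "B \<inter> C = {j}" using B(1) C(1) unfolding transversal_def by blast
    have "B \<inter> C \<subseteq> A" using B(2) C i by blast
    then have jA: "j \<in> A" "j \<in> C" using j by blast+
    obtain W where W: "W \<in> w" "C \<subseteq> W" using r C(1) unfolding refines_def by blast
    obtain k where "A \<inter> W = {k}" using A W(1) unfolding transversal_def by blast
    moreover have "i \<in> A \<inter> W" "j \<in> A \<inter> W" using i jA C W by auto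
    ultimately have "i = j" by (metis singletonD)
    then show ?thesis using j by blast
  qed
  then show ?thesis using B(1) by blast
qed

text \<open>Passing through the join of \<open>x\<close> and \<open>y\<close>, the transversal first loses points and then gains
  others.  The number of steps is the distance of \<open>x\<close> and \<open>y\<close>.\<close>

lemma transversal_move:
  assumes V: "V \<noteq> {}" and x: "partition_on V x" and y: "partition_on V y" and A: "transversal x A"
  shows "\<exists>B. transversal y B \<and> pdist V (blk V A) (blk V B) \<le> pdist V x y"
proof -
  define w where "w = gen V (x \<union> y)"
  have P: "x \<union> y \<subseteq> Pow V" using partition_Pow x y by blast
  have pw: "partition_on V w" unfolding w_def by (rule partition_gen[OF P])
  have rx: "refines V x w" using gen_mono[of x "x \<union> y"] P gen_partition[OF x] unfolding w_def by simp
  have ry: "refines V y w" using gen_mono[of y "x \<union> y"] P gen_partition[OF y] unfolding w_def by simp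
  obtain A' where A': "A' \<subseteq> A" "transversal w A'" using transversal_restrict[OF rx A] by blast
  obtain B where B: "A' \<subseteq> B" "transversal y B" using transversal_extend[OF ry A'(2)] by blast
  have s: "A \<subseteq> V" "B \<subseteq> V" using transversal_subset x y A B(2) by auto
  have n: "A \<noteq> {}" "B \<noteq> {}" using transversal_nonempty[OF V] x y A B(2) by auto
  have "finite (A \<inter> B)" using s finV by (meson finite_Int finite_subset)
  then have "card A' \<le> card (A \<inter> B)" by (rule card_mono) (use A' B in blast)
  moreover have "A \<inter> B \<noteq> {}" using A' B transversal_nonempty[OF V pw A'(2)] by blast
  ultimately have "pdist V (blk V A) (blk V B) \<le> pdist V x y"
    unfolding pdist_blk[OF s(1) n(1) s(2) n(2)] pdist_def[of V x y]
    using card_transversal[OF x A] card_transversal[OF y B(2)] card_transversal[OF pw A'(2)]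
    unfolding w_def by simp
  then show ?thesis using B(2) by blast
qed

text \<open>A set that is nearly a transversal, in that it has about the right size and meets nearly all
  blocks, is corrected by discarding surplus points and adding representatives of the blocks that
  it misses.\<close>

lemma transversal_close:
  assumes V: "V \<noteq> {}" and x: "partition_on V x" and S: "S \<subseteq> V" "S \<noteq> {}"
  shows "\<exists>A. transversal x A \<and> pdist V (blk V S) (blk V A) \<le>
    int (card S) - int (card x) + 2 * (int (card (gen V (x \<union> blk V S))) - 1)"
proof -
  obtain A where A: "transversal x A" "\<forall>B \<in> x. B \<inter> S \<noteq> {} \<longrightarrow> A \<inter> B \<subseteq> S"
    using transversal_near[OF x] by blast
  have AV: "A \<subseteq> V" "A \<noteq> {}" using transversal_subset[OF x A(1)] transversal_nonempty[OF V x A(1)] .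
  have "touched x S \<subseteq> touched x (S \<inter> A)"
  proof
    fix B assume "B \<in> touched x S"
    then have B: "B \<in> x" "B \<inter> S \<noteq> {}" unfolding touched_def by auto
    then have "A \<inter> B \<subseteq> S" using A(2) by blast
    moreover obtain k where "A \<inter> B = {k}" using A(1) B(1) unfolding transversal_def by blast
    ultimately show "B \<in> touched x (S \<inter> A)" using B(1) unfolding touched_def by blast
  qed
  then have "card (touched x S) \<le> card (touched x (S \<inter> A))"
    by (rule card_mono[rotated]) (use finite_partition[OF finV x] in \<open>simp add: touched_def\<close>)
  also have "\<dots> = card (S \<inter> A)" by (rule card_transversal_touched[OF x A(1)]) simp
  finally have "card (touched x S) \<le> card (S \<inter> A)" .
  moreover have "card (gen V (insert S x)) \<le> card x"
    using card_refines[OF gen_mono[of x "insert S x"]] partition_Pow[OF x] S(1) gen_partition[OF x]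
    by auto
  ultimately have "pdist V (blk V S) (blk V A) \<le>
    int (card S) - int (card x) + 2 * (int (card (gen V (x \<union> blk V S))) - 1)"
    unfolding pdist_blk[OF S AV] gen_Un_blk[OF x S(1)]
    using card_gen_insert[OF x S] card_transversal[OF x A(1)] by auto
  then show ?thesis using A(1) by blast
qed

lemma common_block:
  assumes x: "partition_on V x" and y: "partition_on V y" and B: "B \<in> x" "B \<in> y"
  shows "B \<in> gen V (x \<union> y)"
proof -
  have P: "x \<union> y \<subseteq> Pow V" using partition_Pow x y by blast
  have BV: "B \<subseteq> V" "B \<noteq> {}" using x B(1) unfolding partition_on_def by auto
  define w where "w = {B, V - B} - {{}}"
  have pw: "partition_on V w"
    by (rule partition_onI) (use BV in \<open>auto simp: w_def disjnt_def\<close>)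
  have "refines V (gen V (x \<union> y)) w"
  proof (rule gen_least[OF P pw])
    fix S assume S: "S \<in> x \<union> y"
    then have "S = B \<or> S \<inter> B = {}"
      using partition_block_eq[OF x _ B(1), of S] partition_block_eq[OF y _ B(2), of S] by blast
    moreover have "S \<subseteq> V" using P S by blast
    ultimately show "unsplit w S" unfolding unsplit_def w_def by auto
  qed
  moreover obtain i W where W: "i \<in> B" "W \<in> gen V (x \<union> y)" "i \<in> W"
    using partition_block_of[OF partition_gen[OF P]] BV by blast
  ultimately obtain U where "U \<in> w" "W \<subseteq> U" unfolding refines_def by blast
  then have "W \<subseteq> B" using W(1,3) unfolding w_def by auto
  moreover have "B \<subseteq> W" using unsplit_gen[OF P, of B] B W unfolding unsplit_def by blast
  ultimately have "W = B" by (rule equalityI)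
  then show ?thesis using W(2) by simp
qed

text \<open>If the blocks in \<open>T\<close> dominate those of \<open>x\<close>, a transversal of \<open>x\<close> can be chosen inside their
  union.  A transversal of \<open>y\<close> shares at most one point with it in each block in \<open>T\<close>.\<close>

lemma far_from_transversals:
  assumes V: "V \<noteq> {}" and x: "partition_on V x" and y: "partition_on V y"
    and T: "T \<subseteq> y" "\<And>B. B \<in> x \<Longrightarrow> \<exists>C \<in> T. B \<inter> C \<noteq> {}"
  shows "\<exists>A. transversal x A \<and> (\<forall>A'. transversal y A' \<longrightarrow>
    int (card x) + int (card y) - 2 * int (card T) \<le> pdist V (blk V A) (blk V A'))"
proof -
  have fT: "finite T" using T(1) finite_partition[OF finV y] by (rule finite_subset)
  have "x \<noteq> {}" using V x unfolding partition_on_def by auto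
  then have "T \<noteq> {}" using T(2) by blast
  \<comment> \<open>The distance formula has a correction for disjoint sets, which is absorbed because \<open>T\<close> is nonempty.\<close>
  then have cT: "card T \<ge> 1" using fT by (simp add: Suc_leI card_gt_0_iff)
  obtain A where A: "transversal x A" "\<forall>B \<in> x. B \<inter> \<Union>T \<noteq> {} \<longrightarrow> A \<inter> B \<subseteq> \<Union>T"
    using transversal_near[OF x, of "\<Union>T"] by metis
  have "A \<inter> B \<subseteq> \<Union>T" if "B \<in> x" for B
  proof -
    have "B \<inter> \<Union>T \<noteq> {}" using T(2)[OF that] by blast
    then show ?thesis using A(2) that by blast
  qed
  then have AT: "A \<subseteq> \<Union>T" using A(1) unfolding transversal_def by blast
  have AV: "A \<subseteq> V" "A \<noteq> {}" using transversal_subset[OF x A(1)] transversal_nonempty[OF V x A(1)] .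
  have "int (card x) + int (card y) - 2 * int (card T) \<le> pdist V (blk V A) (blk V A')"
    if A': "transversal y A'" for A'
  proof -
    have A'V: "A' \<subseteq> V" "A' \<noteq> {}" using transversal_subset[OF y A'] transversal_nonempty[OF V y A'] .
    have "touched y (A \<inter> A') \<subseteq> T"
    proof
      fix C assume "C \<in> touched y (A \<inter> A')"
      then obtain i where i: "C \<in> y" "i \<in> C" "i \<in> A" unfolding touched_def by blast
      then obtain D where "D \<in> T" "i \<in> D" using AT by blast
      then have "C = D" using partition_block_eq[OF y i(1) _ i(2)] T(1) by blast
      then show "C \<in> T" using \<open>D \<in> T\<close> by simp
    qed
    then have "card (touched y (A \<inter> A')) \<le> card T" by (rule card_mono[OF fT])
    moreover have "card (touched y (A \<inter> A')) = card (A \<inter> A')"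
      by (rule card_transversal_touched[OF y A']) simp
    ultimately show ?thesis
      unfolding pdist_blk[OF AV A'V]
      using card_transversal[OF x A(1)] card_transversal[OF y A'] cT by auto
  qed
  then show ?thesis using A(1) by blast
qed

text \<open>Apply the domination lemma to the blocks of \<open>x\<close> and \<open>y\<close>, adjacent when they meet.  A component
  with one edge is a common block, hence a block of the join.\<close>

lemma far_transversals:
  assumes V: "V \<noteq> {}" and x: "partition_on V x" and y: "partition_on V y"
  shows "\<exists>A B v v'. transversal x A \<and> transversal y B \<and>
    int (card x) - int (card (gen V (x \<union> y))) \<le> v + v' \<and>
    (\<forall>A'. transversal y A' \<longrightarrow> v \<le> pdist V (blk V A) (blk V A')) \<and>
    (\<forall>B'. transversal x B' \<longrightarrow> v' \<le> pdist V (blk V B) (blk V B'))"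
proof -
  have P: "x \<union> y \<subseteq> Pow V" using partition_Pow x y by blast
  have meet: "\<exists>D \<in> v. C \<inter> D \<noteq> {}" if "partition_on V u" "partition_on V v" "C \<in> u" for u v C
  proof -
    have "C \<noteq> {}" "C \<subseteq> V" using that unfolding partition_on_def by auto
    then obtain i where "i \<in> C" "i \<in> V" by blast
    then show ?thesis using partition_block_of[OF that(2), of i] by blast
  qed
  have fin: "finite x" "finite y" using finite_partition[OF finV] x y by auto
  define I where "I = {B \<in> x. \<exists>C \<in> y. (\<forall>B' \<in> x. B' \<inter> C \<noteq> {} \<longrightarrow> B' = B) \<and> (\<forall>C' \<in> y. B \<inter> C' \<noteq> {} \<longrightarrow> C' = C)}"
  have "\<exists>S \<subseteq> x. \<exists>T \<subseteq> y. (\<forall>C \<in> y. \<exists>B \<in> S. B \<inter> C \<noteq> {}) \<and> (\<forall>B \<in> x. \<exists>C \<in> T. B \<inter> C \<noteq> {}) \<and>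
      2 * card S + 2 * card T \<le> 2 * card y + card x + card I"
    unfolding I_def
    by (rule bipartite_domination[OF fin]) (use meet[OF x y] meet[OF y x] in \<open>auto simp: Int_commute\<close>)
  then obtain S T where ST: "S \<subseteq> x" "T \<subseteq> y" "\<And>C. C \<in> y \<Longrightarrow> \<exists>B \<in> S. C \<inter> B \<noteq> {}"
    "\<And>B. B \<in> x \<Longrightarrow> \<exists>C \<in> T. B \<inter> C \<noteq> {}"
    and c: "2 * card S + 2 * card T \<le> 2 * card y + card x + card I"
    by (metis Int_commute)
  have "I \<subseteq> gen V (x \<union> y)"
  proof
    fix B assume "B \<in> I"
    then have B: "B \<in> x" and "\<exists>C. C \<in> y \<and> (\<forall>B' \<in> x. B' \<inter> C \<noteq> {} \<longrightarrow> B' = B) \<and>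
        (\<forall>C' \<in> y. B \<inter> C' \<noteq> {} \<longrightarrow> C' = C)"
      unfolding I_def Bex_def by simp_all
    then obtain C where "C \<in> y \<and> (\<forall>B' \<in> x. B' \<inter> C \<noteq> {} \<longrightarrow> B' = B) \<and>
        (\<forall>C' \<in> y. B \<inter> C' \<noteq> {} \<longrightarrow> C' = C)"
      by (elim exE)
    then have C: "C \<in> y" "\<And>B'. \<lbrakk>B' \<in> x; B' \<inter> C \<noteq> {}\<rbrakk> \<Longrightarrow> B' = B"
      "\<And>C'. \<lbrakk>C' \<in> y; B \<inter> C' \<noteq> {}\<rbrakk> \<Longrightarrow> C' = C"
      by simp_all
    have "B \<subseteq> V" "C \<subseteq> V" using P B C(1) by blast+
    have "B \<subseteq> C"
    proof
      fix i assume i: "i \<in> B"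
      then obtain C' where C': "C' \<in> y" "i \<in> C'" using partition_block_of[OF y] \<open>B \<subseteq> V\<close> by blast
      then have "C' = C" using C(3)[of C'] i by blast
      then show "i \<in> C" using C' by simp
    qed
    moreover have "C \<subseteq> B"
    proof
      fix i assume i: "i \<in> C"
      then obtain B' where B': "B' \<in> x" "i \<in> B'" using partition_block_of[OF x] \<open>C \<subseteq> V\<close> by blast
      then have "B' = B" using C(2)[of B'] i by blast
      then show "i \<in> B" using B' by simp
    qed
    ultimately have "B = C" by blast
    then show "B \<in> gen V (x \<union> y)" using common_block[OF x y B] C(1) by simp
  qed
  then have cI: "card I \<le> card (gen V (x \<union> y))"
    by (rule card_mono[OF finite_partition[OF finV partition_gen[OF P]]])
  obtain A where A: "transversal x A" "\<forall>A'. transversal y A' \<longrightarrow>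
      int (card x) + int (card y) - 2 * int (card T) \<le> pdist V (blk V A) (blk V A')"
    using far_from_transversals[OF V x y ST(2,4)] by blast
  obtain B where B: "transversal y B" "\<forall>B'. transversal x B' \<longrightarrow>
      int (card y) + int (card x) - 2 * int (card S) \<le> pdist V (blk V B) (blk V B')"
    using far_from_transversals[OF V y x ST(1,3)] by blast
  have "int (card x) - int (card (gen V (x \<union> y)))
    \<le> (int (card x) + int (card y) - 2 * int (card T)) + (int (card y) + int (card x) - 2 * int (card S))"
    using c cI by linarith
  then show ?thesis using A B by blast
qed

section \<open>Nearly modular partitions\<close>

text \<open>If \<open>w\<close> is only slightly coarser than a partition \<open>x\<close> into blocks of size at most two, few points
  lie in blocks of \<open>x\<close> that are not blocks of \<open>w\<close>.  Outside these points a refinement \<open>z\<close> of \<open>w\<close>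
  can glue only pairs that are blocks of \<open>x\<close>, so up to the number of these pairs \<open>z\<close> has almost
  as many blocks as there are points.  For long blocks this would fail, since a single merge may
  then bring together many blocks of \<open>z\<close>.\<close>

lemma card_le_of_small_blocks:
  assumes x: "partition_on V x" and small: "\<And>B. B \<in> x \<Longrightarrow> card B \<le> 2"
    and xw: "refines V x w" and zw: "refines V z w"
  shows "card V + 4 * card w \<le> card z + 4 * card x + card {p \<in> x. card p = 2 \<and> (\<exists>Z \<in> z. p \<subseteq> Z)}"
proof -
  have w: "partition_on V w" and z: "partition_on V z" using xw zw unfolding refines_def by auto
  note fin = finite_partition[OF finV x] finite_partition[OF finV w] finite_partition[OF finV z]
  define D where "D = x - w"
  define E where "E = w - x"
  define P where "P = {p \<in> x. card p = 2 \<and> (\<exists>Z \<in> z. p \<subseteq> Z)}"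
  have fins: "finite D" "finite E" "finite P" using fin unfolding D_def E_def P_def by auto
  have "card x = card (x \<inter> w) + card D"
    unfolding D_def using fin card_Int_Diff by blast
  moreover have "card w = card (x \<inter> w) + card E"
    unfolding E_def using fin card_Int_Diff[of w x] by (simp add: Int_commute)
  moreover have "2 * card E \<le> card D"
  proof -
    have "\<exists>B B'. B \<in> D \<and> B' \<in> D \<and> B \<noteq> B' \<and> B \<subseteq> W \<and> B' \<subseteq> W" if W: "W \<in> E" for W
    proof -
      have Ww: "W \<in> w" "W \<notin> x" using W unfolding E_def by auto
      have below: "\<exists>B. B \<in> x \<and> i \<in> B \<and> B \<subseteq> W" if i: "i \<in> W" for i
      proof -
        have "i \<in> V" using i Ww(1) w unfolding partition_on_def by blast
        then obtain B where B: "B \<in> x" "i \<in> B" using partition_block_of[OF x] by blast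
        obtain W' where W': "W' \<in> w" "B \<subseteq> W'" using xw B(1) unfolding refines_def by blast
        have "W' = W" using partition_block_eq[OF w W'(1) Ww(1)] W'(2) B(2) i by blast
        then show ?thesis using B W' by blast
      qed
      have inD: "B \<in> D" if B: "B \<in> x" "B \<subseteq> W" for B
      proof -
        have "B \<notin> w"
        proof
          assume "B \<in> w"
          moreover have "B \<noteq> {}" using B(1) x unfolding partition_on_def by auto
          ultimately have "B = W" using partition_block_eq[OF w _ Ww(1)] B(2) by blast
          then show False using B(1) Ww(2) by simp
        qed
        then show ?thesis using B(1) unfolding D_def by simp
      qed
      have "W \<noteq> {}" using Ww(1) w unfolding partition_on_def by auto
      then obtain i where "i \<in> W" by blast
      then obtain B where B: "B \<in> x" "i \<in> B" "B \<subseteq> W" using below by blast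
      have "B \<noteq> W" using B(1) Ww(2) by blast
      then obtain j where j: "j \<in> W" "j \<notin> B" using B(3) by blast
      then obtain B' where B': "B' \<in> x" "j \<in> B'" "B' \<subseteq> W" using below by blast
      have "B \<noteq> B'" using j B' by blast
      then show ?thesis using inD[OF B(1,3)] inD[OF B'(1,3)] B(3) B'(3) by blast
    qed
    then obtain b b' where b: "\<And>W. W \<in> E \<Longrightarrow> b W \<in> D \<and> b' W \<in> D \<and> b W \<noteq> b' W \<and> b W \<subseteq> W \<and> b' W \<subseteq> W"
      by metis
    define h where "h = (\<lambda>(W, s). if s then b W else b' W)"
    have hW: "h (W, s) \<in> D \<and> h (W, s) \<subseteq> W" if "W \<in> E" for W s
      using b[OF that] unfolding h_def by auto
    have "inj_on h (E \<times> (UNIV :: bool set))"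
    proof (rule inj_onI, clarify)
      fix W s W' s' assume WW: "W \<in> E" "W' \<in> E" and eq: "h (W, s) = h (W', s')"
      have "h (W, s) \<in> x" using hW[OF WW(1)] unfolding D_def by auto
      then have "h (W, s) \<noteq> {}" using x unfolding partition_on_def by auto
      moreover have "h (W, s) \<subseteq> W" "h (W, s) \<subseteq> W'"
        using hW[OF WW(1), of s] hW[OF WW(2), of s'] eq by simp_all
      ultimately obtain i where i: "i \<in> W" "i \<in> W'" by blast
      have "W = W'" using partition_block_eq[OF w _ _ i] WW unfolding E_def by blast
      moreover have "s = s'" using eq b[OF WW(1)] \<open>W = W'\<close> unfolding h_def by (auto split: if_splits)
      ultimately show "W = W' \<and> s = s'" by simp
    qed
    then have "card (E \<times> (UNIV :: bool set)) \<le> card D"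
      by (rule card_inj_on_le) (use hW fins in auto)
    then show ?thesis by (simp add: card_cartesian_product)
  qed
  moreover have "card V \<le> card z + card P + 2 * card D"
  proof -
    have "\<forall>p \<in> P. \<exists>i. i \<in> p" unfolding P_def by (metis (mono_tags, lifting) card.empty equals0I mem_Collect_eq zero_neq_numeral)
    then obtain sel where sel: "\<And>p. p \<in> P \<Longrightarrow> sel p \<in> p" by metis
    \<comment> \<open>Once one point of every pair that \<open>z\<close> glues is dropped, the remaining points outside \<open>\<Union>D\<close>
      lie in distinct blocks of \<open>z\<close>.\<close>
    define G where "G = V - \<Union>D - sel ` P"
    have "card (\<Union>D) \<le> (\<Sum>B\<in>D. card B)" by (rule card_Union_le_sum_card)
    also have "\<dots> \<le> (\<Sum>B\<in>D. 2)" by (rule sum_mono) (use small in \<open>simp add: D_def\<close>)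
    finally have cD: "card (\<Union>D) \<le> 2 * card D" by simp
    have "V \<subseteq> G \<union> \<Union>D \<union> sel ` P" unfolding G_def by auto
    moreover have fG: "finite G" unfolding G_def using finV by simp
    moreover have "finite (\<Union>D)"
      using finV x by (rule_tac finite_subset[of _ V]) (auto simp: D_def partition_on_def)
    ultimately have "card V \<le> card (G \<union> \<Union>D \<union> sel ` P)" using fins by (intro card_mono) auto
    also have "\<dots> \<le> card G + card (\<Union>D) + card (sel ` P)"
      using card_Un_le[of "G \<union> \<Union>D" "sel ` P"] card_Un_le[of G "\<Union>D"] by linarith
    also have "\<dots> \<le> card G + 2 * card D + card P"
      using cD card_image_le[OF fins(3), of sel] by linarith
    finally have "card V \<le> card G + 2 * card D + card P" .
    moreover have "card G \<le> card z"
    proof -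
      have "\<forall>i \<in> G. \<exists>Z. Z \<in> z \<and> i \<in> Z" using partition_block_of[OF z] unfolding G_def by blast
      then obtain f where f: "\<And>i. i \<in> G \<Longrightarrow> f i \<in> z" "\<And>i. i \<in> G \<Longrightarrow> i \<in> f i" by metis
      have "inj_on f G"
      proof (rule inj_onI, rule ccontr)
        fix i j assume ij: "i \<in> G" "j \<in> G" "f i = f j" "i \<noteq> j"
        obtain W where W: "W \<in> w" "f i \<subseteq> W" using zw f(1)[OF ij(1)] unfolding refines_def by blast
        have iW: "i \<in> W" "j \<in> W" using W(2) f(2)[OF ij(1)] f(2)[OF ij(2)] ij(3) by auto
        have "i \<in> V" "i \<notin> \<Union>D" using ij(1) unfolding G_def by auto
        then obtain B where B: "B \<in> x" "i \<in> B" "B \<in> w"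
          using partition_block_of[OF x, of i] unfolding D_def by blast
        have "B = W" using partition_block_eq[OF w B(3) W(1) B(2) iW(1)] .
        then have "{i, j} \<subseteq> B" using iW by simp
        moreover have "finite B" using B(1) finV x unfolding partition_on_def by (meson Union_upper finite_subset)
        moreover have "card {i, j} = 2" using ij(4) by simp
        ultimately have "B = {i, j}" using small[OF B(1)] by (metis card_seteq)
        then have "B \<in> P"
          unfolding P_def using B(1) ij(3,4) f(1)[OF ij(1)] f(2)[OF ij(1)] f(2)[OF ij(2)] by auto
        moreover have "sel B \<noteq> i" "sel B \<noteq> j" using ij(1,2) \<open>B \<in> P\<close> unfolding G_def by auto
        ultimately show False using sel[of B] \<open>B = {i, j}\<close> by simp
      qed
      then show ?thesis by (rule card_inj_on_le) (use f fin in auto)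
    qed
    ultimately show ?thesis by linarith
  qed
  ultimately show ?thesis unfolding P_def by linarith
qed

lemma unsplit_subset: "\<lbrakk>unsplit w T; S \<subseteq> T\<rbrakk> \<Longrightarrow> unsplit w S"
  unfolding unsplit_def by blast

lemma unsplit_block_eq:
  assumes w: "partition_on V w" and S: "unsplit w S" "i \<in> S" "i \<in> V"
  shows "\<exists>W \<in> w. S \<subseteq> W"
  using partition_block_of[OF w S(3)] S(1,2) unfolding unsplit_def by blast

text \<open>Joining two blocks lowers the number of blocks by at most one.\<close>

lemma card_gen_pair_merges:
  assumes y: "partition_on V y" and L: "finite L" "L \<subseteq> y" "g ` L \<subseteq> y"
  shows "card y \<le> card (gen V (y \<union> (\<lambda>B. B \<union> g B) ` L)) + card L"
  using L
proof (induction L)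
  case empty
  then show ?case using gen_partition[OF y] by simp
next
  case (insert B L)
  define F where "F = y \<union> (\<lambda>B. B \<union> g B) ` L"
  have PF: "F \<subseteq> Pow V" using insert.prems partition_Pow[OF y] unfolding F_def by blast
  have By: "B \<in> y" "g B \<in> y" using insert.prems by auto
  have BV: "B \<noteq> {}" "g B \<noteq> {}" "B \<subseteq> V" "g B \<subseteq> V"
    using By y unfolding partition_on_def by auto
  note p = partition_gen[OF PF]
  have u: "unsplit (gen V F) B" "unsplit (gen V F) (g B)"
    using unsplit_gen[OF PF] By unfolding F_def by auto
  obtain W where W: "W \<in> gen V F" "B \<subseteq> W" using unsplit_block_eq[OF p u(1)] BV by blast
  obtain W' where W': "W' \<in> gen V F" "g B \<subseteq> W'" using unsplit_block_eq[OF p u(2)] BV by blast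
  have "touched (gen V F) (B \<union> g B) \<subseteq> {W, W'}"
  proof
    fix U assume "U \<in> touched (gen V F) (B \<union> g B)"
    then obtain i where i: "U \<in> gen V F" "i \<in> U" "i \<in> W \<or> i \<in> W'"
      using W(2) W'(2) unfolding touched_def by blast
    then show "U \<in> {W, W'}"
      using partition_block_eq[OF p i(1) W(1) i(2)] partition_block_eq[OF p i(1) W'(1) i(2)] by auto
  qed
  then have "card (touched (gen V F) (B \<union> g B)) \<le> card {W, W'}" by (rule card_mono[rotated]) simp
  also have "\<dots> \<le> 2" by (simp add: card_insert_if)
  finally have t: "card (touched (gen V F) (B \<union> g B)) \<le> 2" .
  have S: "B \<union> g B \<subseteq> V" "B \<union> g B \<noteq> {}" using BV by auto
  have "card (gen V (insert (B \<union> g B) F)) + card (touched (gen V F) (B \<union> g B)) = card (gen V F) + 1"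
    using card_merge[OF finV p S] gen_insert[OF PF S] by simp
  moreover have "card y \<le> card (gen V F) + card L" using insert.IH insert.prems unfolding F_def by simp
  moreover have "y \<union> (\<lambda>B. B \<union> g B) ` insert B L = insert (B \<union> g B) F" unfolding F_def by simp
  ultimately show ?case using insert.hyps t by simp
qed

lemma card_gen_linked_blocks:
  assumes y: "partition_on V y" and z: "partition_on V z"
    and I: "I \<subseteq> y" "g ` I \<subseteq> y" "I \<inter> g ` I = {}" "inj_on g I"
    and link: "\<And>B. B \<in> I \<Longrightarrow> \<exists>Z \<in> z. Z \<inter> B \<noteq> {} \<and> Z \<inter> g B \<noteq> {}"
  shows "card (gen V (z \<union> y)) + card I \<le> card y"
proof -
  have P: "z \<union> y \<subseteq> Pow V" using partition_Pow y z by blast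
  note p = partition_gen[OF P]
  have fin: "finite y" "finite I" using finite_partition[OF finV y] I(1) finite_subset by auto
  have up: "\<exists>W. W \<in> gen V (z \<union> y) \<and> B \<subseteq> W" if B: "B \<in> y" for B
  proof -
    have "B \<noteq> {}" "B \<subseteq> V" using B y unfolding partition_on_def by auto
    then obtain i where "i \<in> B" "i \<in> V" by blast
    moreover have "unsplit (gen V (z \<union> y)) B" by (rule unsplit_gen[OF P]) (use B in simp)
    ultimately show ?thesis using unsplit_block_eq[OF p] by blast
  qed
  then obtain f where f: "\<And>B. B \<in> y \<Longrightarrow> f B \<in> gen V (z \<union> y)" "\<And>B. B \<in> y \<Longrightarrow> B \<subseteq> f B" by metis
  have feq: "f B = W" if "B \<in> y" "W \<in> gen V (z \<union> y)" "W \<inter> B \<noteq> {}" for B W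
  proof -
    from that(3) obtain i where "i \<in> W" "i \<in> B" by blast
    then show ?thesis using partition_block_eq[OF p f(1)[OF that(1)] that(2), of i] f(2)[OF that(1)] by auto
  qed
  have "gen V (z \<union> y) \<subseteq> f ` (y - g ` I)"
  proof
    fix W assume W: "W \<in> gen V (z \<union> y)"
    then have "W \<noteq> {}" "W \<subseteq> V" using p unfolding partition_on_def by auto
    then obtain i where i: "i \<in> W" "i \<in> V" by blast
    then obtain B where B: "B \<in> y" "i \<in> B" using partition_block_of[OF y] by blast
    have fB: "f B = W" by (rule feq[OF B(1) W]) (use i B in blast)
    show "W \<in> f ` (y - g ` I)"
    proof (cases "B \<in> g ` I")
      case False
      then show ?thesis using fB B(1) by blast
    next
      case True
      then obtain C where C: "C \<in> I" "B = g C" by blast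
      obtain Z where Z: "Z \<in> z" "Z \<inter> C \<noteq> {}" "Z \<inter> B \<noteq> {}" using link[OF C(1)] C(2) by blast
      have uZ: "unsplit (gen V (z \<union> y)) Z" by (rule unsplit_gen[OF P]) (use Z in simp)
      have "B \<subseteq> W" using f(2)[OF B(1)] fB by simp
      then have "W \<inter> Z \<noteq> {}" using Z(3) by blast
      then have "Z \<subseteq> W" using uZ W unfolding unsplit_def by blast
      then have "W \<inter> C \<noteq> {}" using Z(2) by blast
      moreover have Cy: "C \<in> y" "C \<notin> g ` I" using C(1) I(1,3) by auto
      ultimately have "f C = W" using feq[OF Cy(1) W] by simp
      then show ?thesis using Cy by blast
    qed
  qed
  then have "card (gen V (z \<union> y)) \<le> card (y - g ` I)" using fin by (intro surj_card_le) auto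
  moreover have "card (y - g ` I) + card (g ` I) = card y"
    using I(2) fin by (metis card_Diff_subset card_mono finite_imageI le_add_diff_inverse2)
  moreover have "card (g ` I) = card I" by (rule card_image[OF I(4)])
  ultimately show ?thesis by linarith
qed

text \<open>A partition that looks modular is close to one with a single nontrivial block.  Suppose that \<open>y\<close>
  has many nontrivial blocks, pair them up as \<open>B\<close> and \<open>g B\<close>, and choose two points \<open>a B\<close> and \<open>b B\<close> in each.
  Besides singletons, the test partition \<open>x\<close> has the blocks \<open>{a B, a (g B)}\<close> and
  \<open>{b B, b (g B)}\<close>.  The second pair is redundant modulo \<open>y\<close>, so modularity demands a partition \<open>z\<close> of large rank that is nearly below both
  \<open>x\<close> and \<open>y\<close>.  Being nearly below \<open>x\<close>, it glues many of these pairs, and each of them merges two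
  blocks of \<open>y\<close>, so that \<open>z\<close> is not nearly below \<open>y\<close>.\<close>

lemma near_one_block:
  fixes \<delta> :: real
  assumes V: "V \<noteq> {}" and y: "partition_on V y"
    and test: "\<And>x. partition_on V x \<Longrightarrow> \<exists>z. partition_on V z \<and>
      (real (card x) - real (card (gen V (z \<union> x)))) + (real (card y) - real (card (gen V (z \<union> y)))) +
      max 0 (real (card (gen V (x \<union> y))) + real (card z) - real (card x) - real (card y)) \<le> \<delta>"
  shows "\<exists>S \<subseteq> V. S \<noteq> {} \<and> real_of_int (pdist V y (blk V S)) \<le> 8 * \<delta>"
proof -
  define K where "K = {B \<in> y. card B \<ge> 2}"
  have fy: "finite y" by (rule finite_partition[OF finV y])
  have Ky: "K \<subseteq> y" and fK: "finite K" unfolding K_def using fy by auto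
  have fB: "finite B" if "B \<in> y" for B
    using that finV y unfolding partition_on_def by (meson Union_upper finite_subset)
  define m where "m = card K div 2"
  have "m \<le> card K" unfolding m_def by (rule div_le_dividend)
  then obtain K1 where K1: "K1 \<subseteq> K" "card K1 = m"
    by (metis obtain_subset_with_card_n)
  have "m \<le> card (K - K1)"
    using card_Diff_subset[OF finite_subset[OF K1(1) fK] K1(1)] K1(2) unfolding m_def by linarith
  then obtain K2 where K2: "K2 \<subseteq> K - K1" "card K2 = m"
    by (metis obtain_subset_with_card_n)
  have fK12: "finite K1" "finite K2" using K1 K2 fK by (auto intro: finite_subset)
  obtain g where g: "bij_betw g K1 K2"
    using finite_same_card_bij[OF fK12] K1(2) K2(2) by auto
  have ginj: "inj_on g K1" and gK: "g ` K1 = K2" using g unfolding bij_betw_def by auto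
  have "\<forall>B \<in> K. \<exists>i j. i \<in> B \<and> j \<in> B \<and> i \<noteq> j"
  proof
    fix B assume "B \<in> K"
    then have "\<not> card B \<le> Suc 0" "finite B" using fB unfolding K_def by auto
    then show "\<exists>i j. i \<in> B \<and> j \<in> B \<and> i \<noteq> j" using card_le_Suc0_iff_eq by blast
  qed
  then obtain a b where ab: "\<And>B. B \<in> K \<Longrightarrow> a B \<in> B" "\<And>B. B \<in> K \<Longrightarrow> b B \<in> B"
    "\<And>B. B \<in> K \<Longrightarrow> a B \<noteq> b B"
    by metis
  define h where "h = (\<lambda>(B, s). if s then a B else b B)"
  have hB: "h (B, s) \<in> B" if "B \<in> K" for B s using ab(1,2)[OF that] unfolding h_def by simp
  have hinj: "inj_on h (K \<times> (UNIV :: bool set))"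
  proof (rule inj_onI, clarify)
    fix B s B' s' assume BB: "B \<in> K" "B' \<in> K" and eq: "h (B, s) = h (B', s')"
    have "h (B, s) \<in> B'" using hB[OF BB(2), of s'] eq by simp
    then have "B = B'" using partition_block_eq[OF y _ _ hB[OF BB(1), of s]] BB Ky by blast
    moreover have "s = s'" using eq ab(3)[OF BB(1)] \<open>B = B'\<close> unfolding h_def by (auto split: if_splits)
    ultimately show "B = B' \<and> s = s'" by simp
  qed
  define q where "q = (\<lambda>(B, s). {h (B, s), h (g B, s)})"
  define Pr where "Pr = q ` (K1 \<times> (UNIV :: bool set))"
  have gB: "g B \<in> K2" "g B \<in> K" "g B \<notin> K1" if "B \<in> K1" for B using that gK K2(1) by auto
  have hh: "h (B, s) = h (B', s') \<longleftrightarrow> B = B' \<and> s = s'" if "B \<in> K" "B' \<in> K" for B B' s s'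
    using inj_on_eq_iff[OF hinj, of "(B, s)" "(B', s')"] that by simp
  have qdisj: "p = p'" if p: "p \<in> K1 \<times> (UNIV :: bool set)" "p' \<in> K1 \<times> (UNIV :: bool set)"
    and i: "i \<in> q p" "i \<in> q p'" for p p' i
  proof -
    obtain B s B' s' where e: "p = (B, s)" "p' = (B', s')" by (cases p, cases p')
    have B: "B \<in> K1" "B' \<in> K1" using p e by auto
    have K: "B \<in> K" "B' \<in> K" using B K1 by auto
    have "i = h (B, s) \<or> i = h (g B, s)" "i = h (B', s') \<or> i = h (g B', s')"
      using i e unfolding q_def by auto
    then have "(B = B' \<or> B = g B' \<or> g B = B' \<or> g B = g B') \<and> s = s'"
      using hh K gB(2)[OF B(1)] gB(2)[OF B(2)] by metis
    moreover have "B \<noteq> g B'" "g B \<noteq> B'" using gB(3) B by metis+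
    moreover have "g B = g B' \<longleftrightarrow> B = B'" using inj_on_eq_iff[OF ginj B] .
    ultimately show ?thesis using e by auto
  qed
  have q2: "card (q p) = 2" if p: "p \<in> K1 \<times> (UNIV :: bool set)" for p
  proof -
    obtain B s where e: "p = (B, s)" by (cases p)
    have B: "B \<in> K1" using p e by auto
    then have "h (B, s) \<noteq> h (g B, s)" using hh[of B "g B"] gB[OF B] K1(1) by auto
    then show ?thesis unfolding e q_def by simp
  qed
  have qinj: "inj_on q (K1 \<times> (UNIV :: bool set))"
  proof (rule inj_onI)
    fix p p' assume p: "p \<in> K1 \<times> (UNIV :: bool set)" "p' \<in> K1 \<times> (UNIV :: bool set)" "q p = q p'"
    then have "q p \<noteq> {}" using q2[OF p(1)] by force
    then show "p = p'" using qdisj[OF p(1,2)] p(3) by blast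
  qed
  have cPr: "card Pr = 2 * m"
    unfolding Pr_def card_image[OF qinj] using K1(2) by (simp add: card_cartesian_product)
  have fPr: "finite Pr" unfolding Pr_def using fK12 by simp
  have UPr: "\<Union>Pr = h ` ((K1 \<union> K2) \<times> (UNIV :: bool set))"
  proof -
    have "\<Union>Pr = h ` (K1 \<times> (UNIV :: bool set)) \<union> (\<Union>B \<in> K1. \<Union>s. {h (g B, s)})"
      unfolding Pr_def q_def by auto
    also have "(\<Union>B \<in> K1. \<Union>s. {h (g B, s)}) = h ` (K2 \<times> (UNIV :: bool set))"
      unfolding gK[symmetric] by auto
    finally show ?thesis by auto
  qed
  have "card ((K1 \<union> K2) \<times> (UNIV :: bool set)) = 4 * m"
  proof -
    have "K1 \<inter> K2 = {}" using K2(1) by auto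
    then show ?thesis using K1(2) K2(2) fK12 by (simp add: card_cartesian_product card_Un_disjoint)
  qed
  moreover have "inj_on h ((K1 \<union> K2) \<times> (UNIV :: bool set))"
    using hinj by (rule inj_on_subset) (use K1 K2 in auto)
  ultimately have cUPr: "card (\<Union>Pr) = 4 * m" unfolding UPr by (simp add: card_image)
  have UPrV: "\<Union>Pr \<subseteq> V"
  proof -
    have "h (B, s) \<in> V" if "B \<in> K" for B s using hB[OF that] that Ky y unfolding partition_on_def by blast
    then show ?thesis unfolding UPr using K1 K2 by auto
  qed
  define x where "x = Pr \<union> (\<lambda>i. {i}) ` (V - \<Union>Pr)"
  have x: "partition_on V x"
  proof (rule partition_onI)
    show "\<Union>x = V" using UPrV unfolding x_def by auto
    have "{} \<notin> Pr" using q2 unfolding Pr_def by (metis card.empty imageE zero_neq_numeral)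
    then show "{} \<notin> x" unfolding x_def by auto
    have 1: "disjnt p p'" if "p \<in> Pr" "p' \<in> Pr" "p \<noteq> p'" for p p'
      using that qdisj unfolding Pr_def disjnt_iff by blast
    have 2: "disjnt p p'" if "p \<in> Pr" "p' \<in> (\<lambda>i. {i}) ` (V - \<Union>Pr)" for p p'
      using that unfolding disjnt_iff by auto
    fix p p' assume "p \<in> x" "p' \<in> x" "p \<noteq> p'"
    then show "disjnt p p'"
      unfolding x_def using 1[of p p'] 2[of p p'] 2[of p' p] disjnt_sym[of p' p] by auto
  qed
  have "card x + 4 * m = 2 * m + card V"
  proof -
    have "Pr \<inter> (\<lambda>i. {i}) ` (V - \<Union>Pr) = {}" by auto
    moreover have "card ((\<lambda>i. {i}) ` (V - \<Union>Pr)) = card (V - \<Union>Pr)" by (rule card_image) auto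
    ultimately have "card x = 2 * m + card (V - \<Union>Pr)"
      unfolding x_def using fPr cPr finV by (simp add: card_Un_disjoint)
    moreover have "card (V - \<Union>Pr) + card (\<Union>Pr) = card V"
      using UPrV finV by (metis card_Diff_subset card_mono finite_subset le_add_diff_inverse2)
    ultimately show ?thesis using cUPr by simp
  qed
  then have cx: "real (card x) = real (card V) - 2 * real m" by linarith
  have small: "card B \<le> 2" if "B \<in> x" for B
    using that q2 unfolding x_def Pr_def by auto
  \<comment> \<open>The join with \<open>x\<close> glues only \<open>m\<close> pairs of blocks of \<open>y\<close>, whereas \<open>x\<close> has rank \<open>2 m\<close>.\<close>
  have P: "x \<union> y \<subseteq> Pow V" using partition_Pow x y by blast
  have join: "card y \<le> card (gen V (x \<union> y)) + m"
  proof -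
    define F where "F = y \<union> (\<lambda>B. B \<union> g B) ` K1"
    have K1y: "K1 \<subseteq> y" "g ` K1 \<subseteq> y" using K1 K2 gK Ky by auto
    have PF: "F \<subseteq> Pow V" using K1y partition_Pow[OF y] unfolding F_def by blast
    have "refines V (gen V (x \<union> y)) (gen V F)"
    proof (rule gen_least[OF P partition_gen[OF PF]])
      fix S assume "S \<in> x \<union> y"
      then consider "S \<in> y" | "S \<in> Pr" | i where "S = {i}" unfolding x_def by auto
      then show "unsplit (gen V F) S"
      proof cases
        case 1
        then show ?thesis using unsplit_gen[OF PF] unfolding F_def by blast
      next
        case 2
        then obtain B s where B: "B \<in> K1" "S = q (B, s)" unfolding Pr_def by auto
        have "S \<subseteq> B \<union> g B" unfolding B(2) q_def using hB[of B s] hB[of "g B" s] B(1) K1(1) gB(2) by auto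
        moreover have "unsplit (gen V F) (B \<union> g B)"
          using unsplit_gen[OF PF, of "B \<union> g B"] B(1) unfolding F_def by blast
        ultimately show ?thesis by (rule unsplit_subset[rotated])
      next
        case 3
        then show ?thesis unfolding unsplit_def by auto
      qed
    qed
    then have "card (gen V F) \<le> card (gen V (x \<union> y))" by (rule card_refines)
    moreover have "card y \<le> card (gen V F) + card K1"
      unfolding F_def by (rule card_gen_pair_merges[OF y fK12(1) K1y])
    ultimately show ?thesis using K1(2) by linarith
  qed
  obtain z where z: "partition_on V z" and dz:
      "(real (card x) - real (card (gen V (z \<union> x)))) + (real (card y) - real (card (gen V (z \<union> y)))) +
      max 0 (real (card (gen V (x \<union> y))) + real (card z) - real (card x) - real (card y)) \<le> \<delta>"
    using test[OF x] by blast
  have Pz: "z \<union> x \<subseteq> Pow V" "z \<union> y \<subseteq> Pow V" using partition_Pow x y z by blast+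
  have r: "refines V x (gen V (z \<union> x))" "refines V z (gen V (z \<union> x))" "refines V y (gen V (z \<union> y))"
    using gen_mono[of x "z \<union> x"] gen_mono[of z "z \<union> x"] gen_mono[of y "z \<union> y"] Pz
      gen_partition[OF x] gen_partition[OF y] gen_partition[OF z] by simp_all
  define Q where "Q = {p \<in> x. card p = 2 \<and> (\<exists>Z \<in> z. p \<subseteq> Z)}"
  have c1: "card V + 4 * card (gen V (z \<union> x)) \<le> card z + 4 * card x + card Q"
    unfolding Q_def by (rule card_le_of_small_blocks[OF x small r(1,2)])
  define I where "I = {B \<in> K1. \<exists>s. \<exists>Z \<in> z. q (B, s) \<subseteq> Z}"
  have "Q \<subseteq> q ` (I \<times> (UNIV :: bool set))"
  proof
    fix p assume p: "p \<in> Q"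
    then have "p \<in> Pr" unfolding Q_def x_def by auto
    then obtain B s where B: "B \<in> K1" "p = q (B, s)" unfolding Pr_def by auto
    then have "B \<in> I" using p unfolding Q_def I_def by auto
    then show "p \<in> q ` (I \<times> UNIV)" using B(2) by blast
  qed
  moreover have fI: "finite I" unfolding I_def using fK12 by simp
  ultimately have "card Q \<le> card (I \<times> (UNIV :: bool set))" by (intro surj_card_le) auto
  then have c2: "card Q \<le> 2 * card I" by (simp add: card_cartesian_product)
  have c3: "card (gen V (z \<union> y)) + card I \<le> card y"
  proof (rule card_gen_linked_blocks[OF y z, of I g])
    have "I \<subseteq> K1" unfolding I_def by auto
    then have gI: "g ` I \<subseteq> K2" using gK by auto
    show "I \<subseteq> y" "inj_on g I" using \<open>I \<subseteq> K1\<close> K1(1) Ky inj_on_subset[OF ginj] by auto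
    show "g ` I \<subseteq> y" "I \<inter> g ` I = {}" using \<open>I \<subseteq> K1\<close> gI K2(1) Ky by blast+
    fix B assume "B \<in> I"
    then obtain s Z where B: "B \<in> K1" "Z \<in> z" "q (B, s) \<subseteq> Z" unfolding I_def by blast
    then have "h (B, s) \<in> Z" "h (g B, s) \<in> Z" unfolding q_def by auto
    moreover have "h (B, s) \<in> B" "h (g B, s) \<in> g B" using hB B(1) K1(1) gB(2) by auto
    ultimately show "\<exists>Z \<in> z. Z \<inter> B \<noteq> {} \<and> Z \<inter> g B \<noteq> {}" using B(2) by blast
  qed
  have le: "card (gen V (z \<union> x)) \<le> card x" "card (gen V (z \<union> y)) \<le> card y"
    using card_refines r by auto
  have m4: "real m \<le> 4 * \<delta>" and d0: "0 \<le> \<delta>"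
    using c1 c2 c3 cx join dz le by linarith+
  \<comment> \<open>Gluing the nontrivial blocks of \<open>y\<close> into one block costs one less than their number.\<close>
  show ?thesis
  proof (cases "K = {}")
    case True
    obtain i where i: "i \<in> V" using V by blast
    have iV: "{i} \<subseteq> V" "{i} \<noteq> {}" using i by auto
    have "card V = card y"
    proof -
      have "card B = 1" if "B \<in> y" for B
      proof -
        have "B \<noteq> {}" using that y unfolding partition_on_def by auto
        then have "card B \<noteq> 0" using fB[OF that] by simp
        moreover have "\<not> card B \<ge> 2" using True that unfolding K_def by blast
        ultimately show ?thesis by linarith
      qed
      then have "card (\<Union>y) = (\<Sum>B\<in>y. 1)"
        using card_Union_disjoint[of y] partition_onD2[OF y] fB by (simp add: pairwise_def disjnt_def)
      then show ?thesis using y unfolding partition_on_def by simp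
    qed
    moreover have "unsplit y {i}" unfolding unsplit_def by auto
    then have "gen V (insert {i} y) = y"
      by (intro gen_eqI) (use y refines_iff_unsplit[OF y] refines_refl[OF y] in \<open>auto simp: is_gen_def\<close>)
    ultimately have "pdist V y (blk V {i}) = 0"
      unfolding pdist_def gen_Un_blk[OF y iV(1)] using card_blk[OF iV] by simp
    then show ?thesis using iV d0 by (intro exI[of _ "{i}"]) auto
  next
    case False
    have sub: "\<Union>K \<subseteq> V" using Ky y unfolding partition_on_def by blast
    have ne: "\<Union>K \<noteq> {}" using False ab(1) by blast
    have t: "touched y (\<Union>K) = K"
    proof (intro equalityI subsetI)
      fix B assume "B \<in> touched y (\<Union>K)"
      then obtain i C where i: "B \<in> y" "i \<in> B" "C \<in> K" "i \<in> C" unfolding touched_def by blast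
      then have "B = C" using partition_block_eq[OF y i(1) _ i(2,4)] Ky by blast
      then show "B \<in> K" using i by simp
    next
      fix B assume "B \<in> K"
      then show "B \<in> touched y (\<Union>K)" using Ky ab(1)[of B] unfolding touched_def by blast
    qed
    have "card V = card (y - K) + card (\<Union>K)"
    proof -
      have one: "card B = 1" if "B \<in> y - K" for B
      proof -
        have "B \<noteq> {}" using that y unfolding partition_on_def by auto
        then have "card B \<noteq> 0" using fB[of B] that by simp
        moreover have "\<not> card B \<ge> 2" using that unfolding K_def by blast
        ultimately show ?thesis by linarith
      qed
      have "V - \<Union>K = \<Union>(y - K)"
      proof (intro equalityI subsetI)
        fix i assume "i \<in> V - \<Union>K"
        then show "i \<in> \<Union>(y - K)" using partition_block_of[OF y, of i] by blast
      next
        fix i assume "i \<in> \<Union>(y - K)"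
        then obtain B where B: "B \<in> y" "B \<notin> K" "i \<in> B" by blast
        have "i \<notin> C" if "C \<in> K" for C
          using partition_block_eq[OF y B(1) _ B(3), of C] that Ky B(2) by blast
        moreover have "i \<in> V" using B y unfolding partition_on_def by blast
        ultimately show "i \<in> V - \<Union>K" by blast
      qed
      also have "card (\<Union>(y - K)) = card (y - K)"
      proof -
        have "card (\<Union>(y - K)) = (\<Sum>B\<in>y - K. card B)"
          by (rule card_Union_disjoint)
            (use partition_onD2[OF y] fB in \<open>auto simp: pairwise_def\<close>)
        also have "\<dots> = (\<Sum>B\<in>y - K. 1)" by (rule sum.cong) (use one in auto)
        finally show ?thesis by simp
      qed
      finally have "card (V - \<Union>K) = card (y - K)" .
      moreover have "card (V - \<Union>K) + card (\<Union>K) = card V"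
        using sub finV by (metis card_Diff_subset card_mono finite_subset le_add_diff_inverse2)
      ultimately show ?thesis by simp
    qed
    moreover have "card (y - K) + card K = card y"
      using Ky fy by (metis card_Diff_subset card_mono finite_subset le_add_diff_inverse2)
    ultimately have "pdist V y (blk V (\<Union>K)) = int (card K) - 1"
      unfolding pdist_def gen_Un_blk[OF y sub] using card_blk[OF sub ne] card_gen_insert[OF y sub ne] t by simp
    moreover have "int (card K) - 1 \<le> 2 * int m" unfolding m_def by linarith
    ultimately have "real_of_int (pdist V y (blk V (\<Union>K))) \<le> 8 * \<delta>" using m4 by linarith
    then show ?thesis using sub ne by blast
  qed
qed

end

section \<open>Transfer of formulas from partition lattices to models\<close>

definition clip :: "real \<Rightarrow> real"
  where "clip t = max 0 (min 1 t)"

lemma clip_bounds: "0 \<le> clip t" "clip t \<le> 1"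
  unfolding clip_def by auto

lemma clip_id: "0 \<le> t \<Longrightarrow> t \<le> 1 \<Longrightarrow> clip t = t"
  unfolding clip_def by auto

lemma clip_eq_0_iff: "clip t = 0 \<longleftrightarrow> t \<le> 0"
  unfolding clip_def by auto

lemma le_of_clip_less: "clip t < 1 \<Longrightarrow> t \<le> clip t"
  unfolding clip_def by auto

text \<open>The only connectives needed: an affine combination of the arguments, truncated to the unit
  interval.  An inequality says that a truncated difference is 0.\<close>

definition FLin :: "real \<Rightarrow> (real \<times> fml) list \<Rightarrow> fml"
  where "FLin c ps = Conn (\<lambda>v. clip (c + (\<Sum>i<length ps. fst (ps ! i) * v i))) (map snd ps)"

lemma fml_val_FLin [simp]:
  "fml_val M (FLin c ps) e = clip (c + sum_list (map (\<lambda>p. fst p * fml_val M (snd p) e) ps))"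
  unfolding FLin_def by (simp add: sum_list_sum_nth atLeast0LessThan cong: sum.cong_simp)

lemma wff_FLin [simp]: "wff (FLin c ps) \<longleftrightarrow> (\<forall>p \<in> set ps. wff (snd p))"
proof -
  have "connective (length ps) (\<lambda>v. clip (c + (\<Sum>i<length ps. fst (ps ! i) * v i)))"
    unfolding connective_def
  proof (intro conjI)
    have "continuous_on (unit_cube (length ps)) (\<lambda>v :: nat \<Rightarrow> real. v i)" for i
      by (rule continuous_on_subset[OF continuous_on_product_coordinates]) simp
    then show "continuous_on (unit_cube (length ps)) (\<lambda>v. clip (c + (\<Sum>i<length ps. fst (ps ! i) * v i)))"
      unfolding clip_def by (intro continuous_intros)
    show "(\<lambda>v. clip (c + (\<Sum>i<length ps. fst (ps ! i) * v i))) ` unit_cube (length ps) \<subseteq> {0..1}"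
      using clip_bounds by auto
  qed
  then show ?thesis unfolding FLin_def by simp
qed

lemma free_vars_FLin [simp]: "free_vars (FLin c ps) = (\<Union>p \<in> set ps. free_vars (snd p))"
  unfolding FLin_def by simp

lemma trm_val_closed:
  assumes "fpl_structure M" "range e \<subseteq> carrier M"
  shows "trm_val M t e \<in> carrier M"
proof -
  interpret fpl_structure M by fact
  show ?thesis
    using assms(2) by (induction t) (auto intro: lzero_closed lone_closed lplus_closed)
qed

lemma range_fun_upd_carrier: "\<lbrakk>range e \<subseteq> carrier M; a \<in> carrier M\<rbrakk> \<Longrightarrow> range (e(v := a)) \<subseteq> carrier M"
  by auto

text \<open>The suprema and infima are taken in the reals, so this is what makes them meaningful.\<close>

lemma fml_val_bounds:
  assumes "fpl_structure M" "wff f" "range e \<subseteq> carrier M"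
  shows "fml_val M f e \<in> {0..1}"
  using assms(2,3)
proof (induction f arbitrary: e)
  case (Dist s t)
  interpret fpl_structure M by fact
  show ?case
    using diameter trm_val_closed[OF assms(1) Dist.prems(2)] nonneg by simp
next
  case (Conn u fs)
  have "(\<lambda>i \<in> {..<length fs}. map (\<lambda>f. fml_val M f e) fs ! i) \<in> unit_cube (length fs)"
    unfolding unit_cube_def using Conn by auto
  moreover have "connective (length fs) u" using Conn.prems(1) by simp
  then have "u ` unit_cube (length fs) \<subseteq> {0..1}" unfolding connective_def by (rule conjunct2)
  ultimately have "u (\<lambda>i \<in> {..<length fs}. map (\<lambda>f. fml_val M f e) fs ! i) \<in> {0..1}" by blast
  then show ?case unfolding fml_val.simps .
next
  case (FSup v f)
  interpret fpl_structure M by fact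
  have *: "fml_val M f (e(v := a)) \<in> {0..1}" if "a \<in> carrier M" for a
    using FSup that range_fun_upd_carrier[OF FSup.prems(2) that] by simp
  have "bdd_above ((\<lambda>a. fml_val M f (e(v := a))) ` carrier M)" using * by (intro bdd_aboveI[of _ 1]) auto
  then have "0 \<le> (SUP a \<in> carrier M. fml_val M f (e(v := a)))"
    using * lzero_closed by (intro cSUP_upper2[OF _ lzero_closed]) auto
  moreover have "(SUP a \<in> carrier M. fml_val M f (e(v := a))) \<le> 1"
    using * lzero_closed by (intro cSUP_least) auto
  ultimately show ?case by simp
next
  case (FInf v f)
  interpret fpl_structure M by fact
  have *: "fml_val M f (e(v := a)) \<in> {0..1}" if "a \<in> carrier M" for a
    using FInf that range_fun_upd_carrier[OF FInf.prems(2) that] by simp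
  have "bdd_below ((\<lambda>a. fml_val M f (e(v := a))) ` carrier M)" using * by (intro bdd_belowI[of _ 0]) auto
  then have "(INF a \<in> carrier M. fml_val M f (e(v := a))) \<le> 1"
    using * lzero_closed by (intro cINF_lower2[OF _ lzero_closed]) auto
  moreover have "0 \<le> (INF a \<in> carrier M. fml_val M f (e(v := a)))"
    using * lzero_closed by (intro cINF_greatest) auto
  ultimately show ?case by simp
qed

definition sups :: "nat list \<Rightarrow> fml \<Rightarrow> fml"
  where "sups vs f = foldr FSup vs f"

lemma sups_simps [simp]: "sups [] f = f" "sups (v # vs) f = FSup v (sups vs f)"
  unfolding sups_def by simp_all

lemma wff_sups [simp]: "wff (sups vs f) \<longleftrightarrow> wff f"
  by (induction vs) auto

lemma free_vars_sups [simp]: "free_vars (sups vs f) = free_vars f - set vs"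
  by (induction vs) auto

lemma fml_val_of_sups:
  assumes M: "fpl_structure M" and f: "wff f"
  shows "\<lbrakk>range e \<subseteq> carrier M; range e' \<subseteq> carrier M; \<And>v. v \<notin> set vs \<Longrightarrow> e' v = e v;
    fml_val M (sups vs f) e = 0\<rbrakk> \<Longrightarrow> fml_val M f e' = 0"
proof (induction vs arbitrary: e)
  case Nil
  then have "e' = e" by auto
  then show ?case using Nil by simp
next
  case (Cons v vs)
  have e'v: "e' v \<in> carrier M" using Cons.prems(2) by auto
  have b: "fml_val M (sups vs f) (e(v := a)) \<in> {0..1}" if "a \<in> carrier M" for a
    by (rule fml_val_bounds[OF M]) (use f range_fun_upd_carrier[OF Cons.prems(1) that] in auto)
  have "bdd_above ((\<lambda>a. fml_val M (sups vs f) (e(v := a))) ` carrier M)"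
    using b by (intro bdd_aboveI[of _ 1]) auto
  then have "fml_val M (sups vs f) (e(v := e' v)) \<le> fml_val M (sups (v # vs) f) e"
    using cSUP_upper[OF e'v, of "\<lambda>a. fml_val M (sups vs f) (e(v := a))"] by simp
  then have "fml_val M (sups vs f) (e(v := e' v)) = 0"
    using Cons.prems(4) b[OF e'v] by simp
  then show ?case
    by (rule Cons.IH[OF range_fun_upd_carrier[OF Cons.prems(1) e'v] Cons.prems(2), rotated])
      (use Cons.prems(3) in auto)
qed

lemma singletons_partition_lattice: "lzero (partition_lattice n) \<in> carrier (partition_lattice n)"
  unfolding partition_lattice_def using partition_on_singletons by simp

lemma carrier_partition_lattice: "carrier (partition_lattice n) = {x. partition_on {1..n} x}"
  unfolding partition_lattice_def by simp

text \<open>A formula that vanishes in all partition lattices vanishes in every model, because its universal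
  closure is one of the axioms.  Variables outside \<open>vs\<close> must have the value that is fixed for
  evaluating sentences.\<close>

lemma transfer:
  assumes M: "models_T_FPL M" and f: "wff f" "free_vars f \<subseteq> set vs"
    and P: "\<And>n e. \<lbrakk>n \<ge> 2; range e \<subseteq> carrier (partition_lattice n)\<rbrakk> \<Longrightarrow> fml_val (partition_lattice n) f e = 0"
    and e: "range e \<subseteq> carrier M" "\<And>v. v \<notin> set vs \<Longrightarrow> e v = lzero M"
  shows "fml_val M f e = 0"
proof -
  have "fml_val (partition_lattice n) (sups us f) e = 0"
    if n: "n \<ge> 2" and e: "range e \<subseteq> carrier (partition_lattice n)" for n us e
    using e
  proof (induction us arbitrary: e)
    case Nil then show ?case using P[OF n] by simp
  next
    case (Cons u us)
    have "fml_val (partition_lattice n) (sups us f) (e(u := a)) = 0" if "a \<in> carrier (partition_lattice n)" for a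
      by (rule Cons.IH) (rule range_fun_upd_carrier[OF Cons.prems that])
    then have "fml_val (partition_lattice n) (sups (u # us) f) e = (SUP a \<in> carrier (partition_lattice n). (0 :: real))"
      by simp
    also have "\<dots> = 0" using singletons_partition_lattice[of n] by (intro cSUP_const) auto
    finally show ?case .
  qed
  then have "sups vs f \<in> T_FPL"
    unfolding T_FPL_def sentence_def sentence_val_def using f singletons_partition_lattice by auto
  then have "fml_val M (sups vs f) (\<lambda>_. lzero M) = 0"
    using M unfolding models_T_FPL_def sentence_val_def by blast
  moreover have fM: "fpl_structure M" using M unfolding models_T_FPL_def by simp
  moreover have "lzero M \<in> carrier M" using fM by (rule fpl_structure.lzero_closed)
  ultimately show ?thesis
    using fml_val_of_sups[OF fM f(1), of "\<lambda>_. lzero M" e vs] e by auto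
qed

section \<open>Modularity and selectors as formulas\<close>

text \<open>How far \<open>z\<close> is from being a common lower bound of \<open>x\<close> and \<open>a\<close> whose norm is as large as
  metric modularity of \<open>a\<close> requires.  The meet itself is not continuous, hence it is not the value
  of a formula.\<close>

definition meet_defect :: "'a fpl_str \<Rightarrow> 'a \<Rightarrow> 'a \<Rightarrow> 'a \<Rightarrow> real"
  where "meet_defect M x a z = ldist M (lplus M z x) x + ldist M (lplus M z a) a +
    clip (lnorm M x + lnorm M a - lnorm M (lplus M x a) - lnorm M z)"

definition modularity_defect :: "'a fpl_str \<Rightarrow> 'a \<Rightarrow> real"
  where "modularity_defect M a = (SUP x \<in> carrier M. INF z \<in> carrier M. clip (meet_defect M x a z))"

text \<open>For metrically modular \<open>a\<close> with \<open>x + a = 1\<close>, the meet of \<open>x\<close> and \<open>a\<close> is 0 if and only if the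
  norms add up to 1.\<close>

definition selector_defect :: "'a fpl_str \<Rightarrow> 'a \<Rightarrow> 'a \<Rightarrow> real"
  where "selector_defect M x a = clip (modularity_defect M a + ldist M (lplus M x a) (lone M) +
    clip (lnorm M x + lnorm M a - 1) + clip (1 - lnorm M x - lnorm M a))"

definition norm_fml :: "trm \<Rightarrow> fml"
  where "norm_fml t = Dist t Zero"

lemma norm_fml_simps [simp]:
  "fml_val M (norm_fml t) e = lnorm M (trm_val M t e)" "wff (norm_fml t)"
  "free_vars (norm_fml t) = trm_vars t"
  unfolding norm_fml_def lnorm_def by simp_all

text \<open>The bound variables 10 and 11 are kept apart from the variables below 10 that serve as
  parameters.\<close>

definition modularity_fml :: "nat \<Rightarrow> fml"
  where "modularity_fml v = FSup 10 (FInf 11 (FLin 0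
    [(1, Dist (Plus (Var 11) (Var 10)) (Var 10)), (1, Dist (Plus (Var 11) (Var v)) (Var v)),
     (1, FLin 0 [(1, norm_fml (Var 10)), (1, norm_fml (Var v)),
       (- 1, norm_fml (Plus (Var 10) (Var v))), (- 1, norm_fml (Var 11))])]))"

lemma modularity_fml_simps [simp]:
  "v < 10 \<Longrightarrow> fml_val M (modularity_fml v) e = modularity_defect M (e v)"
  "wff (modularity_fml v)" "v < 10 \<Longrightarrow> free_vars (modularity_fml v) = {v}"
  unfolding modularity_fml_def modularity_defect_def meet_defect_def
  by (auto simp: algebra_simps)

definition selector_fml :: "nat \<Rightarrow> nat \<Rightarrow> fml"
  where "selector_fml u v = FLin 0
    [(1, modularity_fml v), (1, Dist (Plus (Var u) (Var v)) One),
     (1, FLin (- 1) [(1, norm_fml (Var u)), (1, norm_fml (Var v))]),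
     (1, FLin 1 [(- 1, norm_fml (Var u)), (- 1, norm_fml (Var v))])]"

lemma selector_fml_simps [simp]:
  "v < 10 \<Longrightarrow> fml_val M (selector_fml u v) e = selector_defect M (e u) (e v)"
  "wff (selector_fml u v)" "v < 10 \<Longrightarrow> free_vars (selector_fml u v) = {u, v}"
  unfolding selector_fml_def selector_defect_def
  by (auto simp: algebra_simps)

section \<open>Defects in the partition lattices\<close>

lemma INF_eq_0:
  fixes f :: "'b \<Rightarrow> real"
  assumes "a \<in> A" "f a = 0" "\<And>b. b \<in> A \<Longrightarrow> 0 \<le> f b"
  shows "(INF b \<in> A. f b) = 0"
proof (rule antisym)
  have "bdd_below (f ` A)" using assms(3) by (intro bdd_belowI[of _ 0]) auto
  then show "(INF b \<in> A. f b) \<le> 0" using assms(1,2) by (intro cINF_lower2) auto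
  show "0 \<le> (INF b \<in> A. f b)" using assms(1,3) by (intro cINF_greatest) auto
qed

locale partition_lattice_ge_2 =
  fixes n :: nat
  assumes n: "n \<ge> 2"
begin

sublocale finite_ground_set "{1..n}"
  by unfold_locales simp

lemma ground_nonempty: "{1..n} \<noteq> {}"
  using n by simp

lemma join_partition_order:
  assumes x: "partition_on {1..n} x" and y: "partition_on {1..n} y"
  shows "x \<squnion>\<^bsub>partition_order n\<^esub> y = gen {1..n} (x \<union> y)"
proof -
  let ?V = "{1..n}" and ?L = "partition_order n"
  have P: "x \<union> y \<subseteq> Pow ?V" using partition_Pow x y by blast
  note g = partition_gen[OF P]
  have U: "Upper ?L {x, y} = {u. partition_on ?V u \<and> refines ?V x u \<and> refines ?V y u}"
    unfolding Upper_def partition_order_def using x y by auto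
  have "refines ?V x (gen ?V (x \<union> y))" "refines ?V y (gen ?V (x \<union> y))"
    using gen_mono[of x "x \<union> y"] gen_mono[of y "x \<union> y"] P gen_partition[OF x] gen_partition[OF y] by simp_all
  moreover have "refines ?V (gen ?V (x \<union> y)) u" if "partition_on ?V u" "refines ?V x u" "refines ?V y u" for u
  proof (rule gen_least[OF P that(1)])
    fix S assume "S \<in> x \<union> y"
    then show "unsplit u S"
      using refines_iff_unsplit[OF x that(1)] refines_iff_unsplit[OF y that(1)] that(2,3) by blast
  qed
  ultimately have l: "least ?L (gen ?V (x \<union> y)) (Upper ?L {x, y})"
    unfolding least_def U using g by (auto simp: partition_order_def)
  have unique: "u = gen ?V (x \<union> y)" if "least ?L u (Upper ?L {x, y})" for u
  proof -
    have "refines ?V u (gen ?V (x \<union> y))" "refines ?V (gen ?V (x \<union> y)) u"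
      using l that unfolding least_def by (auto simp: partition_order_def)
    then show ?thesis by (rule refines_asym)
  qed
  show ?thesis
    unfolding Lattice.join_def Lattice.sup_def by (intro some_equality l unique)
qed

lemma carrier_iff: "x \<in> carrier (partition_lattice n) \<longleftrightarrow> partition_on {1..n} x"
  unfolding carrier_partition_lattice by simp

lemma lplus_eq:
  "\<lbrakk>partition_on {1..n} x; partition_on {1..n} y\<rbrakk> \<Longrightarrow> lplus (partition_lattice n) x y = gen {1..n} (x \<union> y)"
  using join_partition_order unfolding partition_lattice_def by simp

lemma partition_join:
  "\<lbrakk>partition_on {1..n} x; partition_on {1..n} y\<rbrakk> \<Longrightarrow> partition_on {1..n} (gen {1..n} (x \<union> y))"
  using partition_Pow by (intro partition_gen) blast

lemma lzero_eq: "lzero (partition_lattice n) = gen {1..n} {}"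
  unfolding partition_lattice_def gen_empty by simp

lemma lone_eq: "lone (partition_lattice n) = {{1..n}}"
  unfolding partition_lattice_def by simp

lemma partition_lzero: "partition_on {1..n} (gen {1..n} {})"
  by (rule partition_gen) simp

lemma partition_lone: "partition_on {1..n} {{1..n}}"
  using ground_nonempty by (rule partition_on_space)

lemma ldist_eq:
  assumes "partition_on {1..n} x" "partition_on {1..n} y"
  shows "ldist (partition_lattice n) x y = real_of_int (pdist {1..n} x y) / (real n - 1)"
  using assms join_partition_order[OF assms] unfolding partition_lattice_def pdist_def by simp

lemma lnorm_eq:
  assumes x: "partition_on {1..n} x"
  shows "lnorm (partition_lattice n) x = (real n - real (card x)) / (real n - 1)"
proof -
  have "gen {1..n} (x \<union> gen {1..n} {}) = x"
    using gen_gen_Un[of "{}" x] partition_Pow[OF x] gen_partition[OF x] by (simp add: Un_commute)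
  moreover have "card (gen {1..n} {}) = n" unfolding gen_empty by (simp add: card_image)
  ultimately show ?thesis
    unfolding lnorm_def lzero_eq ldist_eq[OF x partition_lzero] pdist_def by simp
qed

lemma ldist_join_eq:
  assumes x: "partition_on {1..n} x" and z: "partition_on {1..n} z"
  shows "ldist (partition_lattice n) (lplus (partition_lattice n) z x) x =
    (real (card x) - real (card (gen {1..n} (z \<union> x)))) / (real n - 1)"
proof -
  have P: "z \<union> x \<subseteq> Pow {1..n}" "x \<subseteq> Pow {1..n}" using partition_Pow x z by blast+
  have "gen {1..n} (gen {1..n} (z \<union> x) \<union> x) = gen {1..n} (z \<union> x)"
    using gen_gen_Un[OF P] by (simp add: Un_assoc)
  then show ?thesis
    unfolding lplus_eq[OF z x] ldist_eq[OF partition_join[OF z x] x] pdist_def by simp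
qed

lemma card_partition_pos: "partition_on {1..n} x \<Longrightarrow> 1 \<le> card x"
proof -
  assume x: "partition_on {1..n} x"
  then have "x \<noteq> {}" using ground_nonempty unfolding partition_on_def by auto
  then show ?thesis using finite_partition[OF finV x] by (simp add: Suc_leI card_gt_0_iff)
qed

lemma ldist_lone_eq:
  assumes x: "partition_on {1..n} x"
  shows "ldist (partition_lattice n) x (lone (partition_lattice n)) = (real (card x) - 1) / (real n - 1)"
proof -
  have P: "x \<union> {{1..n}} \<subseteq> Pow {1..n}" using partition_Pow[OF x] by auto
  have "refines {1..n} {{1..n}} (gen {1..n} (x \<union> {{1..n}}))"
    using gen_mono[of "{{1..n}}" "x \<union> {{1..n}}"] P gen_partition[OF partition_lone] by simp
  then have "card (gen {1..n} (x \<union> {{1..n}})) \<le> card {{1..n}}" by (rule card_refines)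
  then have "card (gen {1..n} (x \<union> {{1..n}})) = 1"
    using card_partition_pos[OF partition_gen[OF P]] by simp
  then show ?thesis unfolding lone_eq ldist_eq[OF x partition_lone] pdist_def by simp
qed

lemma card_join_le:
  assumes x: "partition_on {1..n} x" and y: "partition_on {1..n} y"
  shows "card (gen {1..n} (x \<union> y)) \<le> card x" "card (gen {1..n} (x \<union> y)) \<le> card y"
proof -
  have P: "x \<union> y \<subseteq> Pow {1..n}" using partition_Pow x y by blast
  show "card (gen {1..n} (x \<union> y)) \<le> card x" "card (gen {1..n} (x \<union> y)) \<le> card y"
    using card_refines[OF gen_mono[of x "x \<union> y"]] card_refines[OF gen_mono[of y "x \<union> y"]]
      P gen_partition[OF x] gen_partition[OF y] by simp_all
qed

lemma card_partition_le:
  assumes "partition_on {1..n} x"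
  shows "card x \<le> n"
proof -
  have "refines {1..n} (gen {1..n} {}) x" by (rule gen_least) (use assms in auto)
  then have "card x \<le> card (gen {1..n} {})" by (rule card_refines)
  then show ?thesis unfolding gen_empty by (simp add: card_image)
qed

lemma ldist_le_1:
  assumes x: "partition_on {1..n} x" and y: "partition_on {1..n} y"
  shows "ldist (partition_lattice n) x y \<le> 1"
proof -
  have P: "x \<union> y \<subseteq> Pow {1..n}" using partition_Pow x y by blast
  have "card (gen {1..n} {}) = n" unfolding gen_empty by (simp add: card_image)
  moreover have "card (gen {1..n} x) + card (gen {1..n} ({} \<union> y)) \<le> card (gen {1..n} {}) + card (gen {1..n} (x \<union> y))"
    by (rule card_gen_semimodular) (use P in auto)
  ultimately have "pdist {1..n} x y \<le> int n - 1"
    unfolding pdist_def using gen_partition[OF x] gen_partition[OF y] card_partition_pos[OF partition_join[OF x y]]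
    by simp
  then show ?thesis unfolding ldist_eq[OF x y] using n by simp
qed

lemma ldist_triangle:
  assumes "partition_on {1..n} x" "partition_on {1..n} y" "partition_on {1..n} z"
  shows "ldist (partition_lattice n) x z \<le> ldist (partition_lattice n) x y + ldist (partition_lattice n) y z"
proof -
  have "real_of_int (pdist {1..n} x z) \<le> real_of_int (pdist {1..n} x y) + real_of_int (pdist {1..n} y z)"
    using pdist_triangle[OF assms] by linarith
  then show ?thesis
    using n assms by (simp add: ldist_eq add_divide_distrib[symmetric] divide_right_mono)
qed

lemma meet_defect_eq:
  assumes x: "partition_on {1..n} x" and a: "partition_on {1..n} a" and z: "partition_on {1..n} z"
  shows "meet_defect (partition_lattice n) x a z =
    ((real (card x) - real (card (gen {1..n} (z \<union> x)))) + (real (card a) - real (card (gen {1..n} (z \<union> a)))) +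
      max 0 (real (card (gen {1..n} (x \<union> a))) + real (card z) - real (card x) - real (card a))) / (real n - 1)"
proof -
  have n1: "real n - 1 > 0" using n by simp
  have "lnorm (partition_lattice n) x + lnorm (partition_lattice n) a
      - lnorm (partition_lattice n) (lplus (partition_lattice n) x a) - lnorm (partition_lattice n) z
    = (real (card (gen {1..n} (x \<union> a))) + real (card z) - real (card x) - real (card a)) / (real n - 1)" (is "?l = ?t / _")
    unfolding lplus_eq[OF x a] lnorm_eq[OF x] lnorm_eq[OF a] lnorm_eq[OF z] lnorm_eq[OF partition_join[OF x a]]
    by (simp only: add_divide_distrib[symmetric] diff_divide_distrib[symmetric]) simp
  moreover have "?t \<le> real n - 1"
    using card_join_le[OF x a] card_partition_le[OF z] card_partition_pos[OF a] by linarith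
  then have "clip (?t / (real n - 1)) = max 0 ?t / (real n - 1)"
    using n1 unfolding clip_def by (auto simp: max_def min_def field_simps)
  ultimately show ?thesis
    unfolding meet_defect_def ldist_join_eq[OF x z] ldist_join_eq[OF a z]
    by (simp add: add_divide_distrib)
qed

lemma modularity_defect_blk:
  assumes S: "S \<subseteq> {1..n}" "S \<noteq> {}"
  shows "modularity_defect (partition_lattice n) (blk {1..n} S) = 0"
proof -
  note b = partition_blk[OF S(1)]
  have "(INF z \<in> carrier (partition_lattice n). clip (meet_defect (partition_lattice n) x (blk {1..n} S) z)) = 0"
    if x: "partition_on {1..n} x" for x
  proof -
    obtain z where z: "partition_on {1..n} z" and r: "refines {1..n} z x" "refines {1..n} z (blk {1..n} S)"
      and c: "card z + card (gen {1..n} (x \<union> blk {1..n} S)) = card x + card (blk {1..n} S)"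
      using block_meet[OF x S] by blast
    have absorb: "gen {1..n} (z \<union> w) = w" if "refines {1..n} z w" "partition_on {1..n} w" for w
    proof (rule gen_eqI)
      show "is_gen {1..n} (z \<union> w) w"
        unfolding is_gen_def
        using that refines_iff_unsplit[OF z that(2)] refines_iff_unsplit[OF that(2)] refines_refl[OF that(2)] by blast
    qed
    have "real (card z) + real (card (gen {1..n} (x \<union> blk {1..n} S))) = real (card x) + real (card (blk {1..n} S))"
      using c by linarith
    then have "meet_defect (partition_lattice n) x (blk {1..n} S) z = 0"
      unfolding meet_defect_eq[OF x b z] absorb[OF r(1) x] absorb[OF r(2) b] by simp
    then have "clip (meet_defect (partition_lattice n) x (blk {1..n} S) z) = 0" unfolding clip_def by simp
    then show ?thesis using z clip_bounds by (intro INF_eq_0[of z]) (auto simp: carrier_iff)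
  qed
  then have "modularity_defect (partition_lattice n) (blk {1..n} S) = (SUP x \<in> carrier (partition_lattice n). (0 :: real))"
    unfolding modularity_defect_def by (intro SUP_cong) (auto simp: carrier_iff)
  also have "\<dots> = 0" using singletons_partition_lattice[of n] by (intro cSUP_const) auto
  finally show ?thesis .
qed

lemma finite_carrier: "finite (carrier (partition_lattice n))"
  unfolding carrier_partition_lattice by (rule finitely_many_partition_on) simp

text \<open>The lattice is finite, so the infimum is attained.\<close>

lemma modularity_defect_witness:
  assumes a: "partition_on {1..n} a" and x: "partition_on {1..n} x"
    and less: "modularity_defect (partition_lattice n) a < 1"
  shows "\<exists>z. partition_on {1..n} z \<and>
    meet_defect (partition_lattice n) x a z \<le> modularity_defect (partition_lattice n) a"
proof -
  let ?f = "\<lambda>x z. clip (meet_defect (partition_lattice n) x a z)"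
  let ?C = "carrier (partition_lattice n)"
  have ne: "?C \<noteq> {}" using singletons_partition_lattice[of n] by blast
  have "Inf (?f x ` ?C) \<in> ?f x ` ?C"
    using ne finite_carrier by (intro closed_contains_Inf finite_imp_closed) (auto intro!: bdd_below_finite)
  then obtain z where z: "z \<in> ?C" "?f x z = (INF z \<in> ?C. ?f x z)" by auto
  have "(INF z \<in> ?C. ?f x z) \<le> modularity_defect (partition_lattice n) a"
    unfolding modularity_defect_def
    by (rule cSUP_upper) (use x finite_carrier in \<open>auto simp: carrier_iff\<close>)
  then have "?f x z \<le> modularity_defect (partition_lattice n) a" using z by simp
  then have "meet_defect (partition_lattice n) x a z \<le> modularity_defect (partition_lattice n) a"
    using le_of_clip_less[of "meet_defect (partition_lattice n) x a z"] less by linarith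
  then show ?thesis using z by (auto simp: carrier_iff)
qed

lemma modularity_defect_nonneg:
  "0 \<le> modularity_defect (partition_lattice n) a"
proof -
  let ?C = "carrier (partition_lattice n)"
  have z: "lzero (partition_lattice n) \<in> ?C" by (rule singletons_partition_lattice)
  have "0 \<le> (INF z \<in> ?C. clip (meet_defect (partition_lattice n) (lzero (partition_lattice n)) a z))"
    using z clip_bounds by (intro cINF_greatest) auto
  also have "\<dots> \<le> modularity_defect (partition_lattice n) a"
    unfolding modularity_defect_def by (rule cSUP_upper[OF z]) (use finite_carrier in auto)
  finally show ?thesis .
qed

lemma selector_defect_transversal:
  assumes x: "partition_on {1..n} x" and A: "transversal x A"
  shows "selector_defect (partition_lattice n) x (blk {1..n} A) = 0"
proof -
  have AV: "A \<subseteq> {1..n}" "A \<noteq> {}"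
    using transversal_subset[OF x A] transversal_nonempty[OF ground_nonempty x A] .
  note b = partition_blk[OF AV(1)]
  have c: "card A = card x" by (rule card_transversal[OF x A])
  have "card (gen {1..n} (x \<union> blk {1..n} A)) = 1"
    unfolding gen_Un_blk[OF x AV(1)] using card_gen_insert[OF x AV] touched_transversal[OF A] by simp
  then have 1: "ldist (partition_lattice n) (lplus (partition_lattice n) x (blk {1..n} A)) (lone (partition_lattice n)) = 0"
    unfolding lplus_eq[OF x b] ldist_lone_eq[OF partition_join[OF x b]] by simp
  have "real (card (blk {1..n} A)) + real (card x) = real n + 1"
    using card_blk[OF AV] c by simp
  then have "lnorm (partition_lattice n) x + lnorm (partition_lattice n) (blk {1..n} A) = 1"
    unfolding lnorm_eq[OF x] lnorm_eq[OF b] using n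
    by (simp add: add_divide_distrib[symmetric] del: One_nat_def)
  then show ?thesis
    unfolding selector_defect_def modularity_defect_blk[OF AV] 1 by (simp add: clip_def)
qed

text \<open>The linear estimate that makes the set of selectors definable uniformly in \<open>n\<close>.  A defect \<open>c\<close>
  costs at most \<open>8 c\<close> to reach a one-block partition and \<open>27 c\<close> to turn its block into a transversal.\<close>

lemma transversal_near_selector_defect:
  assumes x: "partition_on {1..n} x" and a: "partition_on {1..n} a"
  shows "\<exists>A. transversal x A \<and>
    ldist (partition_lattice n) a (blk {1..n} A) \<le> 35 * selector_defect (partition_lattice n) x a"
proof (cases "selector_defect (partition_lattice n) x a < 1")
  case False
  obtain A where A: "transversal x A" using transversal_near[OF x, of "{}"] by metis
  have "partition_on {1..n} (blk {1..n} A)" by (rule partition_blk[OF transversal_subset[OF x A]])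
  then have "ldist (partition_lattice n) a (blk {1..n} A) \<le> 1" by (rule ldist_le_1[OF a])
  then have "ldist (partition_lattice n) a (blk {1..n} A) \<le> 35 * selector_defect (partition_lattice n) x a"
    using False by linarith
  then show ?thesis using A by blast
next
  case True
  define \<gamma> where "\<gamma> = selector_defect (partition_lattice n) x a"
  define N where "N = real n - 1"
  have N: "N > 0" using n unfolding N_def by simp
  let ?P = "partition_lattice n" and ?V = "{1..n}"
  note j = partition_join[OF x a]
  have sum: "modularity_defect ?P a + ldist ?P (lplus ?P x a) (lone ?P) +
      clip (lnorm ?P x + lnorm ?P a - 1) + clip (1 - lnorm ?P x - lnorm ?P a) \<le> \<gamma>"
    using le_of_clip_less True unfolding \<gamma>_def selector_defect_def by blast
  have d1: "ldist ?P (lplus ?P x a) (lone ?P) = (real (card (gen ?V (x \<union> a))) - 1) / N"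
    unfolding lplus_eq[OF x a] ldist_lone_eq[OF j] N_def ..
  have d1': "0 \<le> (real (card (gen ?V (x \<union> a))) - 1) / N" using N card_partition_pos[OF j] by simp
  have m: "modularity_defect ?P a \<le> \<gamma>" and one: "(real (card (gen ?V (x \<union> a))) - 1) / N \<le> \<gamma>"
    and up: "clip (1 - lnorm ?P x - lnorm ?P a) \<le> \<gamma>" "clip (lnorm ?P x + lnorm ?P a - 1) \<le> \<gamma>"
    using sum d1 d1' modularity_defect_nonneg[of a] clip_bounds(1)[of "lnorm ?P x + lnorm ?P a - 1"]
      clip_bounds(1)[of "1 - lnorm ?P x - lnorm ?P a"] by linarith+
  have m1: "modularity_defect ?P a < 1" using m True unfolding \<gamma>_def by linarith
  have g0: "0 \<le> \<gamma>" "\<gamma> < 1" using True clip_bounds unfolding \<gamma>_def selector_defect_def by auto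
  have "lnorm ?P x + lnorm ?P a - 1 \<le> \<gamma>"
    using le_of_clip_less up(2) g0 by (meson le_less_trans order_trans)
  then have "(real n - real (card x) + (real n - real (card a))) / N \<le> \<gamma> + 1"
    unfolding lnorm_eq[OF x] lnorm_eq[OF a] N_def[symmetric] add_divide_distrib by linarith
  then have rank: "real n - real (card x) + (real n - real (card a)) - N \<le> \<gamma> * N"
    using N by (simp add: pos_divide_le_eq distrib_right)
  have "\<exists>S \<subseteq> ?V. S \<noteq> {} \<and> real_of_int (pdist ?V a (blk ?V S)) \<le> 8 * (\<gamma> * N)"
  proof (rule near_one_block[OF ground_nonempty a])
    fix u assume u: "partition_on ?V u"
    obtain z where z: "partition_on ?V z" "meet_defect ?P u a z \<le> modularity_defect ?P a"
      using modularity_defect_witness[OF a u m1] by blast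
    have "meet_defect ?P u a z \<le> \<gamma>" using z(2) m by linarith
    then show "\<exists>z. partition_on ?V z \<and>
      (real (card u) - real (card (gen ?V (z \<union> u)))) + (real (card a) - real (card (gen ?V (z \<union> a)))) +
      max 0 (real (card (gen ?V (u \<union> a))) + real (card z) - real (card u) - real (card a)) \<le> \<gamma> * N"
      using z(1) N unfolding meet_defect_eq[OF u a z(1)] N_def[symmetric]
      by (intro exI[of _ z]) (simp add: pos_divide_le_eq)
  qed
  then obtain S where S: "S \<subseteq> ?V" "S \<noteq> {}" and dS: "real_of_int (pdist ?V a (blk ?V S)) \<le> 8 * (\<gamma> * N)" by blast
  note b = partition_blk[OF S(1)]
  obtain A where A: "transversal x A" and dA: "pdist ?V (blk ?V S) (blk ?V A) \<le>
    int (card S) - int (card x) + 2 * (int (card (gen ?V (x \<union> blk ?V S))) - 1)"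
    using transversal_close[OF ground_nonempty x S] by blast
  note bA = partition_blk[OF transversal_subset[OF x A]]
  \<comment> \<open>Replacing \<open>a\<close> by the one-block partition moves its rank, and the rank of its join
    with \<open>x\<close>, by at most their distance.\<close>
  have 1: "int (card a) - int (card (blk ?V S)) \<le> pdist ?V a (blk ?V S)"
    using card_join_le[OF a b] unfolding pdist_def by linarith
  have 2: "int (card (gen ?V (x \<union> blk ?V S))) - int (card (gen ?V (x \<union> a))) \<le> pdist ?V a (blk ?V S)"
  proof -
    have P: "x \<subseteq> Pow ?V" "a \<subseteq> Pow ?V" "blk ?V S \<subseteq> Pow ?V" using partition_Pow x a b by auto
    have "card (gen ?V (blk ?V S \<union> x)) + card (gen ?V (blk ?V S \<union> a))
        \<le> card (gen ?V (blk ?V S)) + card (gen ?V (blk ?V S \<union> x \<union> a))"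
      by (rule card_gen_semimodular) (use P in auto)
    moreover have "card (gen ?V (blk ?V S \<union> x \<union> a)) \<le> card (gen ?V (x \<union> a))"
      by (rule card_refines[OF gen_mono]) (use P in auto)
    moreover have "gen ?V (blk ?V S) = blk ?V S" by (rule gen_partition[OF b])
    moreover have "card (gen ?V (blk ?V S \<union> a)) \<le> card a" using card_join_le[OF b a] by simp
    ultimately show ?thesis unfolding pdist_def by (simp add: Un_commute)
  qed
  have "real_of_int (pdist ?V (blk ?V S) (blk ?V A)) \<le>
      real (card S) - real (card x) + 2 * (real (card (gen ?V (x \<union> blk ?V S))) - 1)"
    using of_int_le_iff[where ?'a = real, THEN iffD2, OF dA] by simp
  also have "\<dots> \<le> 27 * (\<gamma> * N)"
  proof -
    have "real (card (gen ?V (x \<union> a))) - 1 \<le> \<gamma> * N" using one N by (simp add: pos_divide_le_eq)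
    moreover have "real (card (gen ?V (x \<union> blk ?V S))) - real (card (gen ?V (x \<union> a)))
        \<le> real_of_int (pdist ?V a (blk ?V S))"
      using of_int_le_iff[where ?'a = real, THEN iffD2, OF 2] by simp
    ultimately have "real (card (gen ?V (x \<union> blk ?V S))) - 1 \<le> 9 * (\<gamma> * N)" using dS by linarith
    moreover have "real (card S) = real n + 1 - real (card (blk ?V S))" using card_blk[OF S] by simp
    moreover have "real (card a) - real (card (blk ?V S)) \<le> 8 * (\<gamma> * N)"
      using of_int_le_iff[where ?'a = real, THEN iffD2, OF 1] dS by simp
    ultimately show ?thesis using rank N_def by argo
  qed
  finally have "real_of_int (pdist ?V a (blk ?V A)) \<le> 35 * (\<gamma> * N)"
    using pdist_triangle[OF a b bA] dS by linarith
  then have "ldist ?P a (blk ?V A) \<le> 35 * \<gamma>"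
    unfolding ldist_eq[OF a bA] N_def[symmetric] using N by (simp add: pos_divide_le_eq)
  then show ?thesis using A unfolding \<gamma>_def by blast
qed

lemma selector_move:
  assumes x: "partition_on {1..n} x" and y: "partition_on {1..n} y" and a: "partition_on {1..n} a"
  shows "\<exists>b. partition_on {1..n} b \<and> selector_defect (partition_lattice n) y b = 0 \<and>
    ldist (partition_lattice n) a b
      \<le> ldist (partition_lattice n) x y + 35 * selector_defect (partition_lattice n) x a"
proof -
  let ?P = "partition_lattice n" and ?V = "{1..n}"
  obtain A where A: "transversal x A" "ldist ?P a (blk ?V A) \<le> 35 * selector_defect ?P x a"
    using transversal_near_selector_defect[OF x a] by metis
  obtain B where B: "transversal y B" "pdist ?V (blk ?V A) (blk ?V B) \<le> pdist ?V x y"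
    using transversal_move[OF ground_nonempty x y A(1)] by metis
  note bA = partition_blk[OF transversal_subset[OF x A(1)]]
  note bB = partition_blk[OF transversal_subset[OF y B(1)]]
  have "ldist ?P (blk ?V A) (blk ?V B) \<le> ldist ?P x y"
    unfolding ldist_eq[OF bA bB] ldist_eq[OF x y] using B(2) n by (simp add: divide_right_mono)
  then have "ldist ?P a (blk ?V B) \<le> ldist ?P x y + 35 * selector_defect ?P x a"
    using ldist_triangle[OF a bA bB] A(2) by linarith
  then show ?thesis using bB selector_defect_transversal[OF y B(1)] by blast
qed

text \<open>The lower bound survives for arbitrary \<open>b\<close> once the distance of \<open>b\<close> from the selectors, as
  estimated by its defect, is added.\<close>

lemma far_selector:
  assumes y: "partition_on {1..n} y" and a: "partition_on {1..n} a"
    and far: "\<And>B. transversal y B \<Longrightarrow> v \<le> pdist {1..n} a (blk {1..n} B)"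
    and b: "partition_on {1..n} b"
  shows "real_of_int v / (real n - 1)
    \<le> clip (ldist (partition_lattice n) a b + 35 * selector_defect (partition_lattice n) y b)"
proof -
  let ?P = "partition_lattice n" and ?V = "{1..n}"
  obtain B where B: "transversal y B" "ldist ?P b (blk ?V B) \<le> 35 * selector_defect ?P y b"
    using transversal_near_selector_defect[OF y b] by metis
  note bB = partition_blk[OF transversal_subset[OF y B(1)]]
  have "real_of_int v / (real n - 1) \<le> ldist ?P a (blk ?V B)"
    unfolding ldist_eq[OF a bB] using far[OF B(1)] n by (simp add: divide_right_mono)
  moreover have "ldist ?P a (blk ?V B) \<le> 1" by (rule ldist_le_1[OF a bB])
  moreover have "ldist ?P a (blk ?V B) \<le> ldist ?P a b + ldist ?P b (blk ?V B)"
    by (rule ldist_triangle[OF a b bB])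
  ultimately show ?thesis using B(2) unfolding clip_def by auto
qed

lemma far_selectors:
  assumes x: "partition_on {1..n} x" and y: "partition_on {1..n} y"
  shows "\<exists>a b v v'. partition_on {1..n} a \<and> partition_on {1..n} b \<and>
    selector_defect (partition_lattice n) x a = 0 \<and> selector_defect (partition_lattice n) y b = 0 \<and>
    lnorm (partition_lattice n) (lplus (partition_lattice n) x y) - lnorm (partition_lattice n) x \<le> v + v' \<and>
    (\<forall>b'. partition_on {1..n} b' \<longrightarrow>
      v \<le> clip (ldist (partition_lattice n) a b' + 35 * selector_defect (partition_lattice n) y b')) \<and>
    (\<forall>a'. partition_on {1..n} a' \<longrightarrow>
      v' \<le> clip (ldist (partition_lattice n) b a' + 35 * selector_defect (partition_lattice n) x a'))"
proof -
  let ?P = "partition_lattice n" and ?V = "{1..n}" and ?N = "real n - 1"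
  obtain A B v v' where A: "transversal x A" and B: "transversal y B"
    and c: "int (card x) - int (card (gen ?V (x \<union> y))) \<le> v + v'"
    and vA: "\<And>A'. transversal y A' \<Longrightarrow> v \<le> pdist ?V (blk ?V A) (blk ?V A')"
    and vB: "\<And>B'. transversal x B' \<Longrightarrow> v' \<le> pdist ?V (blk ?V B) (blk ?V B')"
    using far_transversals[OF ground_nonempty x y] by metis
  note bA = partition_blk[OF transversal_subset[OF x A]]
  note bB = partition_blk[OF transversal_subset[OF y B]]
  have "real (card x) - real (card (gen ?V (x \<union> y))) \<le> real_of_int v + real_of_int v'"
    using of_int_le_iff[where ?'a = real, THEN iffD2, OF c] by simp
  then have "(real (card x) - real (card (gen ?V (x \<union> y)))) / ?N \<le> (real_of_int v + real_of_int v') / ?N"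
    using n by (intro divide_right_mono) auto
  moreover have "lnorm ?P (lplus ?P x y) - lnorm ?P x = (real (card x) - real (card (gen ?V (x \<union> y)))) / ?N"
    unfolding lplus_eq[OF x y] lnorm_eq[OF x] lnorm_eq[OF partition_join[OF x y]]
    by (simp add: diff_divide_distrib)
  ultimately have "lnorm ?P (lplus ?P x y) - lnorm ?P x \<le> real_of_int v / ?N + real_of_int v' / ?N"
    by (simp add: add_divide_distrib)
  moreover have "\<forall>b'. partition_on ?V b' \<longrightarrow>
      real_of_int v / ?N \<le> clip (ldist ?P (blk ?V A) b' + 35 * selector_defect ?P y b')"
    using far_selector[OF y bA vA] by simp
  moreover have "\<forall>a'. partition_on ?V a' \<longrightarrow>
      real_of_int v' / ?N \<le> clip (ldist ?P (blk ?V B) a' + 35 * selector_defect ?P x a')"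
    using far_selector[OF x bB vB] by simp
  ultimately show ?thesis
    using bA bB selector_defect_transversal[OF x A] selector_defect_transversal[OF y B] by blast
qed

end

section \<open>Lattice structure of models\<close>

lemma clip_add_le: "\<lbrakk>s \<le> t + r; 0 \<le> r\<rbrakk> \<Longrightarrow> clip s \<le> clip t + r"
  unfolding clip_def by auto

lemma INF_less_witness:
  fixes f :: "'b \<Rightarrow> real"
  assumes "(INF b \<in> A. f b) < c" "A \<noteq> {}"
  shows "\<exists>b \<in> A. f b < c"
  using assms cINF_greatest[of A c f] by (meson not_le)

locale FPL_model = fpl_structure M for M :: "'a fpl_str" +
  assumes models: "models_T_FPL M"
begin

text \<open>Three parameters suffice for all transferred facts.\<close>

lemma transfer3:
  assumes "wff f" "free_vars f \<subseteq> {0, 1, 2}"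
    and P: "\<And>n e. \<lbrakk>partition_lattice_ge_2 n; partition_on {1..n} (e 0); partition_on {1..n} (e 1);
      partition_on {1..n} (e 2)\<rbrakk> \<Longrightarrow> fml_val (partition_lattice n) f e = 0"
    and xyz: "x \<in> carrier M" "y \<in> carrier M" "z \<in> carrier M"
  shows "fml_val M f ((\<lambda>_. lzero M)(0 := x, 1 := y, 2 := z)) = 0"
proof (rule transfer[OF models, of f "[0, 1, 2]"])
  fix n :: nat and e :: "nat \<Rightarrow> nat set set"
  assume "n \<ge> 2" and e: "range e \<subseteq> carrier (partition_lattice n)"
  have "partition_on {1..n} (e v)" for v
    using e unfolding carrier_partition_lattice by auto
  then show "fml_val (partition_lattice n) f e = 0"
    using P \<open>n \<ge> 2\<close> unfolding partition_lattice_ge_2_def by blast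
qed (use assms lzero_closed in auto)

abbreviation mplus :: "'a \<Rightarrow> 'a \<Rightarrow> 'a" (infixl "\<oplus>" 65)
  where "x \<oplus> y \<equiv> lplus M x y"

abbreviation mdist :: "'a \<Rightarrow> 'a \<Rightarrow> real"
  where "mdist x y \<equiv> ldist M x y"

abbreviation mnorm :: "'a \<Rightarrow> real"
  where "mnorm x \<equiv> lnorm M x"

lemmas closed [simp] = lplus_closed lzero_closed lone_closed

lemma carrier_nonempty [simp]: "carrier M \<noteq> {}"
  using lzero_closed by blast

lemma eq_of_mdist_0:
  assumes "mdist x y = 0" "x \<in> carrier M" "y \<in> carrier M"
  shows "x = y"
  using assms zero by blast

lemma mplus_commute:
  assumes "x \<in> carrier M" "y \<in> carrier M"
  shows "x \<oplus> y = y \<oplus> x"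
proof (rule eq_of_mdist_0)
  have "fml_val M (Dist (Plus (Var 0) (Var 1)) (Plus (Var 1) (Var 0))) ((\<lambda>_. lzero M)(0 := x, 1 := y, 2 := x)) = 0"
  proof (rule transfer3)
    fix n and e :: "nat \<Rightarrow> nat set set"
    assume "partition_lattice_ge_2 n" and e: "partition_on {1..n} (e 0)" "partition_on {1..n} (e 1)"
    interpret partition_lattice_ge_2 n by fact
    show "fml_val (partition_lattice n) (Dist (Plus (Var 0) (Var 1)) (Plus (Var 1) (Var 0))) e = 0"
      using e partition_join[of "e 1" "e 0"]
      by (simp add: lplus_eq ldist_eq Un_commute pdist_def gen_partition del: One_nat_def)
  qed (use assms in auto)
  then show "mdist (x \<oplus> y) (y \<oplus> x) = 0" by simp
qed (use assms in auto)

lemma mplus_assoc: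
  assumes "x \<in> carrier M" "y \<in> carrier M" "z \<in> carrier M"
  shows "x \<oplus> y \<oplus> z = x \<oplus> (y \<oplus> z)"
proof (rule eq_of_mdist_0)
  have "fml_val M (Dist (Plus (Plus (Var 0) (Var 1)) (Var 2)) (Plus (Var 0) (Plus (Var 1) (Var 2))))
    ((\<lambda>_. lzero M)(0 := x, 1 := y, 2 := z)) = 0"
  proof (rule transfer3)
    fix n and e :: "nat \<Rightarrow> nat set set"
    assume "partition_lattice_ge_2 n" and e: "partition_on {1..n} (e 0)"
      "partition_on {1..n} (e 1)" "partition_on {1..n} (e 2)"
    interpret partition_lattice_ge_2 n by fact
    have P: "e 0 \<subseteq> Pow {1..n}" "e 1 \<subseteq> Pow {1..n}" "e 2 \<subseteq> Pow {1..n}" using e partition_Pow by blast+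
    have "gen {1..n} (gen {1..n} (e 0 \<union> e 1) \<union> e 2) = gen {1..n} (e 0 \<union> e 1 \<union> e 2)"
      by (rule gen_gen_Un) (use P in auto)
    moreover have "gen {1..n} (gen {1..n} (e 1 \<union> e 2) \<union> e 0) = gen {1..n} (e 1 \<union> e 2 \<union> e 0)"
      by (rule gen_gen_Un) (use P in auto)
    ultimately have "gen {1..n} (gen {1..n} (e 0 \<union> e 1) \<union> e 2) = gen {1..n} (e 0 \<union> gen {1..n} (e 1 \<union> e 2))"
      by (simp add: Un_ac)
    then show "fml_val (partition_lattice n)
        (Dist (Plus (Plus (Var 0) (Var 1)) (Var 2)) (Plus (Var 0) (Plus (Var 1) (Var 2)))) e = 0"
      using e partition_join[OF e(1) partition_join[OF e(2,3)]] partition_join[OF e(1,2)] partition_join[OF e(2,3)]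
      by (simp add: lplus_eq ldist_eq pdist_def gen_partition del: One_nat_def)
  qed (use assms in auto)
  then show "mdist (x \<oplus> y \<oplus> z) (x \<oplus> (y \<oplus> z)) = 0" by simp
qed (use assms in auto)

lemma mplus_idem:
  assumes "x \<in> carrier M"
  shows "x \<oplus> x = x"
proof (rule eq_of_mdist_0)
  have "fml_val M (Dist (Plus (Var 0) (Var 0)) (Var 0)) ((\<lambda>_. lzero M)(0 := x, 1 := x, 2 := x)) = 0"
  proof (rule transfer3)
    fix n and e :: "nat \<Rightarrow> nat set set"
    assume "partition_lattice_ge_2 n" and e: "partition_on {1..n} (e 0)"
    interpret partition_lattice_ge_2 n by fact
    show "fml_val (partition_lattice n) (Dist (Plus (Var 0) (Var 0)) (Var 0)) e = 0"
      using e by (simp add: lplus_eq ldist_eq pdist_def gen_partition del: One_nat_def)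
  qed (use assms in auto)
  then show "mdist (x \<oplus> x) x = 0" by simp
qed (use assms in auto)

lemma mplus_lzero:
  assumes "x \<in> carrier M"
  shows "lzero M \<oplus> x = x"
proof (rule eq_of_mdist_0)
  have "fml_val M (Dist (Plus Zero (Var 0)) (Var 0)) ((\<lambda>_. lzero M)(0 := x, 1 := x, 2 := x)) = 0"
  proof (rule transfer3)
    fix n and e :: "nat \<Rightarrow> nat set set"
    assume "partition_lattice_ge_2 n" and e: "partition_on {1..n} (e 0)"
    interpret partition_lattice_ge_2 n by fact
    have "gen {1..n} (gen {1..n} {} \<union> e 0) = e 0"
      using gen_gen_Un[of "{}" "e 0"] partition_Pow[OF e] gen_partition[OF e] by simp
    then show "fml_val (partition_lattice n) (Dist (Plus Zero (Var 0)) (Var 0)) e = 0"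
      using e partition_lzero by (simp add: lzero_eq lplus_eq ldist_eq pdist_def gen_partition del: One_nat_def)
  qed (use assms in auto)
  then show "mdist (lzero M \<oplus> x) x = 0" by simp
qed (use assms in auto)

lemma mdist_eq_mnorm:
  assumes "x \<in> carrier M" "y \<in> carrier M"
  shows "mdist x y = 2 * mnorm (x \<oplus> y) - mnorm x - mnorm y"
proof -
  define f where "f s = FLin 0 [(s, Dist (Var 0) (Var 1)), (- 2 * s, norm_fml (Plus (Var 0) (Var 1))),
    (s, norm_fml (Var 0)), (s, norm_fml (Var 1))]" for s
  have "fml_val M (f s) ((\<lambda>_. lzero M)(0 := x, 1 := y, 2 := x)) = 0" for s
  proof (rule transfer3)
    fix n and e :: "nat \<Rightarrow> nat set set"
    assume "partition_lattice_ge_2 n" and e: "partition_on {1..n} (e 0)" "partition_on {1..n} (e 1)"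
    interpret partition_lattice_ge_2 n by fact
    have "ldist (partition_lattice n) (e 0) (e 1) = 2 * lnorm (partition_lattice n) (lplus (partition_lattice n) (e 0) (e 1))
        - lnorm (partition_lattice n) (e 0) - lnorm (partition_lattice n) (e 1)"
      unfolding ldist_eq[OF e] lplus_eq[OF e] lnorm_eq[OF e(1)] lnorm_eq[OF e(2)] lnorm_eq[OF partition_join[OF e]] pdist_def
      by (simp only: times_divide_eq_right diff_divide_distrib[symmetric]) simp
    moreover have "fml_val (partition_lattice n) (f s) e = clip (s * (ldist (partition_lattice n) (e 0) (e 1) -
        (2 * lnorm (partition_lattice n) (lplus (partition_lattice n) (e 0) (e 1))
          - lnorm (partition_lattice n) (e 0) - lnorm (partition_lattice n) (e 1))))"
      unfolding f_def by (simp add: algebra_simps)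
    ultimately show "fml_val (partition_lattice n) (f s) e = 0"
      by (simp add: clip_def)
  qed (use assms in \<open>auto simp: f_def\<close>)
  from this[of 1] this[of "- 1"] show ?thesis
    unfolding f_def by (simp add: clip_eq_0_iff)
qed

lemma mnorm_lone: "mnorm (lone M) = 1"
proof -
  have "fml_val M (FLin 1 [(- 1, norm_fml One)]) ((\<lambda>_. lzero M)(0 := lzero M, 1 := lzero M, 2 := lzero M)) = 0"
  proof (rule transfer3)
    fix n and e :: "nat \<Rightarrow> nat set set"
    assume "partition_lattice_ge_2 n"
    interpret partition_lattice_ge_2 n by fact
    have "lnorm (partition_lattice n) (lone (partition_lattice n)) = 1"
      unfolding lone_eq lnorm_eq[OF partition_lone] using n by simp
    then show "fml_val (partition_lattice n) (FLin 1 [(- 1, norm_fml One)]) e = 0"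
      by (simp add: clip_def)
  qed auto
  then have "1 \<le> mnorm (lone M)" by (simp add: clip_eq_0_iff)
  moreover have "mnorm (lone M) \<le> 1" unfolding lnorm_def by (rule diameter) auto
  ultimately show ?thesis by simp
qed

lemma mnorm_semimodular:
  assumes "x \<in> carrier M" "y \<in> carrier M" "z \<in> carrier M"
  shows "mnorm (x \<oplus> y \<oplus> z) + mnorm z \<le> mnorm (x \<oplus> z) + mnorm (y \<oplus> z)"
proof -
  define f where "f = FLin 0 [(1, norm_fml (Plus (Plus (Var 0) (Var 1)) (Var 2))), (1, norm_fml (Var 2)),
    (- 1, norm_fml (Plus (Var 0) (Var 2))), (- 1, norm_fml (Plus (Var 1) (Var 2)))]"
  have "fml_val M f ((\<lambda>_. lzero M)(0 := x, 1 := y, 2 := z)) = 0"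
  proof (rule transfer3)
    fix n and e :: "nat \<Rightarrow> nat set set"
    assume "partition_lattice_ge_2 n" and e: "partition_on {1..n} (e 0)"
      "partition_on {1..n} (e 1)" "partition_on {1..n} (e 2)"
    interpret partition_lattice_ge_2 n by fact
    let ?P = "partition_lattice n" and ?V = "{1..n}"
    have P: "e 0 \<subseteq> Pow ?V" "e 1 \<subseteq> Pow ?V" "e 2 \<subseteq> Pow ?V" using e partition_Pow by blast+
    have "gen ?V (gen ?V (e 0 \<union> e 1) \<union> e 2) = gen ?V (e 0 \<union> e 1 \<union> e 2)"
      by (rule gen_gen_Un) (use P in auto)
    moreover have "card (gen ?V (e 0 \<union> e 2)) + card (gen ?V (e 2 \<union> e 1)) \<le> card (gen ?V (e 2)) + card (gen ?V (e 0 \<union> e 2 \<union> e 1))"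
      by (rule card_gen_semimodular) (use P in auto)
    ultimately have "card (gen ?V (e 0 \<union> e 2)) + card (gen ?V (e 1 \<union> e 2))
        \<le> card (e 2) + card (gen ?V (gen ?V (e 0 \<union> e 1) \<union> e 2))"
      using gen_partition[OF e(3)] by (simp add: Un_ac)
    then have "real (card (gen ?V (e 0 \<union> e 2))) + real (card (gen ?V (e 1 \<union> e 2)))
        \<le> real (card (e 2)) + real (card (gen ?V (gen ?V (e 0 \<union> e 1) \<union> e 2)))" by linarith
    then have "lnorm ?P (lplus ?P (lplus ?P (e 0) (e 1)) (e 2)) + lnorm ?P (e 2)
        \<le> lnorm ?P (lplus ?P (e 0) (e 2)) + lnorm ?P (lplus ?P (e 1) (e 2))"
      unfolding lplus_eq[OF e(1,2)] lplus_eq[OF partition_join[OF e(1,2)] e(3)] lplus_eq[OF e(1,3)] lplus_eq[OF e(2,3)]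
        lnorm_eq[OF e(3)] lnorm_eq[OF partition_join[OF partition_join[OF e(1,2)] e(3)]]
        lnorm_eq[OF partition_join[OF e(1,3)]] lnorm_eq[OF partition_join[OF e(2,3)]]
        add_divide_distrib[symmetric]
      using n by (intro divide_right_mono) auto
    then show "fml_val ?P f e = 0" unfolding f_def by (simp add: clip_eq_0_iff)
  qed (use assms in \<open>auto simp: f_def\<close>)
  then show ?thesis unfolding f_def by (simp add: clip_eq_0_iff)
qed

lemma mnorm_nonneg: "0 \<le> mnorm x"
  unfolding lnorm_def by (rule nonneg)

text \<open>In particular the norm is monotone and measures distances between comparable elements.\<close>

lemma mdist_mplus:
  assumes "x \<in> carrier M" "y \<in> carrier M"
  shows "mdist x (x \<oplus> y) = mnorm (x \<oplus> y) - mnorm x" "mdist (y \<oplus> x) x = mnorm (x \<oplus> y) - mnorm x"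
proof -
  have "x \<oplus> (x \<oplus> y) = x \<oplus> y" using mplus_assoc[of x x y] mplus_idem assms by simp
  then show *: "mdist x (x \<oplus> y) = mnorm (x \<oplus> y) - mnorm x"
    using mdist_eq_mnorm[of x "x \<oplus> y"] assms by simp
  then show "mdist (y \<oplus> x) x = mnorm (x \<oplus> y) - mnorm x"
    using commute[of x "x \<oplus> y"] mplus_commute[OF assms] by simp
qed

lemma mnorm_mono:
  assumes "x \<in> carrier M" "y \<in> carrier M"
  shows "mnorm x \<le> mnorm (x \<oplus> y)" "mnorm y \<le> mnorm (x \<oplus> y)"
proof -
  show "mnorm x \<le> mnorm (x \<oplus> y)" using mdist_mplus(1)[OF assms] nonneg[of x "x \<oplus> y"] by linarith
  show "mnorm y \<le> mnorm (x \<oplus> y)"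
    using mdist_mplus(1)[OF assms(2,1)] nonneg[of y "y \<oplus> x"] mplus_commute[OF assms] by simp
qed

lemma mnorm_lipschitz:
  assumes "x \<in> carrier M" "y \<in> carrier M"
  shows "mnorm x \<le> mnorm y + mdist x y"
  unfolding lnorm_def using triangle[OF assms lzero_closed] by simp

lemma mplus_lipschitz:
  assumes "x \<in> carrier M" "y \<in> carrier M" "z \<in> carrier M"
  shows "mdist (z \<oplus> x) (z \<oplus> y) \<le> mdist x y" "mdist (x \<oplus> z) (y \<oplus> z) \<le> mdist x y"
  using lplus_contractive[of z x z y] lplus_contractive[of x z y z] assms by simp_all

lemma cauchy_limit:
  assumes s: "\<And>k. s k \<in> carrier M" and c: "\<And>k l. mdist (s k) (s l) \<le> e k + e l" and e: "e \<longlonglongrightarrow> 0"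
  shows "\<exists>z \<in> carrier M. (\<lambda>k. mdist (s k) z) \<longlonglongrightarrow> 0 \<and> (\<forall>k. mdist (s k) z \<le> e k)"
proof -
  have "MCauchy s"
    unfolding MCauchy_def
  proof (intro conjI allI impI)
    show "range s \<subseteq> carrier M" using s by auto
    fix \<epsilon> :: real assume "\<epsilon> > 0"
    then obtain N where N: "\<And>k. k \<ge> N \<Longrightarrow> e k < \<epsilon> / 2"
      using order_tendstoD(2)[OF e, of "\<epsilon> / 2"] unfolding eventually_sequentially by auto
    have "mdist (s k) (s l) < \<epsilon>" if "N \<le> k" "N \<le> l" for k l
      using c[of k l] N[OF that(1)] N[OF that(2)] by linarith
    then show "\<exists>N. \<forall>n n'. N \<le> n \<longrightarrow> N \<le> n' \<longrightarrow> mdist (s n) (s n') < \<epsilon>" by blast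
  qed
  then obtain z where "limitin mtopology s z sequentially" using complete unfolding mcomplete_def by blast
  then have z: "z \<in> carrier M" and lim: "(\<lambda>k. mdist (s k) z) \<longlonglongrightarrow> 0"
    unfolding limitin_metric_dist_null by auto
  have "mdist (s k) z \<le> e k" for k
  proof (rule LIMSEQ_le_const)
    show "(\<lambda>l. e k + e l + mdist (s l) z) \<longlonglongrightarrow> e k"
      using tendsto_add[OF tendsto_add[OF tendsto_const e] lim, of "e k"] by simp
    have "mdist (s k) z \<le> e k + e l + mdist (s l) z" for l
      using triangle[OF s[of k] s[of l] z] c[of k l] by linarith
    then show "\<exists>N. \<forall>l\<ge>N. mdist (s k) z \<le> e k + e l + mdist (s l) z" by blast
  qed
  then show ?thesis using z lim by blast
qed

text \<open>Approximate common lower bounds whose norms are nearly as large as possible are close to each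
  other: their join is again an approximate lower bound, so its norm is hardly larger, and the
  distance is given by the norms.  Completeness then yields an actual lower bound.\<close>

lemma lower_bound_limit:
  assumes x: "x \<in> carrier M" and a: "a \<in> carrier M" and s: "\<And>k. s k \<in> carrier M"
    and low: "\<And>k. mdist (s k \<oplus> x) x \<le> e k" "\<And>k. mdist (s k \<oplus> a) a \<le> e k"
    and large: "\<And>k. r - e k \<le> mnorm (s k)"
    and bound: "\<And>k l. mnorm (s k \<oplus> s l) \<le> r + 2 * (e k + e l)"
    and e: "e \<longlonglongrightarrow> 0"
  shows "\<exists>z \<in> carrier M. z \<oplus> x = x \<and> z \<oplus> a = a \<and> r \<le> mnorm z"
proof -
  have "mdist (s k) (s l) \<le> 5 * e k + 5 * e l" for k l
    unfolding mdist_eq_mnorm[OF s s] using large[of k] large[of l] bound[of k l] by argo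
  moreover have "(\<lambda>k. 5 * e k) \<longlonglongrightarrow> 0" using tendsto_mult_left[OF e, of 5] by simp
  ultimately obtain z where z: "z \<in> carrier M" and lim: "(\<lambda>k. mdist (s k) z) \<longlonglongrightarrow> 0"
    using cauchy_limit[of s "\<lambda>k. 5 * e k", OF s] by blast
  have below: "z \<oplus> u = u" if u: "u \<in> carrier M" and lu: "\<And>k. mdist (s k \<oplus> u) u \<le> e k" for u
  proof (rule eq_of_mdist_0)
    have "mdist (z \<oplus> u) u \<le> mdist (s k) z + e k" for k
      using triangle[of "z \<oplus> u" "s k \<oplus> u" u] mplus_lipschitz(2)[OF z s[of k] u] lu[of k] commute[of z "s k"] z s u
      by simp
    then have "mdist (z \<oplus> u) u \<le> 0"
      using LIMSEQ_le_const[OF tendsto_add[OF lim e], of "mdist (z \<oplus> u) u"] by auto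
    then show "mdist (z \<oplus> u) u = 0" using nonneg[of "z \<oplus> u" u] by linarith
  qed (use z u in auto)
  have "r \<le> mnorm z + (e k + mdist (s k) z)" for k
    using large[of k] mnorm_lipschitz[OF s[of k] z] by linarith
  then have "r \<le> mnorm z + (0 + 0)"
    by (intro LIMSEQ_le_const[OF tendsto_add[OF tendsto_const tendsto_add[OF e lim]]]) auto
  then show ?thesis using z below[OF x low(1)] below[OF a low(2)] by auto
qed

lemma half_powers: "(\<lambda>k. (1 / 2 :: real) ^ k) \<longlonglongrightarrow> 0"
  by (rule LIMSEQ_power_zero) simp

text \<open>Meets exist by completeness: approximate the supremum of the norms of the lower bounds, which are
  closed under joins.\<close>

lemma lmeet_properties:
  assumes x: "x \<in> carrier M" and a: "a \<in> carrier M"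
  shows "lmeet M x a \<in> carrier M" "lmeet M x a \<oplus> x = x" "lmeet M x a \<oplus> a = a"
    "\<And>w. \<lbrakk>w \<in> carrier M; w \<oplus> x = x; w \<oplus> a = a\<rbrakk> \<Longrightarrow> w \<oplus> lmeet M x a = lmeet M x a"
proof -
  define L where "L = {w \<in> carrier M. w \<oplus> x = x \<and> w \<oplus> a = a}"
  have LC: "w \<in> carrier M" if "w \<in> L" for w using that unfolding L_def by simp
  have L0: "lzero M \<in> L" unfolding L_def using mplus_lzero x a by simp
  have Lplus: "w \<oplus> w' \<in> L" if "w \<in> L" "w' \<in> L" for w w'
    using that x a mplus_assoc unfolding L_def by simp
  define r where "r = (SUP w \<in> L. mnorm w)"
  have bdd: "bdd_above (mnorm ` L)"
    using diameter LC unfolding lnorm_def by (intro bdd_aboveI[of _ 1]) auto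
  have upper: "mnorm w \<le> r" if "w \<in> L" for w
    unfolding r_def by (rule cSUP_upper[OF that bdd])
  have "\<exists>w \<in> L. r - (1 / 2) ^ k \<le> mnorm w" for k :: nat
  proof -
    have "r - (1 / 2) ^ k < r" by simp
    then obtain w where "w \<in> L" "r - (1 / 2) ^ k < mnorm w"
      unfolding r_def using less_cSUP_iff[OF _ bdd] L0 by blast
    then show ?thesis by force
  qed
  then obtain s where s: "\<And>k. s k \<in> L" "\<And>k. r - (1 / 2) ^ k \<le> mnorm (s k)" by metis
  have "\<exists>z \<in> carrier M. z \<oplus> x = x \<and> z \<oplus> a = a \<and> r \<le> mnorm z"
  proof (rule lower_bound_limit[OF x a _ _ _ s(2) _ half_powers])
    show "s k \<in> carrier M" for k by (rule LC[OF s(1)])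
    have "s k \<oplus> x = x" "s k \<oplus> a = a" for k using s(1)[of k] unfolding L_def by auto
    then show "mdist (s k \<oplus> x) x \<le> (1 / 2) ^ k" "mdist (s k \<oplus> a) a \<le> (1 / 2) ^ k" for k
      using x a by simp_all
    have "mnorm (s k \<oplus> s l) \<le> r" for k l by (rule upper[OF Lplus[OF s(1) s(1)]])
    moreover have "0 \<le> 2 * ((1 / 2 :: real) ^ k + (1 / 2) ^ l)" for k l by simp
    ultimately show "mnorm (s k \<oplus> s l) \<le> r + 2 * ((1 / 2) ^ k + (1 / 2) ^ l)" for k l
      by (smt (verit))
  qed
  then obtain z where z: "z \<in> L" "r \<le> mnorm z" unfolding L_def by blast
  have zC: "z \<in> carrier M" by (rule LC[OF z(1)])
  have top: "w \<oplus> z = z" if w: "w \<in> L" for w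
  proof -
    have wC: "w \<in> carrier M" by (rule LC[OF w])
    have "mdist (w \<oplus> z) z \<le> 0"
      using mdist_mplus(2)[OF zC wC] upper[OF Lplus[OF z(1) w]] z(2) by linarith
    then show ?thesis using nonneg[of "w \<oplus> z" z] by (intro eq_of_mdist_0) (use zC wC in auto)
  qed
  have Lower: "Lower (lorder M) {x, a} = L"
    unfolding Lower_def L_def lorder_def using x a by auto
  have g: "greatest (lorder M) z (Lower (lorder M) {x, a})"
    unfolding greatest_def Lower using z(1) top LC by (auto simp: lorder_def)
  have "u = z" if "greatest (lorder M) u (Lower (lorder M) {x, a})" for u
  proof -
    have u: "u \<in> L" "z \<oplus> u = u" using that z(1) unfolding greatest_def Lower by (auto simp: lorder_def)
    then show ?thesis using top[OF u(1)] mplus_commute[OF zC LC[OF u(1)]] by simp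
  qed
  then have "lmeet M x a = z"
    unfolding lmeet_def Lattice.meet_def Lattice.inf_def by (intro some_equality g)
  then show "lmeet M x a \<in> carrier M" "lmeet M x a \<oplus> x = x" "lmeet M x a \<oplus> a = a"
    "\<And>w. \<lbrakk>w \<in> carrier M; w \<oplus> x = x; w \<oplus> a = a\<rbrakk> \<Longrightarrow> w \<oplus> lmeet M x a = lmeet M x a"
    using z(1) top unfolding L_def by auto
qed

section \<open>Metric modularity and selectors in models\<close>

lemma INF_clip_le_modularity_defect:
  assumes x: "x \<in> carrier M"
  shows "(INF z \<in> carrier M. clip (meet_defect M x a z)) \<le> modularity_defect M a"
  unfolding modularity_defect_def
proof (rule cSUP_upper[OF x])
  have "(INF z \<in> carrier M. clip (meet_defect M x a z)) \<le> 1" for x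
    using clip_bounds by (intro cINF_lower2[OF _ lzero_closed]) (auto intro: bdd_belowI[of _ 0])
  then show "bdd_above ((\<lambda>x. INF z \<in> carrier M. clip (meet_defect M x a z)) ` carrier M)"
    by (intro bdd_aboveI[of _ 1]) auto
qed

lemma modularity_defect_nonneg: "0 \<le> modularity_defect M a"
proof -
  have "0 \<le> (INF z \<in> carrier M. clip (meet_defect M (lzero M) a z))"
    using clip_bounds lzero_closed by (intro cINF_greatest) auto
  also have "\<dots> \<le> modularity_defect M a" by (rule INF_clip_le_modularity_defect) simp
  finally show ?thesis .
qed

text \<open>The meet is a witness with defect 0 for every \<open>x\<close>.\<close>

lemma metrically_modular_defect:
  assumes "metrically_modular M a"
  shows "modularity_defect M a = 0"
proof -
  have a: "a \<in> carrier M" using assms unfolding metrically_modular_def by simp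
  have "(INF z \<in> carrier M. clip (meet_defect M x a z)) = 0" if x: "x \<in> carrier M" for x
  proof (rule INF_eq_0[OF lmeet_properties(1)[OF x a]])
    have "mnorm (x \<oplus> a) + mnorm (lmeet M x a) = mnorm x + mnorm a"
      using assms x unfolding metrically_modular_def by blast
    then show "clip (meet_defect M x a (lmeet M x a)) = 0"
      unfolding meet_defect_def lmeet_properties(2,3)[OF x a] using x a by (simp add: clip_def)
  qed (rule clip_bounds)
  then have "modularity_defect M a = (SUP x \<in> carrier M. (0 :: real))"
    unfolding modularity_defect_def by (intro SUP_cong) auto
  also have "\<dots> = 0" using lzero_closed by (intro cSUP_const) auto
  finally show ?thesis .
qed

lemma mdist_approx_lower:
  assumes "z \<in> carrier M" "w \<in> carrier M" "x \<in> carrier M"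
  shows "mdist (z \<oplus> w \<oplus> x) x \<le> mdist (z \<oplus> x) x + mdist (w \<oplus> x) x"
proof -
  have "mdist (z \<oplus> (w \<oplus> x)) x \<le> mdist (z \<oplus> (w \<oplus> x)) (z \<oplus> x) + mdist (z \<oplus> x) x"
    using assms by (intro triangle) auto
  moreover have "mdist (z \<oplus> (w \<oplus> x)) (z \<oplus> x) \<le> mdist (w \<oplus> x) x"
    using assms by (intro mplus_lipschitz) auto
  ultimately show ?thesis using mplus_assoc[OF assms] by simp
qed

text \<open>The converse, where only approximate witnesses are given.  Semimodularity makes them converge, and
  the limit has to be the meet.\<close>

lemma modularity_defect_0_imp:
  assumes a: "a \<in> carrier M" and 0: "modularity_defect M a = 0"
  shows "metrically_modular M a"
  unfolding metrically_modular_def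
proof (intro conjI a ballI)
  fix x assume x: "x \<in> carrier M"
  define r where "r = mnorm x + mnorm a - mnorm (x \<oplus> a)"
  \<comment> \<open>Semimodularity bounds an approximate lower bound just as it bounds a lower bound.\<close>
  have upper: "mnorm w \<le> r + mdist (w \<oplus> x) x + mdist (w \<oplus> a) a" if w: "w \<in> carrier M" for w
  proof -
    have "mnorm (x \<oplus> a \<oplus> w) + mnorm w \<le> mnorm (x \<oplus> w) + mnorm (a \<oplus> w)"
      by (rule mnorm_semimodular[OF x a w])
    moreover have "mnorm (x \<oplus> a) \<le> mnorm (x \<oplus> a \<oplus> w)" using x a w by (intro mnorm_mono) auto
    ultimately show ?thesis
      using mdist_mplus(2)[OF x w] mdist_mplus(2)[OF a w] unfolding r_def by linarith
  qed
  have "\<exists>z \<in> carrier M. meet_defect M x a z \<le> (1 / 2) ^ k" for k :: nat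
  proof -
    have p: "(1 / 2 :: real) ^ k \<le> 1" "0 < (1 / 2 :: real) ^ k" by (simp_all add: power_le_one)
    have "(INF z \<in> carrier M. clip (meet_defect M x a z)) < (1 / 2) ^ k / 2"
      using INF_clip_le_modularity_defect[OF x, of a] assms(2) p by linarith
    then obtain z where z: "z \<in> carrier M" "clip (meet_defect M x a z) < (1 / 2) ^ k / 2"
      using INF_less_witness carrier_nonempty by blast
    then have "meet_defect M x a z \<le> (1 / 2) ^ k" using le_of_clip_less[of "meet_defect M x a z"] p by linarith
    then show ?thesis using z by auto
  qed
  then obtain s where s: "\<And>k. s k \<in> carrier M" and ms: "\<And>k :: nat. meet_defect M x a (s k) \<le> (1 / 2) ^ k" by metis
  have low: "mdist (s k \<oplus> x) x \<le> (1 / 2) ^ k" "mdist (s k \<oplus> a) a \<le> (1 / 2) ^ k" "clip (r - mnorm (s k)) \<le> (1 / 2) ^ k" for k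
    using ms[of k] nonneg[of "s k \<oplus> x" x] nonneg[of "s k \<oplus> a" a] clip_bounds(1)[of "r - mnorm (s k)"]
    unfolding meet_defect_def r_def by linarith+
  have "r \<le> 1"
    using mnorm_mono(1)[OF x a] diameter[OF a lzero_closed] unfolding r_def lnorm_def by linarith
  then have large: "r - (1 / 2) ^ k \<le> mnorm (s k)" for k
    using low(3)[of k] mnorm_nonneg[of "s k"] unfolding clip_def by linarith
  have "\<exists>z \<in> carrier M. z \<oplus> x = x \<and> z \<oplus> a = a \<and> r \<le> mnorm z"
  proof (rule lower_bound_limit[OF x a s low(1,2) large _ half_powers])
    fix k l
    have "mnorm (s k \<oplus> s l) \<le> r + mdist (s k \<oplus> s l \<oplus> x) x + mdist (s k \<oplus> s l \<oplus> a) a"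
      using s by (intro upper) auto
    then show "mnorm (s k \<oplus> s l) \<le> r + 2 * ((1 / 2) ^ k + (1 / 2) ^ l)"
      using mdist_approx_lower[OF s[of k] s[of l] x] mdist_approx_lower[OF s[of k] s[of l] a]
        low(1,2)[of k] low(1,2)[of l] by argo
  qed
  then obtain z where z: "z \<in> carrier M" "z \<oplus> x = x" "z \<oplus> a = a" "r \<le> mnorm z" by blast
  note m = lmeet_properties[OF x a]
  have "mnorm z \<le> mnorm (lmeet M x a)"
    using mnorm_mono(1)[OF z(1) m(1)] m(4)[OF z(1,2,3)] by simp
  moreover have "mnorm (lmeet M x a) \<le> r" using upper[OF m(1)] m(2,3) x a by simp
  ultimately show "mnorm (x \<oplus> a) + mnorm (lmeet M x a) = mnorm x + mnorm a"
    using z(4) unfolding r_def by linarith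
qed

lemma selector_defect_nonneg: "0 \<le> selector_defect M x a"
  unfolding selector_defect_def by (rule clip_bounds)

lemma selector_defect_eq_0_iff:
  assumes x: "x \<in> carrier M" and a: "a \<in> carrier M"
  shows "selector_defect M x a = 0 \<longleftrightarrow> a \<in> selectors M x"
proof
  assume "selector_defect M x a = 0"
  then have "modularity_defect M a + mdist (x \<oplus> a) (lone M) + clip (mnorm x + mnorm a - 1) +
      clip (1 - mnorm x - mnorm a) \<le> 0"
    unfolding selector_defect_def clip_eq_0_iff .
  then have 0: "modularity_defect M a = 0" "mdist (x \<oplus> a) (lone M) = 0"
    "clip (mnorm x + mnorm a - 1) = 0" "clip (1 - mnorm x - mnorm a) = 0"
    using modularity_defect_nonneg[of a] nonneg[of "x \<oplus> a" "lone M"]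
      clip_bounds(1)[of "mnorm x + mnorm a - 1"] clip_bounds(1)[of "1 - mnorm x - mnorm a"] by linarith+
  have one: "x \<oplus> a = lone M" by (rule eq_of_mdist_0[OF 0(2)]) (use x a in auto)
  have mod: "metrically_modular M a" by (rule modularity_defect_0_imp[OF a 0(1)])
  then have "mnorm (x \<oplus> a) + mnorm (lmeet M x a) = mnorm x + mnorm a"
    using x unfolding metrically_modular_def by blast
  then have "mnorm (lmeet M x a) = 0"
    using 0(3,4) unfolding clip_eq_0_iff one mnorm_lone by linarith
  then have "lmeet M x a = lzero M"
    unfolding lnorm_def by (rule eq_of_mdist_0) (use lmeet_properties(1)[OF x a] in auto)
  then show "a \<in> selectors M x" unfolding selectors_def using mod one by simp
next
  assume "a \<in> selectors M x"
  then have s: "metrically_modular M a" "x \<oplus> a = lone M" "lmeet M x a = lzero M"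
    unfolding selectors_def by auto
  have "mnorm (x \<oplus> a) + mnorm (lmeet M x a) = mnorm x + mnorm a"
    using s(1) x unfolding metrically_modular_def by blast
  then have "mnorm x + mnorm a = 1" unfolding s(2,3) mnorm_lone by (simp add: lnorm_def)
  then show "selector_defect M x a = 0"
    unfolding selector_defect_def metrically_modular_defect[OF s(1)] s(2) by (simp add: clip_def)
qed

lemma selectors_closed: "selectors M x \<subseteq> carrier M"
  unfolding selectors_def metrically_modular_def by auto

lemma meet_defect_lipschitz:
  assumes x: "x \<in> carrier M" and a: "a \<in> carrier M" and b: "b \<in> carrier M" and z: "z \<in> carrier M"
  shows "meet_defect M x a z \<le> meet_defect M x b z + 4 * mdist a b"
proof -
  have "mdist (z \<oplus> a) a \<le> mdist (z \<oplus> b) b + 2 * mdist a b"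
    using triangle[of "z \<oplus> a" "z \<oplus> b" a] triangle[of "z \<oplus> b" b a] mplus_lipschitz(1)[OF a b z]
      commute[of a b] a b z by simp
  moreover have "clip (mnorm x + mnorm a - mnorm (x \<oplus> a) - mnorm z)
      \<le> clip (mnorm x + mnorm b - mnorm (x \<oplus> b) - mnorm z) + 2 * mdist a b"
  proof (rule clip_add_le)
    have "mnorm (x \<oplus> b) \<le> mnorm (x \<oplus> a) + mdist a b"
      using mnorm_lipschitz[of "x \<oplus> b" "x \<oplus> a"] mplus_lipschitz(1)[OF b a x] commute[of a b] x a b by simp
    then show "mnorm x + mnorm a - mnorm (x \<oplus> a) - mnorm z
        \<le> mnorm x + mnorm b - mnorm (x \<oplus> b) - mnorm z + 2 * mdist a b"
      using mnorm_lipschitz[OF a b] by linarith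
  qed (use nonneg in simp)
  ultimately show ?thesis unfolding meet_defect_def by linarith
qed

lemma modularity_defect_lipschitz:
  assumes a: "a \<in> carrier M" and b: "b \<in> carrier M"
  shows "modularity_defect M a \<le> modularity_defect M b + 4 * mdist a b"
proof -
  have "(INF z \<in> carrier M. clip (meet_defect M x a z)) \<le> modularity_defect M b + 4 * mdist a b"
    if x: "x \<in> carrier M" for x
  proof -
    have "(INF z \<in> carrier M. clip (meet_defect M x a z)) - 4 * mdist a b \<le> clip (meet_defect M x b z)"
      if z: "z \<in> carrier M" for z
    proof -
      have "(INF z \<in> carrier M. clip (meet_defect M x a z)) \<le> clip (meet_defect M x a z)"
        using clip_bounds by (intro cINF_lower[OF _ z]) (auto intro: bdd_belowI[of _ 0])
      also have "\<dots> \<le> clip (meet_defect M x b z) + 4 * mdist a b"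
        by (rule clip_add_le[OF meet_defect_lipschitz[OF x a b z]]) (use nonneg in simp)
      finally show ?thesis by linarith
    qed
    then have "(INF z \<in> carrier M. clip (meet_defect M x a z)) - 4 * mdist a b
        \<le> (INF z \<in> carrier M. clip (meet_defect M x b z))"
      using lzero_closed by (intro cINF_greatest) auto
    then show ?thesis using INF_clip_le_modularity_defect[OF x, of b] by linarith
  qed
  then show ?thesis
    unfolding modularity_defect_def[of M a] using lzero_closed by (intro cSUP_least) auto
qed

lemma selector_defect_lipschitz:
  assumes x: "x \<in> carrier M" and a: "a \<in> carrier M" and b: "b \<in> carrier M"
  shows "selector_defect M x a \<le> selector_defect M x b + 7 * mdist a b"
  unfolding selector_defect_def
proof (rule clip_add_le)
  have "mdist (x \<oplus> a) (lone M) \<le> mdist (x \<oplus> b) (lone M) + mdist a b"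
    using triangle[of "x \<oplus> a" "x \<oplus> b" "lone M"] mplus_lipschitz(1)[OF a b x] x a b by simp
  moreover have "clip (mnorm x + mnorm a - 1) \<le> clip (mnorm x + mnorm b - 1) + mdist a b"
    using mnorm_lipschitz[OF a b] nonneg by (intro clip_add_le) auto
  moreover have "clip (1 - mnorm x - mnorm a) \<le> clip (1 - mnorm x - mnorm b) + mdist a b"
    using mnorm_lipschitz[OF b a] nonneg commute[of a b] by (intro clip_add_le) auto
  ultimately show "modularity_defect M a + mdist (x \<oplus> a) (lone M) + clip (mnorm x + mnorm a - 1) + clip (1 - mnorm x - mnorm a)
      \<le> modularity_defect M b + mdist (x \<oplus> b) (lone M) + clip (mnorm x + mnorm b - 1) + clip (1 - mnorm x - mnorm b)
        + 7 * mdist a b"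
    using modularity_defect_lipschitz[OF a b] by argo
qed (use nonneg in simp)

text \<open>The transferred form of the fact that a selector of \<open>x\<close> can be moved to one of \<open>y\<close>.  It speaks
  of approximate selectors on both sides.\<close>

lemma selector_move_approx:
  assumes x: "x \<in> carrier M" and y: "y \<in> carrier M" and a: "a \<in> carrier M" and \<epsilon>: "0 < \<epsilon>"
  shows "\<exists>b \<in> carrier M. selector_defect M y b < \<epsilon> \<and> mdist a b < mdist x y + 35 * selector_defect M x a + \<epsilon>"
proof -
  define f where "f = FInf 3 (FLin 0 [(1, selector_fml 1 3),
    (1, FLin 0 [(1, Dist (Var 2) (Var 3)), (- 1, Dist (Var 0) (Var 1)), (- 35, selector_fml 0 2)])])"
  have "fml_val M f ((\<lambda>_. lzero M)(0 := x, 1 := y, 2 := a)) = 0"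
  proof (rule transfer3)
    fix n and e :: "nat \<Rightarrow> nat set set"
    assume "partition_lattice_ge_2 n" and e: "partition_on {1..n} (e 0)" "partition_on {1..n} (e 1)"
      "partition_on {1..n} (e 2)"
    interpret partition_lattice_ge_2 n by fact
    obtain b where b: "partition_on {1..n} b" "selector_defect (partition_lattice n) (e 1) b = 0"
      "ldist (partition_lattice n) (e 2) b
        \<le> ldist (partition_lattice n) (e 0) (e 1) + 35 * selector_defect (partition_lattice n) (e 0) (e 2)"
      using selector_move[OF e] by blast
    have "fml_val (partition_lattice n) f e = (INF b \<in> carrier (partition_lattice n).
      clip (selector_defect (partition_lattice n) (e 1) b + clip (ldist (partition_lattice n) (e 2) b
        - ldist (partition_lattice n) (e 0) (e 1) - 35 * selector_defect (partition_lattice n) (e 0) (e 2))))"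
      unfolding f_def by (simp add: algebra_simps)
    also have "\<dots> = 0"
    proof (rule INF_eq_0)
      show "b \<in> carrier (partition_lattice n)" using b(1) unfolding carrier_iff .
      have "clip (ldist (partition_lattice n) (e 2) b
        - ldist (partition_lattice n) (e 0) (e 1) - 35 * selector_defect (partition_lattice n) (e 0) (e 2)) = 0"
        unfolding clip_eq_0_iff using b(3) by linarith
      then show "clip (selector_defect (partition_lattice n) (e 1) b + clip (ldist (partition_lattice n) (e 2) b
        - ldist (partition_lattice n) (e 0) (e 1) - 35 * selector_defect (partition_lattice n) (e 0) (e 2))) = 0"
        unfolding b(2) by (simp add: clip_def)
    qed (rule clip_bounds)
    finally show "fml_val (partition_lattice n) f e = 0" .
  qed (use assms in \<open>auto simp: f_def\<close>)
  then have "(INF b \<in> carrier M. clip (selector_defect M y b +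
      clip (mdist a b - mdist x y - 35 * selector_defect M x a))) = 0"
    unfolding f_def by (simp add: algebra_simps)
  then have "(INF b \<in> carrier M. clip (selector_defect M y b +
      clip (mdist a b - mdist x y - 35 * selector_defect M x a))) < min \<epsilon> 1"
    using \<epsilon> by simp
  then obtain b where b: "b \<in> carrier M" and c: "clip (selector_defect M y b +
      clip (mdist a b - mdist x y - 35 * selector_defect M x a)) < min \<epsilon> 1"
    using INF_less_witness[of "\<lambda>b. clip (selector_defect M y b +
      clip (mdist a b - mdist x y - 35 * selector_defect M x a))" "carrier M"] lzero_closed by blast
  have s: "selector_defect M y b + clip (mdist a b - mdist x y - 35 * selector_defect M x a) < min \<epsilon> 1"
    using le_of_clip_less[of "selector_defect M y b +
      clip (mdist a b - mdist x y - 35 * selector_defect M x a)"] c by linarith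
  then have "clip (mdist a b - mdist x y - 35 * selector_defect M x a) < min \<epsilon> 1"
    using selector_defect_nonneg[of y b] by linarith
  then have "mdist a b - mdist x y - 35 * selector_defect M x a < \<epsilon>"
    using le_of_clip_less[of "mdist a b - mdist x y - 35 * selector_defect M x a"] by linarith
  then show ?thesis
    using b s clip_bounds(1)[of "mdist a b - mdist x y - 35 * selector_defect M x a"] by force
qed

end

section \<open>The Hausdorff distance of selector sets\<close>

text \<open>A formula for the distance from \<open>a\<close> to the set of selectors: leaving that set is penalised at a
  rate at least as large as the distance from it.\<close>

definition selector_distance :: "'a fpl_str \<Rightarrow> 'a \<Rightarrow> 'a \<Rightarrow> real"
  where "selector_distance M y a = (INF b \<in> carrier M. clip (ldist M a b + 35 * selector_defect M y b))"

text \<open>This vanishes if \<open>a\<close> and \<open>b\<close> are selectors of \<open>x\<close> and \<open>y\<close> whose distances from the selectors of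
  the other element add up to at least \<open>d(x, x + y)\<close>.\<close>

definition separation_defect :: "'a fpl_str \<Rightarrow> 'a \<Rightarrow> 'a \<Rightarrow> 'a \<Rightarrow> 'a \<Rightarrow> real"
  where "separation_defect M x y a b = clip (selector_defect M x a + selector_defect M y b +
    clip (lnorm M (lplus M x y) - lnorm M x - selector_distance M y a - selector_distance M x b))"

definition separation_fml :: fml
  where "separation_fml = FInf 2 (FInf 3 (FLin 0 [(1, selector_fml 0 2), (1, selector_fml 1 3),
    (1, FLin 0 [(1, norm_fml (Plus (Var 0) (Var 1))), (- 1, norm_fml (Var 0)),
      (- 1, FInf 4 (FLin 0 [(1, Dist (Var 2) (Var 4)), (35, selector_fml 1 4)])),
      (- 1, FInf 5 (FLin 0 [(1, Dist (Var 3) (Var 5)), (35, selector_fml 0 5)]))])]))"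

lemma separation_fml_simps [simp]:
  "fml_val M separation_fml e = (INF a \<in> carrier M. INF b \<in> carrier M. separation_defect M (e 0) (e 1) a b)"
  "wff separation_fml" "free_vars separation_fml = {0, 1}"
  unfolding separation_fml_def separation_defect_def selector_distance_def
  by (auto simp: algebra_simps)

lemma (in partition_lattice_ge_2) separation_defect_witness:
  assumes x: "partition_on {1..n} x" and y: "partition_on {1..n} y"
  shows "\<exists>a b. partition_on {1..n} a \<and> partition_on {1..n} b \<and> separation_defect (partition_lattice n) x y a b = 0"
proof -
  let ?P = "partition_lattice n"
  obtain a b v v' where ab: "partition_on {1..n} a" "partition_on {1..n} b"
    "selector_defect ?P x a = 0" "selector_defect ?P y b = 0"
    and gap: "lnorm ?P (lplus ?P x y) - lnorm ?P x \<le> v + v'"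
    and far: "\<And>b'. partition_on {1..n} b' \<Longrightarrow> v \<le> clip (ldist ?P a b' + 35 * selector_defect ?P y b')"
      "\<And>a'. partition_on {1..n} a' \<Longrightarrow> v' \<le> clip (ldist ?P b a' + 35 * selector_defect ?P x a')"
    using far_selectors[OF x y] by metis
  have ne: "carrier ?P \<noteq> {}" using singletons_partition_lattice[of n] by blast
  have "v \<le> selector_distance ?P y a" "v' \<le> selector_distance ?P x b"
    unfolding selector_distance_def using far ne by (auto intro!: cINF_greatest simp: carrier_iff)
  then have "clip (lnorm ?P (lplus ?P x y) - lnorm ?P x - selector_distance ?P y a - selector_distance ?P x b) = 0"
    unfolding clip_eq_0_iff using gap by linarith
  then have "separation_defect ?P x y a b = 0"
    unfolding separation_defect_def ab(3,4) by (simp add: clip_def)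
  then show ?thesis using ab(1,2) by blast
qed

context FPL_model
begin

text \<open>Move \<open>a\<close> to an approximate selector of \<open>y\<close>, then correct it repeatedly by moving from \<open>y\<close> to
  \<open>y\<close>.  Each correction is controlled by the defect that is left, so the corrections are summable
  and the limit is a selector.\<close>

lemma selector_move:
  assumes x: "x \<in> carrier M" and y: "y \<in> carrier M" and a: "a \<in> carrier M" and \<epsilon>: "0 < \<epsilon>"
  shows "\<exists>b \<in> selectors M y. mdist a b \<le> mdist x y + 35 * selector_defect M x a + \<epsilon>"
proof -
  \<comment> \<open>The first move costs \<open>\<eta>\<close>, the corrections \<open>36 \<eta> (1 + 1/2 + 1/4 + \<dots>) = 72 \<eta>\<close>.\<close>
  define \<eta> where "\<eta> = \<epsilon> / 73"
  have \<eta>: "0 < \<eta>" unfolding \<eta>_def using \<epsilon> by simp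
  obtain b0 where b0: "b0 \<in> carrier M" "selector_defect M y b0 < \<eta>"
    "mdist a b0 < mdist x y + 35 * selector_defect M x a + \<eta>"
    using selector_move_approx[OF x y a \<eta>] by blast
  define P where "P k b \<longleftrightarrow> b \<in> carrier M \<and> selector_defect M y b < \<eta> * (1 / 2) ^ k \<and> (k = 0 \<longrightarrow> b = b0)"
    for k :: nat and b
  have "\<exists>f. \<forall>k. P k (f k) \<and> mdist (f k) (f (Suc k)) \<le> 36 * (\<eta> * (1 / 2) ^ k)"
  proof (rule dependent_nat_choice)
    show "\<exists>b. P 0 b" unfolding P_def using b0 by auto
    fix b k assume b: "P k b"
    have "0 < \<eta> * (1 / 2) ^ Suc k" using \<eta> by simp
    then obtain b' where b': "b' \<in> carrier M" "selector_defect M y b' < \<eta> * (1 / 2) ^ Suc k"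
      "mdist b b' < mdist y y + 35 * selector_defect M y b + \<eta> * (1 / 2) ^ Suc k"
      using selector_move_approx[OF y y] b unfolding P_def by blast
    have "\<eta> * (1 / 2) ^ Suc k \<le> \<eta> * (1 / 2) ^ k" using \<eta> by simp
    moreover have "mdist y y = 0" using y by simp
    ultimately have "mdist b b' \<le> 36 * (\<eta> * (1 / 2) ^ k)" using b b'(3) unfolding P_def by linarith
    then show "\<exists>b'. P (Suc k) b' \<and> mdist b b' \<le> 36 * (\<eta> * (1 / 2) ^ k)"
      unfolding P_def using b' by blast
  qed
  then obtain f where P: "\<And>k. P k (f k)" and step: "\<And>k. mdist (f k) (f (Suc k)) \<le> 36 * (\<eta> * (1 / 2) ^ k)" by blast
  have fC: "f k \<in> carrier M" for k using P[of k] unfolding P_def by simp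
  have f0: "f 0 = b0" using P[of 0] unfolding P_def by simp
  have tail: "mdist (f k) (f (k + m)) \<le> 72 * (\<eta> * (1 / 2) ^ k) - 72 * (\<eta> * (1 / 2) ^ (k + m))" for k m
  proof (induction m)
    case 0
    then show ?case using fC by simp
  next
    case (Suc m)
    have "mdist (f k) (f (k + Suc m)) \<le> mdist (f k) (f (k + m)) + 36 * (\<eta> * (1 / 2) ^ (k + m))"
      using triangle[OF fC[of k] fC[of "k + m"] fC[of "k + Suc m"]] step[of "k + m"] by simp
    moreover have "\<eta> * (1 / 2) ^ (k + Suc m) = \<eta> * (1 / 2) ^ (k + m) / 2" by simp
    ultimately show ?case using Suc.IH by argo
  qed
  have cau: "mdist (f k) (f l) \<le> 72 * (\<eta> * (1 / 2) ^ k) + 72 * (\<eta> * (1 / 2) ^ l)" for k l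
  proof -
    have pos: "0 \<le> 72 * (\<eta> * (1 / 2) ^ j)" for j :: nat using \<eta> by simp
    show ?thesis
    proof (cases "k \<le> l")
      case True
      then show ?thesis using tail[of k "l - k"] pos[of l] by simp
    next
      case False
      then show ?thesis using tail[of l "k - l"] pos[of k] commute[of "f k" "f l"] by simp
    qed
  qed
  have lim0: "(\<lambda>k. 72 * (\<eta> * (1 / 2) ^ k)) \<longlonglongrightarrow> 0"
    using tendsto_mult_left[OF tendsto_mult_left[OF half_powers, of \<eta>], of 72] by simp
  obtain b where b: "b \<in> carrier M" "(\<lambda>k. mdist (f k) b) \<longlonglongrightarrow> 0" "\<And>k. mdist (f k) b \<le> 72 * (\<eta> * (1 / 2) ^ k)"
    using cauchy_limit[of f, OF fC cau lim0] by blast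
  have "selector_defect M y b \<le> 0"
  proof (rule LIMSEQ_le_const)
    show "(\<lambda>k. 72 * (\<eta> * (1 / 2) ^ k) + 7 * mdist (f k) b) \<longlonglongrightarrow> 0"
      using tendsto_add[OF lim0 tendsto_mult_left[OF b(2), of 7]] by simp
    have "selector_defect M y b \<le> 72 * (\<eta> * (1 / 2) ^ k) + 7 * mdist (f k) b" for k
    proof -
      have "selector_defect M y (f k) < \<eta> * (1 / 2) ^ k" using P[of k] unfolding P_def by simp
      moreover have "0 < \<eta> * (1 / 2) ^ k" using \<eta> by simp
      ultimately show ?thesis
        using selector_defect_lipschitz[OF y b(1) fC[of k]] commute[of b "f k"] by linarith
    qed
    then show "\<exists>N. \<forall>k\<ge>N. selector_defect M y b \<le> 72 * (\<eta> * (1 / 2) ^ k) + 7 * mdist (f k) b" by blast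
  qed
  then have "b \<in> selectors M y"
    using selector_defect_nonneg[of y b] selector_defect_eq_0_iff[OF y b(1)] by linarith
  moreover have "mdist a b \<le> mdist x y + 35 * selector_defect M x a + \<epsilon>"
    using triangle[OF a b0(1) b(1)] b0(3) b(3)[of 0] f0 unfolding \<eta>_def by simp
  ultimately show ?thesis by blast
qed

lemma selectors_nonempty:
  assumes "x \<in> carrier M"
  shows "selectors M x \<noteq> {}"
  using selector_move[OF assms assms assms, of 1] by auto

lemma separation_witness:
  assumes x: "x \<in> carrier M" and y: "y \<in> carrier M" and \<epsilon>: "0 < \<epsilon>"
  shows "\<exists>a \<in> carrier M. \<exists>b \<in> carrier M. selector_defect M x a < \<epsilon> \<and> selector_defect M y b < \<epsilon> \<and>
    mnorm (x \<oplus> y) - mnorm x < selector_distance M y a + selector_distance M x b + \<epsilon>"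
proof -
  have "fml_val M separation_fml ((\<lambda>_. lzero M)(0 := x, 1 := y, 2 := x)) = 0"
  proof (rule transfer3)
    fix n and e :: "nat \<Rightarrow> nat set set"
    assume "partition_lattice_ge_2 n" and e: "partition_on {1..n} (e 0)" "partition_on {1..n} (e 1)"
    interpret partition_lattice_ge_2 n by fact
    let ?P = "partition_lattice n"
    obtain a b where ab: "a \<in> carrier ?P" "b \<in> carrier ?P" "separation_defect ?P (e 0) (e 1) a b = 0"
      using separation_defect_witness[OF e] unfolding carrier_iff by blast
    have nonneg: "0 \<le> separation_defect ?P (e 0) (e 1) a b" for a b
      unfolding separation_defect_def by (rule clip_bounds)
    have "(INF b \<in> carrier ?P. separation_defect ?P (e 0) (e 1) a b) = 0"
      by (rule INF_eq_0[OF ab(2)]) (use ab(3) nonneg in auto)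
    then have "(INF a \<in> carrier ?P. INF b \<in> carrier ?P. separation_defect ?P (e 0) (e 1) a b) = 0"
    proof (rule INF_eq_0[where f = "\<lambda>a. INF b \<in> carrier ?P. separation_defect ?P (e 0) (e 1) a b", OF ab(1)])
      show "0 \<le> (INF b \<in> carrier ?P. separation_defect ?P (e 0) (e 1) a b)" for a
        using ab(2) nonneg by (intro cINF_greatest) auto
    qed
    then show "fml_val ?P separation_fml e = 0" by simp
  qed (use assms in auto)
  then have "(INF a \<in> carrier M. INF b \<in> carrier M. separation_defect M x y a b) < min \<epsilon> 1"
    using \<epsilon> by simp
  then obtain a where a: "a \<in> carrier M" "(INF b \<in> carrier M. separation_defect M x y a b) < min \<epsilon> 1"
    using INF_less_witness[OF _ carrier_nonempty] by metis
  then obtain b where b: "b \<in> carrier M" "separation_defect M x y a b < min \<epsilon> 1"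
    using INF_less_witness[OF _ carrier_nonempty] by metis
  define t where "t = mnorm (x \<oplus> y) - mnorm x - selector_distance M y a - selector_distance M x b"
  have s: "selector_defect M x a + selector_defect M y b + clip t < min \<epsilon> 1"
    using le_of_clip_less[of "selector_defect M x a + selector_defect M y b + clip t"] b(2)
    unfolding separation_defect_def t_def by linarith
  then have "clip t < min \<epsilon> 1" "selector_defect M x a < \<epsilon>" "selector_defect M y b < \<epsilon>"
    using selector_defect_nonneg[of x a] selector_defect_nonneg[of y b] clip_bounds(1)[of t] by linarith+
  moreover from this(1) have "t < \<epsilon>" using le_of_clip_less[of t] by linarith
  ultimately show ?thesis using a(1) b(1) unfolding t_def by (intro bexI[of _ a] bexI[of _ b]) auto
qed

lemma point_set_dist_bounds:
  assumes "b \<in> B" "B \<subseteq> carrier M" "a \<in> carrier M"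
  shows "point_set_dist (ldist M) a B \<le> mdist a b" "point_set_dist (ldist M) a B \<le> 1"
proof -
  show le: "point_set_dist (ldist M) a B \<le> mdist a b"
    unfolding point_set_dist_def using assms nonneg by (intro cINF_lower) (auto intro: bdd_belowI[of _ 0])
  then show "point_set_dist (ldist M) a B \<le> 1" using diameter[of a b] assms by force
qed

lemma point_set_dist_le_hausdorff:
  assumes "A \<subseteq> carrier M" "B \<subseteq> carrier M" "B \<noteq> {}" "a \<in> A"
  shows "point_set_dist (ldist M) a B \<le> hausdorff_dist (ldist M) A B"
    "point_set_dist (ldist M) a B \<le> hausdorff_dist (ldist M) B A"
proof -
  have "bdd_above ((\<lambda>a. point_set_dist (ldist M) a B) ` A)"
    using assms point_set_dist_bounds(2) by (intro bdd_aboveI[of _ 1]) blast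
  then have "point_set_dist (ldist M) a B \<le> (SUP a \<in> A. point_set_dist (ldist M) a B)"
    by (rule cSUP_upper[OF assms(4)])
  then show "point_set_dist (ldist M) a B \<le> hausdorff_dist (ldist M) A B"
    "point_set_dist (ldist M) a B \<le> hausdorff_dist (ldist M) B A"
    unfolding hausdorff_dist_def by auto
qed

text \<open>The approximate selector \<open>a\<close> may be replaced by a nearby selector.\<close>

lemma selector_distance_le:
  assumes x: "x \<in> carrier M" and y: "y \<in> carrier M" and a: "a \<in> carrier M"
    and small: "selector_defect M x a < \<epsilon>" and \<epsilon>: "0 < \<epsilon>"
  shows "\<exists>a' \<in> selectors M x. selector_distance M y a \<le> point_set_dist (ldist M) a' (selectors M y) + 36 * \<epsilon>"
proof -
  obtain a' where a': "a' \<in> selectors M x" "mdist a a' \<le> mdist x x + 35 * selector_defect M x a + \<epsilon>"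
    using selector_move[OF x x a \<epsilon>] by blast
  have a'C: "a' \<in> carrier M" using a'(1) selectors_closed by blast
  have "selector_distance M y a - 36 * \<epsilon> \<le> mdist a' b" if b: "b \<in> selectors M y" for b
  proof -
    have bC: "b \<in> carrier M" using b selectors_closed by blast
    have "selector_distance M y a \<le> clip (mdist a b + 35 * selector_defect M y b)"
      unfolding selector_distance_def using clip_bounds by (intro cINF_lower[OF _ bC]) (auto intro: bdd_belowI[of _ 0])
    moreover have "selector_defect M y b = 0" using selector_defect_eq_0_iff[OF y bC] b by simp
    moreover have "clip (mdist a b) = mdist a b" using nonneg diameter[OF a bC] by (rule clip_id)
    moreover have "mdist x x = 0" using x by simp
    ultimately show ?thesis using triangle[OF a a'C bC] a'(2) small by simp
  qed
  then have "selector_distance M y a - 36 * \<epsilon> \<le> point_set_dist (ldist M) a' (selectors M y)"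
    unfolding point_set_dist_def using selectors_nonempty[OF y] by (intro cINF_greatest) auto
  then show ?thesis using a'(1) by force
qed

text \<open>The Hausdorff distance bounds both distances in the separation, whose sum is at least
  \<open>d(x, x + y)\<close> up to \<open>\<delta>\<close>.  This is where the factor 2 comes from.\<close>

lemma mdist_join_le_hausdorff:
  assumes x: "x \<in> carrier M" and y: "y \<in> carrier M"
  shows "mdist x (x \<oplus> y) \<le> 2 * hausdorff_dist (ldist M) (selectors M x) (selectors M y)"
proof (rule field_le_epsilon)
  fix \<delta> :: real assume "0 < \<delta>"
  \<comment> \<open>The separation costs \<open>\<epsilon>\<close> and replacing approximate selectors by selectors costs \<open>36 \<epsilon>\<close> on
    each side.\<close>
  define \<epsilon> where "\<epsilon> = \<delta> / 73"
  have \<epsilon>: "0 < \<epsilon>" unfolding \<epsilon>_def using \<open>0 < \<delta>\<close> by simp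
  let ?D = "hausdorff_dist (ldist M) (selectors M x) (selectors M y)"
  obtain a b where ab: "a \<in> carrier M" "b \<in> carrier M" "selector_defect M x a < \<epsilon>" "selector_defect M y b < \<epsilon>"
    and gap: "mnorm (x \<oplus> y) - mnorm x < selector_distance M y a + selector_distance M x b + \<epsilon>"
    using separation_witness[OF x y \<epsilon>] by blast
  obtain a' where a': "a' \<in> selectors M x"
    "selector_distance M y a \<le> point_set_dist (ldist M) a' (selectors M y) + 36 * \<epsilon>"
    using selector_distance_le[OF x y ab(1,3) \<epsilon>] by blast
  obtain b' where b': "b' \<in> selectors M y"
    "selector_distance M x b \<le> point_set_dist (ldist M) b' (selectors M x) + 36 * \<epsilon>"
    using selector_distance_le[OF y x ab(2,4) \<epsilon>] by blast
  have "point_set_dist (ldist M) a' (selectors M y) \<le> ?D"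
    by (rule point_set_dist_le_hausdorff(1)[OF selectors_closed selectors_closed selectors_nonempty[OF y] a'(1)])
  moreover have "point_set_dist (ldist M) b' (selectors M x) \<le> ?D"
    by (rule point_set_dist_le_hausdorff(2)[OF selectors_closed selectors_closed selectors_nonempty[OF x] b'(1)])
  ultimately show "mdist x (x \<oplus> y) \<le> 2 * ?D + \<delta>"
    using gap a'(2) b'(2) mdist_mplus(1)[OF x y] unfolding \<epsilon>_def by argo
qed

lemma point_set_dist_selectors_le:
  assumes x: "x \<in> carrier M" and y: "y \<in> carrier M" and a: "a \<in> selectors M x"
  shows "point_set_dist (ldist M) a (selectors M y) \<le> mdist x y"
proof (rule field_le_epsilon)
  fix \<epsilon> :: real assume \<epsilon>: "0 < \<epsilon>"
  have aC: "a \<in> carrier M" using a selectors_closed by blast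
  obtain b where b: "b \<in> selectors M y" "mdist a b \<le> mdist x y + 35 * selector_defect M x a + \<epsilon>"
    using selector_move[OF x y aC \<epsilon>] by blast
  have "selector_defect M x a = 0" using selector_defect_eq_0_iff[OF x aC] a by simp
  then show "point_set_dist (ldist M) a (selectors M y) \<le> mdist x y + \<epsilon>"
    using point_set_dist_bounds(1)[OF b(1) selectors_closed aC] b(2) by simp
qed

lemma hausdorff_selectors_le:
  assumes x: "x \<in> carrier M" and y: "y \<in> carrier M"
  shows "hausdorff_dist (ldist M) (selectors M x) (selectors M y) \<le> mdist x y"
  unfolding hausdorff_dist_def
proof (rule max.boundedI)
  show "(SUP a \<in> selectors M x. point_set_dist (ldist M) a (selectors M y)) \<le> mdist x y"
    using selectors_nonempty[OF x] point_set_dist_selectors_le[OF x y] by (rule cSUP_least)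
  show "(SUP b \<in> selectors M y. point_set_dist (ldist M) b (selectors M x)) \<le> mdist x y"
    using selectors_nonempty[OF y] point_set_dist_selectors_le[OF y x] commute[of x y]
    by (intro cSUP_least) auto
qed

lemma mdist_le_hausdorff:
  assumes x: "x \<in> carrier M" and y: "y \<in> carrier M"
  shows "mdist x y \<le> 4 * hausdorff_dist (ldist M) (selectors M x) (selectors M y)"
proof -
  have "hausdorff_dist (ldist M) (selectors M y) (selectors M x) = hausdorff_dist (ldist M) (selectors M x) (selectors M y)"
    unfolding hausdorff_dist_def by (simp add: max.commute)
  then have "mdist y (x \<oplus> y) \<le> 2 * hausdorff_dist (ldist M) (selectors M x) (selectors M y)"
    using mdist_join_le_hausdorff[OF y x] mplus_commute[OF x y] by simp
  then show ?thesis
    using mdist_join_le_hausdorff[OF x y] triangle[of x "x \<oplus> y" y] commute[of "x \<oplus> y" y] x y by simp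
qed

end

theorem proposition6p35:
  fixes M :: "'a fpl_str"
  assumes "models_T_FPL M"
  shows "(\<forall>x \<in> carrier M. \<forall>y \<in> carrier M.
            ldist M x (lplus M x y)
              \<le> 2 * hausdorff_dist (ldist M) (selectors M x) (selectors M y)) \<and>
         (\<forall>x \<in> carrier M. \<forall>y \<in> carrier M.
            ldist M x y \<le> 4 * hausdorff_dist (ldist M) (selectors M x) (selectors M y) \<and>
            4 * hausdorff_dist (ldist M) (selectors M x) (selectors M y) \<le> 4 * ldist M x y)"
proof -
  interpret fpl_structure M using assms unfolding models_T_FPL_def by simp
  interpret FPL_model M by unfold_locales (rule assms)
  show ?thesis using mdist_join_le_hausdorff mdist_le_hausdorff hausdorff_selectors_le by simp
qed

end
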